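(* In the multidimensional Black–Scholes setting of the context, fix $t>0$, suppose all weights $\xi_1,\dots,\xi_n$ are positive and that Assumption $(\mathcal A)$ holds for $\mathfrak B$. Put $\bar S=\bar A_1+\dots+\bar A_{\bar n}$. Then, as $x\to0$: (1) if $1\le i\le\bar n$, $e_i(t,x)=\frac{x}{\xi_i}\frac{\bar A_i}{\bar S}\left(1+O\left((\log\frac1x)^{-1}\right)\right)=x\frac{\bar w_i}{\xi_i}\left(1+O\left((\log\frac1x)^{-1}\right)\right)$; (2) if $\bar n<i\le n$, $$e_i(t,x)=x^{\sum_{j=1}^{\bar n}\bar A_jb_{ij}}S^i_0\exp\left\{\theta_it-\sum_{p,q=1}^{\bar n}b_{pi}\bar a_{pq}\left(\log\tfrac{\bar S}{\bar A_q}+\mu_{q,t}\right)\right\}\exp\left\{-\tfrac t2\sum_{p,q=1}^{\bar n}\bar a_{pq}b_{pi}b_{qi}\right\}\left(1+O\left(\left(\log\tfrac1x\right)^{-1}\right)\right).$$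
   Context: Let $\mathfrak B=(b_{ij})$ be an $n\times n$ positive definite covariance matrix, $\theta\in\mathbb R^n$, $W$ an $n$-dimensional standard Brownian motion, and asset prices $S_t=(S^1_t,\dots,S^n_t)$ with $\log S_t=\log S_0+\theta t-\frac t2\operatorname{diag}(\mathfrak B)+\mathfrak B^{1/2}W_t$ (componentwise, $\operatorname{diag}(\mathfrak B)=(b_{11},\dots,b_{nn})$), $S_0\in(0,\infty)^n$. Given weights $\xi_i$, set $\mu_{i,t}=\log S^i_0+\log|\xi_i|+\theta_it-\frac{b_{ii}t}{2}$ and $e_i(t,x)=\mathbb E[S^i_t\mid\sum_{k=1}^n\xi_kS^k_t=x]$. Let $\Delta_n=\{w\in\mathbb R^n:w_i\ge0,\sum_iw_i=1\}$, $\bar w$ the unique minimizer of $w^\top\mathfrak Bw$ over $\Delta_n$, $\bar I=\{i:\bar w_i\ne0\}$, $\bar n=|\bar I|$, with assets labeled so that $\bar I=\{1,\dots,\bar n\}$. Let $\bar{\mathfrak B}=(b_{ij})_{i,j=1}^{\bar n}$, $\bar a_{ij}$ the entries of $\bar{\mathfrak B}^{-1}$, $\bar A_k=\sum_{j=1}^{\bar n}\bar a_{kj}$. Assumption $(\mathcal A)$: for every $i\notin\bar I$, $(e^i-\bar w)^\top\mathfrak B\bar w\ne0$, with $e^i$ the $i$-th standard basis vector. *)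

theory Defs
  imports "HOL-Probability.Probability" "HOL-Library.Landau_Symbols"
begin

text \<open>Square matrices of size n are represented as functions nat => nat => real,
  vectors as nat => real; only indices below n are relevant.\<close>

definition quad_form :: "nat \<Rightarrow> (nat \<Rightarrow> nat \<Rightarrow> real) \<Rightarrow> (nat \<Rightarrow> real) \<Rightarrow> real" where
  "quad_form n B v = (\<Sum>i<n. \<Sum>j<n. v i * B i j * v j)"

definition sym_mat :: "nat \<Rightarrow> (nat \<Rightarrow> nat \<Rightarrow> real) \<Rightarrow> bool" where
  "sym_mat n B \<longleftrightarrow> (\<forall>i<n. \<forall>j<n. B i j = B j i)"

definition pos_def :: "nat \<Rightarrow> (nat \<Rightarrow> nat \<Rightarrow> real) \<Rightarrow> bool" where
  "pos_def n B \<longleftrightarrow> sym_mat n B \<and> (\<forall>v. (\<exists>i<n. v i \<noteq> 0) \<longrightarrow> quad_form n B v > 0)"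

definition mat_sqrt :: "nat \<Rightarrow> (nat \<Rightarrow> nat \<Rightarrow> real) \<Rightarrow> (nat \<Rightarrow> nat \<Rightarrow> real)" where
  "mat_sqrt n B = (THE R. (\<forall>i j. (n \<le> i \<or> n \<le> j) \<longrightarrow> R i j = 0) \<and> sym_mat n R
      \<and> (\<forall>v. quad_form n R v \<ge> 0)
      \<and> (\<forall>i<n. \<forall>j<n. (\<Sum>k<n. R i k * R k j) = B i j))"

definition std_simplex :: "nat \<Rightarrow> (nat \<Rightarrow> real) set" where
  "std_simplex n = {w. (\<forall>i<n. 0 \<le> w i) \<and> (\<forall>i\<ge>n. w i = 0) \<and> (\<Sum>i<n. w i) = 1}"

definition min_var_weights :: "nat \<Rightarrow> (nat \<Rightarrow> nat \<Rightarrow> real) \<Rightarrow> (nat \<Rightarrow> real)" where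
  "min_var_weights n B = (THE w. w \<in> std_simplex n \<and> (\<forall>v\<in>std_simplex n. quad_form n B w \<le> quad_form n B v))"

definition support_set :: "nat \<Rightarrow> (nat \<Rightarrow> nat \<Rightarrow> real) \<Rightarrow> nat set" where
  "support_set n B = {i. i < n \<and> min_var_weights n B i \<noteq> 0}"

definition restr_inv :: "nat set \<Rightarrow> (nat \<Rightarrow> nat \<Rightarrow> real) \<Rightarrow> (nat \<Rightarrow> nat \<Rightarrow> real)" where
  "restr_inv I B = (THE a. (\<forall>i\<in>I. \<forall>j\<in>I. (\<Sum>k\<in>I. B i k * a k j) = (if i = j then 1 else 0))
      \<and> (\<forall>i j. (i \<notin> I \<or> j \<notin> I) \<longrightarrow> a i j = 0))"

definition assumption_A :: "nat \<Rightarrow> (nat \<Rightarrow> nat \<Rightarrow> real) \<Rightarrow> bool" where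
  "assumption_A n B \<longleftrightarrow> (\<forall>i<n. i \<notin> support_set n B \<longrightarrow>
      (\<Sum>j<n. \<Sum>k<n. ((if j = i then 1 else 0) - min_var_weights n B j) * B j k * min_var_weights n B k) \<noteq> 0)"

end

theory Submission
  imports Defs "HOL-Real_Asymp.Real_Asymp"
begin

text \<open>Write \<open>X\<^sub>k = log (\<xi>\<^sub>k S\<^sub>k)\<close>, \<open>Y = \<Sum> exp X\<^sub>k\<close>, \<open>L = log (1/x)\<close>. Since \<open>\<xi>\<^sub>i e\<^sub>i(x)\<close> is the value at 1 of the
  conditional moment generating function \<open>s \<mapsto> E[exp (s X\<^sub>i) | Y = x]\<close>, its logarithm is the integral
  over \<open>s \<in> [0,1]\<close> of the mean of \<open>X\<^sub>i\<close> under the tilted conditional law, which is again the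
  conditional law of a Gaussian vector with shifted mean. It therefore suffices to compute the
  conditional mean of \<open>X\<^sub>i\<close> up to \<open>O(1/L)\<close>, uniformly in \<open>s\<close>. No Laplace asymptotics of densities are
  used: Gaussian integration by parts along vector fields tangent to the level sets of \<open>Y\<close> gives
  exact identities for conditional expectations. Applied to the deviation \<open>v\<close> of \<open>X\<close> from its
  predicted value, in all coordinates at once, it yields an energy identity which bounds the inverse
  covariance form of \<open>v\<close> by \<open>O(1)\<close>, the relative entropy of the optimal weights with respect to the
  fractions \<open>exp X\<^sub>k / x\<close> by \<open>O(1/L)\<close>, and the fractions outside the support by \<open>O(1/L\<^sup>2)\<close>; two further
  identities then control the mean of every component of \<open>v\<close>. The weight \<open>g(Y)\<close>, with a bump \<open>g\<close>
  concentrated near \<open>x\<close>, replaces conditioning on \<open>Y = x\<close>.\<close>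

section \<open>Positive definite matrices and minimum variance weights\<close>


text \<open>The energy identity alone is too weak: entropy of order \<open>1/L\<close> still lets
  deviations on the support fluctuate at size \<open>L\<close> to the power -1/2, while means of
  order \<open>1/L\<close> are wanted. The gain is a cancellation: the remainder
  \<open>exp v - 1 - v\<close> is nonnegative and paid for by the entropy, so an identity that is
  linear in \<open>v\<close> to first order leaves only errors already under control. The second
  direction of the tangent field is always \<open>\<beta> = B A\<close>. It is 1 on the support and,
  by Assumption (A), at least \<open>1 + b\<close> off it; this gap is what makes the tail fractions
  small. Paired with the Gaussian score it removes the inverse covariance and leaves the scalar
  \<open>a + L * S - bd\<close>. The prediction is the tilted mean shifted by
  \<open>B (d - L A)\<close> with \<open>d\<close> and \<open>A\<close> supported on the active set:
  optimal weights there, Gaussian regression elsewhere. It is affine in \<open>s\<close>, so its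
  integral over [0,1] is its value at 1/2. That integral is realised without differentiating in
  \<open>s\<close>: a product of small tilts, each bounded below through
  \<open>1 + z \<le> exp z\<close>, and the same product run backwards for the upper bound.\<close>

lemma compact_Pi_UNIV:
  fixes T :: "'a \<Rightarrow> 'b::topological_space set"
  assumes "\<And>i. compact (T i)"
  shows "compact {f. \<forall>i. f i \<in> T i}"
proof -
  have "compactin (product_topology (\<lambda>_. euclidean) UNIV) (Pi\<^sub>E UNIV T)"
    using assms by (subst compactin_PiE) auto
  moreover have "Pi\<^sub>E UNIV T = {f. \<forall>i. f i \<in> T i}" by auto
  ultimately show ?thesis by (simp add: euclidean_product_topology)
qed

lemma continuous_on_entry: "continuous_on S (\<lambda>Q :: 'a \<Rightarrow> 'b \<Rightarrow> real. Q i j)"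
  by (rule continuous_on_product_then_coordinatewise, rule continuous_on_subset[OF continuous_on_product_coordinates subset_UNIV])

lemma continuous_on_coord: "continuous_on S (\<lambda>v :: 'a \<Rightarrow> real. v i)"
  by (rule continuous_on_subset[OF continuous_on_product_coordinates subset_UNIV])

definition orthonormal_columns :: "nat \<Rightarrow> (nat \<Rightarrow> nat \<Rightarrow> real) \<Rightarrow> bool" where
  "orthonormal_columns n Q \<longleftrightarrow> (\<forall>i<n. \<forall>j<n. (\<Sum>k<n. Q k i * Q k j) = of_bool (i = j))"

text \<open>Rows and columns are both required to be orthonormal, so that neither property has to be
  derived from the other; the zero padding makes the set compact as a set of functions on all of
  \<open>nat\<close>.\<close>

definition orthogonal_mats :: "nat \<Rightarrow> (nat \<Rightarrow> nat \<Rightarrow> real) set" where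
  "orthogonal_mats n = {Q. (\<forall>i j. n \<le> i \<or> n \<le> j \<longrightarrow> Q i j = 0)
     \<and> orthonormal_columns n Q \<and> orthonormal_columns n (\<lambda>i j. Q j i)}"

lemma orthogonal_entry_bound:
  assumes "Q \<in> orthogonal_mats n"
  shows "\<bar>Q i j\<bar> \<le> 1"
proof (cases "i < n \<and> j < n")
  case True
  have "(Q i j)\<^sup>2 \<le> (\<Sum>k<n. (Q k j)\<^sup>2)" using True by (intro member_le_sum) auto
  also have "\<dots> = 1"
    using assms True unfolding orthogonal_mats_def orthonormal_columns_def by (simp add: power2_eq_square)
  finally show ?thesis by (simp add: abs_square_le_1)
next
  case False
  then show ?thesis using assms unfolding orthogonal_mats_def by (auto simp: not_less)
qed

text \<open>The entries lie in a Tychonoff box, \<open>[-1, 1]\<close> inside the block and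
  \<open>{0}\<close> outside, of which the orthogonality equations cut out a closed part.\<close>

lemma compact_orthogonal_mats: "compact (orthogonal_mats n)"
proof -
  define T where "T i j = (if i < n \<and> j < n then {-1..1::real} else {0})" for i j
  have 1: "compact {Q. \<forall>i. Q i \<in> {r. \<forall>j. r j \<in> T i j}}"
    by (intro compact_Pi_UNIV) (auto simp: T_def)
  have 2: "closed {Q :: nat \<Rightarrow> nat \<Rightarrow> real. orthonormal_columns n Q \<and> orthonormal_columns n (\<lambda>i j. Q j i)}"
    unfolding orthonormal_columns_def
    by (intro closed_Collect_conj closed_Collect_all closed_Collect_imp closed_Collect_eq
        continuous_on_sum continuous_on_mult continuous_on_entry continuous_on_const) auto
  have "orthogonal_mats n = {Q. \<forall>i. Q i \<in> {r. \<forall>j. r j \<in> T i j}}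
      \<inter> {Q. orthonormal_columns n Q \<and> orthonormal_columns n (\<lambda>i j. Q j i)}"
  proof (intro set_eqI iffI)
    fix Q assume Q: "Q \<in> orthogonal_mats n"
    have "- 1 \<le> Q i j \<and> Q i j \<le> 1" for i j using orthogonal_entry_bound[OF Q, of i j] by linarith
    then show "Q \<in> {Q. \<forall>i. Q i \<in> {r. \<forall>j. r j \<in> T i j}}
      \<inter> {Q. orthonormal_columns n Q \<and> orthonormal_columns n (\<lambda>i j. Q j i)}"
      using Q unfolding orthogonal_mats_def T_def by (auto simp: not_less)
  next
    fix Q assume "Q \<in> {Q. \<forall>i. Q i \<in> {r. \<forall>j. r j \<in> T i j}}
      \<inter> {Q. orthonormal_columns n Q \<and> orthonormal_columns n (\<lambda>i j. Q j i)}"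
    then show "Q \<in> orthogonal_mats n"
      unfolding orthogonal_mats_def T_def by (auto split: if_splits) (metis not_less singletonD)+
  qed
  then show ?thesis using compact_Int_closed[OF 1 2] by simp
qed

section \<open>Orthogonal diagonalisation of symmetric matrices\<close>

definition conj_mat :: "nat \<Rightarrow> (nat \<Rightarrow> nat \<Rightarrow> real) \<Rightarrow> (nat \<Rightarrow> nat \<Rightarrow> real) \<Rightarrow> nat \<Rightarrow> nat \<Rightarrow> real" where
  "conj_mat n B Q k l = (\<Sum>i<n. \<Sum>j<n. Q i k * B i j * Q j l)"

lemma sum_split_pair:
  fixes f :: "nat \<Rightarrow> real"
  assumes "k < n" "l < n" "k \<noteq> l"
  shows "(\<Sum>a<n. f a) = f k + f l + (\<Sum>a\<in>{..<n} - {k, l}. f a)"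
proof -
  have "(\<Sum>a<n. f a) = f k + (\<Sum>a\<in>{..<n} - {k}. f a)"
    using assms by (intro sum.remove) auto
  also have "(\<Sum>a\<in>{..<n} - {k}. f a) = f l + (\<Sum>a\<in>{..<n} - {k} - {l}. f a)"
    using assms by (intro sum.remove) auto
  also have "{..<n} - {k} - {l} = {..<n} - {k, l}" by auto
  finally show ?thesis by simp
qed

text \<open>Jacobi's argument: at an orthogonal \<open>Q\<close> maximising the sum of the squared diagonal entries of
  \<open>Q\<^sup>T B Q\<close>, no plane rotation can increase this sum, so the off-diagonal entries vanish.\<close>

theorem spectral_decomposition:
  assumes sym: "sym_mat n B"
  obtains Q ev where "Q \<in> orthogonal_mats n"
    "\<And>i j. i < n \<Longrightarrow> j < n \<Longrightarrow> B i j = (\<Sum>k<n. ev k * Q i k * Q j k)"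
    "\<And>k. k < n \<Longrightarrow> ev k = quad_form n B (\<lambda>i. Q i k)"
proof -
  define F where "F Q = (\<Sum>k<n. (conj_mat n B Q k k)\<^sup>2)" for Q
  have "continuous_on (orthogonal_mats n) F"
    unfolding F_def conj_mat_def
    by (intro continuous_on_sum continuous_on_mult continuous_on_power continuous_on_entry continuous_on_const)
  moreover have "(\<lambda>i j. of_bool (i = j \<and> i < n)) \<in> orthogonal_mats n"
    unfolding orthogonal_mats_def orthonormal_columns_def
    by (auto simp: of_bool_def if_distrib[of "\<lambda>x. x * _"] cong: if_cong)
  ultimately obtain Q where Q: "Q \<in> orthogonal_mats n" and max: "\<And>Q'. Q' \<in> orthogonal_mats n \<Longrightarrow> F Q' \<le> F Q"
    using continuous_attains_sup[OF compact_orthogonal_mats] by blast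
  have Q0: "\<And>i j. n \<le> i \<or> n \<le> j \<Longrightarrow> Q i j = 0"
    and QQ: "\<And>i j. i < n \<Longrightarrow> j < n \<Longrightarrow> (\<Sum>k<n. Q k i * Q k j) = of_bool (i = j)"
    and QQ': "\<And>i j. i < n \<Longrightarrow> j < n \<Longrightarrow> (\<Sum>k<n. Q i k * Q j k) = of_bool (i = j)"
    using Q unfolding orthogonal_mats_def orthonormal_columns_def by blast+
  define D where "D = conj_mat n B Q"
  have D_sym: "D k l = D l k" for k l
  proof -
    have "D k l = (\<Sum>j<n. \<Sum>i<n. Q i k * B i j * Q j l)"
      unfolding D_def conj_mat_def by (rule sum.swap)
    also have "\<dots> = D l k"
      unfolding D_def conj_mat_def using sym unfolding sym_mat_def
      by (intro sum.cong refl) (simp add: mult_ac)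
    finally show ?thesis .
  qed
  have off: "D k l = 0" if kl: "k < n" "l < n" "k \<noteq> l" for k l
  proof (rule ccontr)
    assume D0: "D k l \<noteq> 0"
    \<comment> \<open>\<open>\<delta>\<close> and \<open>2 * D k l\<close> are the legs of a right
      triangle with hypotenuse \<open>r\<close> and angle \<open>\<phi>\<close>. Rotating columns
      \<open>k\<close> and \<open>l\<close> by half of \<open>\<phi>\<close> keeps the sum of the
      two diagonal entries and turns their difference \<open>\<delta>\<close> into
      \<open>r\<close>.\<close>
    define \<delta> where "\<delta> = D k k - D l l"
    define r where "r = sqrt (\<delta>\<^sup>2 + (2 * D k l)\<^sup>2)"
    have "0 < \<delta>\<^sup>2 + (2 * D k l)\<^sup>2" using D0 by (simp add: add_nonneg_pos)
    then have r: "0 < r" "r\<^sup>2 = \<delta>\<^sup>2 + (2 * D k l)\<^sup>2" unfolding r_def by auto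
    have "(\<delta> / r)\<^sup>2 + (2 * D k l / r)\<^sup>2 = 1"
      unfolding power_divide add_divide_distrib[symmetric] r(2)[symmetric] using r(1) by simp
    then obtain \<phi> where \<phi>: "\<delta> / r = cos \<phi>" "2 * D k l / r = sin \<phi>"
      using sincos_total_2pi by metis
    define c s where "c = cos (\<phi> / 2)" and "s = sin (\<phi> / 2)"
    have cs: "c\<^sup>2 + s\<^sup>2 = 1" unfolding c_def s_def by simp
    have cos: "c\<^sup>2 - s\<^sup>2 = cos \<phi>" using cos_double[of "\<phi> / 2"] unfolding c_def s_def by simp
    have sin: "2 * s * c = sin \<phi>" using sin_double[of "\<phi> / 2"] unfolding c_def s_def by simp
    \<comment> \<open>Uniform encoding of the rotation: column \<open>a\<close> of \<open>Q'\<close>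
      combines columns \<open>x a\<close> and \<open>y a\<close> with coefficients
      \<open>p a\<close> and \<open>q a\<close>. Columns \<open>k\<close> and \<open>l\<close> both
      draw on the pair \<open>k\<close>, \<open>l\<close>; every other column is kept, with
      coefficients 1 and 0.\<close>
    define p where "p a = (if a = k then c else if a = l then - s else 1)" for a
    define q where "q a = (if a = k then s else if a = l then c else 0)" for a
    define x where "x a = (if a = l then k else a)" for a
    define y where "y a = (if a = k then l else a)" for a
    have xy: "x a < n" "y a < n" if "a < n" for a using that kl unfolding x_def y_def by auto
    define Q' where "Q' i a = p a * Q i (x a) + q a * Q i (y a)" for i a
    have G: "(\<Sum>i<n. Q' i a * Q' i e) = p a * p e * of_bool (x a = x e) + p a * q e * of_bool (x a = y e)
        + q a * p e * of_bool (y a = x e) + q a * q e * of_bool (y a = y e)" if "a < n" "e < n" for a e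
    proof -
      have "(\<Sum>i<n. Q' i a * Q' i e) = p a * p e * (\<Sum>i<n. Q i (x a) * Q i (x e)) + p a * q e * (\<Sum>i<n. Q i (x a) * Q i (y e))
        + q a * p e * (\<Sum>i<n. Q i (y a) * Q i (x e)) + q a * q e * (\<Sum>i<n. Q i (y a) * Q i (y e))"
        unfolding Q'_def by (simp add: algebra_simps sum.distrib sum_distrib_left)
      then show ?thesis using QQ xy[OF that(1)] xy[OF that(2)] by simp
    qed
    have D': "conj_mat n B Q' a a = p a * p a * D (x a) (x a) + p a * q a * D (x a) (y a)
        + q a * p a * D (y a) (x a) + q a * q a * D (y a) (y a)" for a
      unfolding D_def conj_mat_def Q'_def by (simp add: algebra_simps sum.distrib sum_distrib_left)
    have "Q' \<in> orthogonal_mats n"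
      unfolding orthogonal_mats_def orthonormal_columns_def
    proof (intro CollectI conjI allI impI)
      show "Q' i a = 0" if "n \<le> i \<or> n \<le> a" for i a
        using that kl Q0[of i "x a"] Q0[of i "y a"] Q0[of i a] unfolding Q'_def x_def y_def p_def q_def by (auto split: if_splits)
      show "(\<Sum>i<n. Q' i a * Q' i e) = of_bool (a = e)" if "a < n" "e < n" for a e
        unfolding G[OF that] using cs kl
        by (auto simp: p_def q_def x_def y_def power2_eq_square split: if_splits)
      show "(\<Sum>a<n. Q' i a * Q' j a) = of_bool (i = j)" if "i < n" "j < n" for i j
      proof -
        have "(\<Sum>a\<in>{..<n} - {k, l}. Q' i a * Q' j a) = (\<Sum>a\<in>{..<n} - {k, l}. Q i a * Q j a)"
          by (intro sum.cong refl) (auto simp: Q'_def p_def q_def x_def y_def)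
        moreover have "Q' i k * Q' j k + Q' i l * Q' j l = (c\<^sup>2 + s\<^sup>2) * (Q i k * Q j k + Q i l * Q j l)"
          using kl by (simp add: Q'_def p_def q_def x_def y_def algebra_simps power2_eq_square)
        ultimately have "(\<Sum>a<n. Q' i a * Q' j a) = (\<Sum>a<n. Q i a * Q j a)"
          unfolding sum_split_pair[OF kl] cs by simp
        then show ?thesis using QQ'[OF that] by simp
      qed
    qed
    then have "F Q' \<le> F Q" by (rule max)
    moreover have "(\<Sum>a\<in>{..<n} - {k, l}. (conj_mat n B Q' a a)\<^sup>2) = (\<Sum>a\<in>{..<n} - {k, l}. (conj_mat n B Q a a)\<^sup>2)"
      unfolding D' by (intro sum.cong refl) (auto simp: p_def q_def x_def y_def D_def)
    ultimately have le: "(conj_mat n B Q' k k)\<^sup>2 + (conj_mat n B Q' l l)\<^sup>2 \<le> (D k k)\<^sup>2 + (D l l)\<^sup>2"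
      unfolding F_def sum_split_pair[OF kl] D_def by simp
    have k': "conj_mat n B Q' k k = c\<^sup>2 * D k k + 2 * s * c * D k l + s\<^sup>2 * D l l"
      unfolding D' using kl D_sym[of l k] by (simp add: p_def q_def x_def y_def power2_eq_square)
    have l': "conj_mat n B Q' l l = s\<^sup>2 * D k k - 2 * s * c * D k l + c\<^sup>2 * D l l"
      unfolding D' using kl D_sym[of l k] by (simp add: p_def q_def x_def y_def power2_eq_square)
    have sum': "conj_mat n B Q' k k + conj_mat n B Q' l l = (c\<^sup>2 + s\<^sup>2) * (D k k + D l l)"
      unfolding k' l' by (simp add: algebra_simps)
    have "conj_mat n B Q' k k - conj_mat n B Q' l l = (c\<^sup>2 - s\<^sup>2) * \<delta> + 2 * s * c * (2 * D k l)"
      unfolding k' l' \<delta>_def by (simp add: algebra_simps)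
    also have "\<dots> = (\<delta>\<^sup>2 + (2 * D k l)\<^sup>2) / r"
      unfolding cos sin \<phi>[symmetric] by (simp add: power2_eq_square add_divide_distrib)
    also have "\<dots> = r" unfolding r(2)[symmetric] using r(1) by (simp add: power2_eq_square)
    finally have diff': "conj_mat n B Q' k k - conj_mat n B Q' l l = r" .
    \<comment> \<open>Since the sum of the two entries is preserved, maximality compares the squared
      differences only: \<open>r\<^sup>2 \<le> \<delta>\<^sup>2\<close>, which forces
      \<open>D k l = 0\<close>.\<close>
    have sq: "2 * (u\<^sup>2 + v\<^sup>2) = (u + v)\<^sup>2 + (u - v)\<^sup>2" for u v :: real
      by (simp add: power2_eq_square algebra_simps)
    have "2 * ((conj_mat n B Q' k k)\<^sup>2 + (conj_mat n B Q' l l)\<^sup>2) = (D k k + D l l)\<^sup>2 + r\<^sup>2"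
      unfolding sq sum' diff' cs by simp
    moreover have "2 * ((D k k)\<^sup>2 + (D l l)\<^sup>2) = (D k k + D l l)\<^sup>2 + \<delta>\<^sup>2"
      unfolding sq \<delta>_def by simp
    moreover have "x \<le> y" if "2 * P = S + x" "2 * R = S + y" "P \<le> R" for P R S x y :: real
      using that by linarith
    ultimately have "r\<^sup>2 \<le> \<delta>\<^sup>2" using le by blast
    then show False using r(2) D0 by simp
  qed
  have "B i j = (\<Sum>k<n. D k k * Q i k * Q j k)" if ij: "i < n" "j < n" for i j
  proof -
    have "(\<Sum>k<n. D k k * Q i k * Q j k) = (\<Sum>k<n. \<Sum>l<n. Q i k * D k l * Q j l)"
    proof (intro sum.cong refl)
      fix k assume "k \<in> {..<n}"
      then have "(\<Sum>l<n. Q i k * D k l * Q j l) = (\<Sum>l<n. if l = k then Q i k * D k k * Q j k else 0)"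
        using off by (intro sum.cong refl) auto
      then show "D k k * Q i k * Q j k = (\<Sum>l<n. Q i k * D k l * Q j l)"
        using \<open>k \<in> {..<n}\<close> by (simp add: mult_ac)
    qed
    also have "\<dots> = (\<Sum>k<n. \<Sum>l<n. \<Sum>u<n. \<Sum>v<n. (Q i k * Q u k) * B u v * (Q j l * Q v l))"
      unfolding D_def conj_mat_def by (simp add: sum_distrib_left sum_distrib_right mult_ac)
    also have "\<dots> = (\<Sum>u<n. \<Sum>v<n. \<Sum>k<n. \<Sum>l<n. (Q i k * Q u k) * B u v * (Q j l * Q v l))"
    proof -
      let ?g = "\<lambda>k l u v. (Q i k * Q u k) * B u v * (Q j l * Q v l)"
      have "(\<Sum>k<n. \<Sum>l<n. \<Sum>u<n. \<Sum>v<n. ?g k l u v) = (\<Sum>k<n. \<Sum>u<n. \<Sum>l<n. \<Sum>v<n. ?g k l u v)"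
        by (rule sum.cong[OF refl], rule sum.swap)
      also have "\<dots> = (\<Sum>u<n. \<Sum>k<n. \<Sum>l<n. \<Sum>v<n. ?g k l u v)" by (rule sum.swap)
      also have "\<dots> = (\<Sum>u<n. \<Sum>k<n. \<Sum>v<n. \<Sum>l<n. ?g k l u v)"
        by (rule sum.cong[OF refl], rule sum.cong[OF refl], rule sum.swap)
      also have "\<dots> = (\<Sum>u<n. \<Sum>v<n. \<Sum>k<n. \<Sum>l<n. ?g k l u v)"
        by (rule sum.cong[OF refl], rule sum.swap)
      finally show ?thesis .
    qed
    also have "\<dots> = (\<Sum>u<n. \<Sum>v<n. (\<Sum>k<n. Q i k * Q u k) * B u v * (\<Sum>l<n. Q j l * Q v l))"
      by (simp add: sum_distrib_left sum_distrib_right mult_ac)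
    also have "\<dots> = (\<Sum>u<n. \<Sum>v<n. of_bool (i = u) * B u v * of_bool (j = v))"
      using ij by (intro sum.cong refl) (simp add: QQ')
    also have "\<dots> = B i j"
      using ij by (simp add: of_bool_def if_distrib[of "\<lambda>x. x * _"] if_distrib[of "(*) _"] cong: if_cong)
    finally show ?thesis by simp
  qed
  then show thesis
    by (rule that[OF Q, of "\<lambda>k. D k k"]) (auto simp: D_def conj_mat_def quad_form_def)
qed

text \<open>Matrices diagonal in one orthonormal basis multiply through their eigenvalues.
  Reciprocal eigenvalues then give the inverse, square roots of eigenvalues the matrix root.\<close>

lemma spectral_product:
  assumes Q: "Q \<in> orthogonal_mats n"
  shows "(\<Sum>k<n. (\<Sum>a<n. f a * Q i a * Q k a) * (\<Sum>e<n. g e * Q k e * Q j e))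
      = (\<Sum>a<n. f a * g a * Q i a * Q j a)"
proof -
  have "(\<Sum>k<n. (\<Sum>a<n. f a * Q i a * Q k a) * (\<Sum>e<n. g e * Q k e * Q j e))
     = (\<Sum>k<n. \<Sum>a<n. \<Sum>e<n. f a * g e * Q i a * Q j e * (Q k a * Q k e))"
    by (simp add: sum_product mult_ac)
  also have "\<dots> = (\<Sum>a<n. \<Sum>e<n. \<Sum>k<n. f a * g e * Q i a * Q j e * (Q k a * Q k e))"
  proof -
    let ?g = "\<lambda>k a e. f a * g e * Q i a * Q j e * (Q k a * Q k e)"
    have "(\<Sum>k<n. \<Sum>a<n. \<Sum>e<n. ?g k a e) = (\<Sum>a<n. \<Sum>k<n. \<Sum>e<n. ?g k a e)" by (rule sum.swap)
    also have "\<dots> = (\<Sum>a<n. \<Sum>e<n. \<Sum>k<n. ?g k a e)" by (rule sum.cong[OF refl], rule sum.swap)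
    finally show ?thesis .
  qed
  also have "\<dots> = (\<Sum>a<n. \<Sum>e<n. if a = e then f a * g a * Q i a * Q j a else 0)"
    using Q unfolding orthogonal_mats_def orthonormal_columns_def
    by (intro sum.cong refl) (auto simp: sum_distrib_left[symmetric])
  also have "\<dots> = (\<Sum>a<n. f a * g a * Q i a * Q j a)" by simp
  finally show ?thesis .
qed

lemma spectral_quad_form:
  "quad_form n (\<lambda>i j. \<Sum>a<n. f a * Q i a * Q j a) v = (\<Sum>a<n. f a * (\<Sum>i<n. Q i a * v i)\<^sup>2)"
proof -
  have "quad_form n (\<lambda>i j. \<Sum>a<n. f a * Q i a * Q j a) v
      = (\<Sum>i<n. \<Sum>j<n. \<Sum>a<n. f a * ((Q i a * v i) * (Q j a * v j)))"
    unfolding quad_form_def by (simp add: sum_distrib_left sum_distrib_right mult_ac)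
  also have "\<dots> = (\<Sum>a<n. \<Sum>i<n. \<Sum>j<n. f a * ((Q i a * v i) * (Q j a * v j)))"
  proof -
    let ?g = "\<lambda>i j a. f a * ((Q i a * v i) * (Q j a * v j))"
    have "(\<Sum>i<n. \<Sum>j<n. \<Sum>a<n. ?g i j a) = (\<Sum>i<n. \<Sum>a<n. \<Sum>j<n. ?g i j a)"
      by (rule sum.cong[OF refl], rule sum.swap)
    also have "\<dots> = (\<Sum>a<n. \<Sum>i<n. \<Sum>j<n. ?g i j a)" by (rule sum.swap)
    finally show ?thesis .
  qed
  also have "\<dots> = (\<Sum>a<n. f a * (\<Sum>i<n. Q i a * v i)\<^sup>2)"
    by (simp only: power2_eq_square sum_product) (simp only: sum_distrib_left)
  finally show ?thesis .
qed

lemma pos_def_spectral: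
  assumes B: "pos_def n B"
  obtains Q ev where "Q \<in> orthogonal_mats n" "\<And>k. k < n \<Longrightarrow> 0 < ev k"
    "\<And>i j. i < n \<Longrightarrow> j < n \<Longrightarrow> B i j = (\<Sum>k<n. ev k * Q i k * Q j k)"
proof -
  have "sym_mat n B" using B unfolding pos_def_def by simp
  from spectral_decomposition[OF this] obtain Q ev where Q: "Q \<in> orthogonal_mats n"
    "\<And>i j. i < n \<Longrightarrow> j < n \<Longrightarrow> B i j = (\<Sum>k<n. ev k * Q i k * Q j k)"
    "\<And>k. k < n \<Longrightarrow> ev k = quad_form n B (\<lambda>i. Q i k)"
    by blast
  have "0 < ev k" if k: "k < n" for k
  proof -
    have "(\<Sum>i<n. Q i k * Q i k) = 1"
      using Q(1) k unfolding orthogonal_mats_def orthonormal_columns_def by simp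
    have "\<exists>i<n. Q i k \<noteq> 0"
    proof (rule ccontr)
      assume "\<not> (\<exists>i<n. Q i k \<noteq> 0)"
      then have "(\<Sum>i<n. Q i k * Q i k) = 0" by (intro sum.neutral) auto
      then show False using \<open>(\<Sum>i<n. Q i k * Q i k) = 1\<close> by linarith
    qed
    then show ?thesis using B Q(3)[OF k] unfolding pos_def_def by simp
  qed
  then show thesis using that Q by blast
qed

lemma pos_def_inverse:
  assumes B: "pos_def n B"
  obtains K where "sym_mat n K" "\<And>v. 0 \<le> quad_form n K v"
    "\<And>i j. i < n \<Longrightarrow> j < n \<Longrightarrow> (\<Sum>k<n. K i k * B k j) = of_bool (i = j)"
    "\<And>i j. i < n \<Longrightarrow> j < n \<Longrightarrow> (\<Sum>k<n. B i k * K k j) = of_bool (i = j)"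
proof -
  obtain Q ev where Q: "Q \<in> orthogonal_mats n" "\<And>k. k < n \<Longrightarrow> 0 < ev k"
    "\<And>i j. i < n \<Longrightarrow> j < n \<Longrightarrow> B i j = (\<Sum>k<n. ev k * Q i k * Q j k)"
    using pos_def_spectral[OF B] by blast
  define K where "K i j = (\<Sum>a<n. (1 / ev a) * Q i a * Q j a)" for i j
  have one: "(\<Sum>a<n. Q i a * Q j a) = of_bool (i = j)" if "i < n" "j < n" for i j
    using Q(1) that unfolding orthogonal_mats_def orthonormal_columns_def by auto
  show thesis
  proof
    show "sym_mat n K" unfolding sym_mat_def K_def by (simp add: mult_ac)
    show "0 \<le> quad_form n K v" for v
      unfolding K_def spectral_quad_form using Q(2)
      by (intro sum_nonneg mult_nonneg_nonneg) (auto simp: less_imp_le)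
    show "(\<Sum>k<n. K i k * B k j) = of_bool (i = j)" if "i < n" "j < n" for i j
    proof -
      have "(\<Sum>k<n. K i k * B k j) = (\<Sum>a<n. (1 / ev a) * ev a * Q i a * Q j a)"
        unfolding spectral_product[OF Q(1), symmetric] K_def using that
        by (intro sum.cong refl) (simp add: Q(3))
      also have "\<dots> = (\<Sum>a<n. Q i a * Q j a)"
        by (intro sum.cong refl) (use Q(2) in force)
      finally show ?thesis using one that by simp
    qed
    show "(\<Sum>k<n. B i k * K k j) = of_bool (i = j)" if "i < n" "j < n" for i j
    proof -
      have "(\<Sum>k<n. B i k * K k j) = (\<Sum>a<n. ev a * (1 / ev a) * Q i a * Q j a)"
        unfolding spectral_product[OF Q(1), symmetric] K_def using that
        by (intro sum.cong refl) (simp add: Q(3))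
      also have "\<dots> = (\<Sum>a<n. Q i a * Q j a)"
        by (intro sum.cong refl) (use Q(2) in force)
      finally show ?thesis using one that by simp
    qed
  qed
qed

section \<open>Semidefinite quadratic forms and uniqueness of the square root\<close>

lemma quad_form_add:
  assumes "sym_mat n K"
  shows "quad_form n K (\<lambda>k. v k + u k)
    = quad_form n K v + 2 * (\<Sum>i<n. \<Sum>j<n. u i * K i j * v j) + quad_form n K u"
proof -
  have "(\<Sum>i<n. \<Sum>j<n. v i * K i j * u j) = (\<Sum>j<n. \<Sum>i<n. v i * K i j * u j)"
    by (rule sum.swap)
  also have "\<dots> = (\<Sum>i<n. \<Sum>j<n. u i * K i j * v j)"
    using assms unfolding sym_mat_def by (intro sum.cong refl) (auto simp: mult_ac)
  finally show ?thesis
    unfolding quad_form_def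
    by (simp add: distrib_left distrib_right sum.distrib)
qed

lemma quad_form_scale: "quad_form n K (\<lambda>k. c * u k) = c\<^sup>2 * quad_form n K u"
  unfolding quad_form_def sum_distrib_left
  by (intro sum.cong refl) (simp add: power2_eq_square mult_ac)

text \<open>Nonnegativity at \<open>v + u\<close> and \<open>v - u\<close>. Applied to multiples of
  \<open>u\<close>, this is Cauchy-Schwarz in a form without roots.\<close>

lemma quad_form_mixed_le:
  assumes "sym_mat n K" "\<And>v. 0 \<le> quad_form n K v"
  shows "2 * \<bar>\<Sum>i<n. \<Sum>j<n. u i * K i j * v j\<bar> \<le> quad_form n K u + quad_form n K v"
proof -
  have "0 \<le> quad_form n K (\<lambda>k. v k + u k)" "0 \<le> quad_form n K (\<lambda>k. v k + (- 1) * u k)"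
    by (rule assms(2))+
  then show ?thesis
    unfolding quad_form_add[OF assms(1)] quad_form_scale by (simp add: sum_negf abs_le_iff)
qed


lemma quad_form_eq: "quad_form n B v = (\<Sum>i<n. v i * (\<Sum>j<n. B i j * v j))"
  unfolding quad_form_def by (simp add: sum_distrib_left mult.assoc)

lemma pos_def_quad_form_zero:
  assumes "pos_def n B" "quad_form n B v = 0" "i < n"
  shows "v i = 0"
  using assms unfolding pos_def_def by (metis less_irrefl)

lemma pos_def_quad_form_nonneg: "pos_def n B \<Longrightarrow> 0 \<le> quad_form n B v"
proof (cases "\<exists>i<n. v i \<noteq> 0")
  case False
  then have "quad_form n B v = 0" unfolding quad_form_def by (intro sum.neutral) auto
  then show ?thesis by simp
qed (auto simp: pos_def_def less_imp_le)

text \<open>A null vector of a semidefinite form lies in the kernel: the mixed term is linear in the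
  scaling of the test vector, the bound on it quadratic. The scaling
  \<open>\<bar>x\<bar> / q\<close> makes the contradiction explicit.\<close>

lemma psd_quad_form_zero:
  assumes K: "sym_mat n K" "\<And>v. 0 \<le> quad_form n K v" and v: "quad_form n K v = 0" and i: "i < n"
  shows "(\<Sum>j<n. K i j * v j) = 0"
proof (rule ccontr)
  define x where "x = (\<Sum>j<n. K i j * v j)"
  define u where "u = (\<lambda>k. if k = i then 1 else 0 :: real)"
  assume "(\<Sum>j<n. K i j * v j) \<noteq> 0"
  then have x: "x \<noteq> 0" unfolding x_def .
  have u: "(\<Sum>k<n. \<Sum>j<n. (c * u k) * K k j * v j) = c * x" for c
  proof -
    have "(\<Sum>k<n. \<Sum>j<n. (c * u k) * K k j * v j) = (\<Sum>k<n. if k = i then c * x else 0)"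
      unfolding u_def x_def by (intro sum.cong refl) (auto simp: sum_distrib_left mult.assoc)
    then show ?thesis using i by simp
  qed
  define q where "q = quad_form n K u"
  have le: "2 * \<bar>c * x\<bar> \<le> c\<^sup>2 * q" for c
    using quad_form_mixed_le[OF K, of "\<lambda>k. c * u k" v] unfolding u quad_form_scale v q_def by simp
  have q: "0 < q" using le[of 1] x by auto
  have "2 * \<bar>(\<bar>x\<bar> / q) * x\<bar> \<le> (\<bar>x\<bar> / q)\<^sup>2 * q" by (rule le)
  also have "\<dots> = \<bar>x\<bar> * \<bar>x\<bar> / q" using q by (simp add: power2_eq_square)
  finally have "2 * (\<bar>x\<bar> * \<bar>x\<bar> / q) \<le> \<bar>x\<bar> * \<bar>x\<bar> / q" using q by (simp add: abs_mult)
  moreover have "0 < \<bar>x\<bar> * \<bar>x\<bar> / q" using q x by (intro divide_pos_pos mult_pos_pos) auto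
  ultimately show False by linarith
qed

text \<open>With \<open>D = R - T\<close>, equality of the squares gives
  \<open>R D + D T = 0\<close>. Multiplying by \<open>D\<close> and taking the trace yields two
  nonnegative sums adding up to 0. Hence the rows of \<open>D\<close> lie in the kernel of
  \<open>R\<close>, therefore in that of \<open>R R = B\<close>, which is trivial.\<close>

lemma psd_sqrt_unique:
  assumes B: "pos_def n B"
    and R: "sym_mat n R" "\<And>v. 0 \<le> quad_form n R v"
      "\<And>i j. i < n \<Longrightarrow> j < n \<Longrightarrow> (\<Sum>k<n. R i k * R k j) = B i j"
    and T: "sym_mat n T" "\<And>v. 0 \<le> quad_form n T v"
      "\<And>i j. i < n \<Longrightarrow> j < n \<Longrightarrow> (\<Sum>k<n. T i k * T k j) = B i j"
    and ij: "i < n" "j < n"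
  shows "R i j = T i j"
proof -
  define D where "D i j = R i j - T i j" for i j
  have D_sym: "D i j = D j i" if "i < n" "j < n" for i j
    using R(1) T(1) that unfolding D_def sym_mat_def by simp
  have RD: "(\<Sum>k<n. R i k * D k j) + (\<Sum>k<n. D i k * T k j) = 0" if "i < n" "j < n" for i j
    using R(3)[OF that] T(3)[OF that] unfolding D_def
    by (simp add: left_diff_distrib right_diff_distrib sum_subtractf)
  have r: "(\<Sum>i<n. \<Sum>j<n. D i j * (\<Sum>k<n. R j k * D k i)) = (\<Sum>i<n. quad_form n R (D i))"
    unfolding quad_form_eq using D_sym by (intro sum.cong refl arg_cong2[of _ _ _ _ "(*)"]) auto
  have t: "(\<Sum>i<n. \<Sum>j<n. D i j * (\<Sum>k<n. D j k * T k i)) = (\<Sum>j<n. quad_form n T (D j))"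
  proof -
    have "(\<Sum>i<n. \<Sum>j<n. D i j * (\<Sum>k<n. D j k * T k i)) = (\<Sum>j<n. \<Sum>i<n. D i j * (\<Sum>k<n. D j k * T k i))"
      by (rule sum.swap)
    also have "\<dots> = (\<Sum>j<n. quad_form n T (D j))"
      unfolding quad_form_eq
    proof (intro sum.cong refl)
      fix j i assume ji: "j \<in> {..<n}" "i \<in> {..<n}"
      have "(\<Sum>k<n. D j k * T k i) = (\<Sum>k<n. T i k * D j k)"
        using T(1) ji unfolding sym_mat_def by (intro sum.cong refl) simp
      then show "D i j * (\<Sum>k<n. D j k * T k i) = D j i * (\<Sum>k<n. T i k * D j k)"
        using D_sym ji by simp
    qed
    finally show ?thesis .
  qed
  have "(\<Sum>i<n. \<Sum>j<n. D i j * (\<Sum>k<n. R j k * D k i)) + (\<Sum>i<n. \<Sum>j<n. D i j * (\<Sum>k<n. D j k * T k i)) = 0"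
  proof -
    have "D i j * (\<Sum>k<n. R j k * D k i) + D i j * (\<Sum>k<n. D j k * T k i) = 0" if "i < n" "j < n" for i j
      using RD[OF that(2,1)] unfolding distrib_left[symmetric] by simp
    then show ?thesis
      unfolding sum.distrib[of "\<lambda>i. \<Sum>j<n. D i j * _ i j", symmetric] sum.distrib[of "\<lambda>j. D _ j * _ j", symmetric]
      by (intro sum.neutral ballI) auto
  qed
  then have "(\<Sum>i<n. quad_form n R (D i)) + (\<Sum>i<n. quad_form n T (D i)) = 0" unfolding r t .
  moreover have "0 \<le> (\<Sum>i<n. quad_form n R (D i))" "0 \<le> (\<Sum>i<n. quad_form n T (D i))"
    using R(2) T(2) by (simp_all add: sum_nonneg)
  ultimately have "(\<Sum>i<n. quad_form n R (D i)) = 0" by linarith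
  then have q0: "quad_form n R (D i) = 0"
    using sum_nonneg_eq_0_iff[of "{..<n}" "\<lambda>i. quad_form n R (D i)"] R(2) ij by auto
  have RD0: "(\<Sum>k<n. R l k * D i k) = 0" if "l < n" for l
    by (rule psd_quad_form_zero[OF R(1,2) q0 that])
  have "(\<Sum>l<n. B k l * D i l) = 0" if k: "k < n" for k
  proof -
    have "(\<Sum>l<n. B k l * D i l) = (\<Sum>l<n. \<Sum>m<n. R k m * R m l * D i l)"
      using R(3) k by (intro sum.cong refl) (simp add: sum_distrib_right[symmetric])
    also have "\<dots> = (\<Sum>m<n. R k m * (\<Sum>l<n. R m l * D i l))"
      by (subst sum.swap) (simp add: sum_distrib_left mult.assoc)
    also have "\<dots> = 0" using RD0 by simp
    finally show ?thesis .
  qed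
  then have "quad_form n B (D i) = 0" unfolding quad_form_eq by simp
  then have "D i j = 0" by (rule pos_def_quad_form_zero[OF B _ ij(2)])
  then show ?thesis unfolding D_def by simp
qed

text \<open>Existence and uniqueness make the definite description meaningful. By symmetry the
  square is restated as \<open>R\<close> times its transpose, the only form in which the root is
  used afterwards.\<close>

lemma mat_sqrt:
  assumes B: "pos_def n B"
  shows "i < n \<Longrightarrow> j < n \<Longrightarrow> (\<Sum>k<n. mat_sqrt n B i k * mat_sqrt n B j k) = B i j"
proof -
  obtain Q ev where Q: "Q \<in> orthogonal_mats n" "\<And>k. k < n \<Longrightarrow> 0 < ev k"
    "\<And>i j. i < n \<Longrightarrow> j < n \<Longrightarrow> B i j = (\<Sum>k<n. ev k * Q i k * Q j k)"
    using pos_def_spectral[OF B] by blast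
  define R where "R i j = (\<Sum>a<n. sqrt (ev a) * Q i a * Q j a)" for i j
  let ?P = "\<lambda>R. (\<forall>i j. (n \<le> i \<or> n \<le> j) \<longrightarrow> R i j = 0) \<and> sym_mat n R
      \<and> (\<forall>v. quad_form n R v \<ge> 0)
      \<and> (\<forall>i<n. \<forall>j<n. (\<Sum>k<n. R i k * R k j) = B i j)"
  have PR: "?P R"
  proof (intro conjI allI impI)
    show "R i j = 0" if "n \<le> i \<or> n \<le> j" for i j
      unfolding R_def using Q(1) that by (auto simp: orthogonal_mats_def intro!: sum.neutral)
    show "sym_mat n R" unfolding sym_mat_def R_def by (simp add: mult_ac)
    show "0 \<le> quad_form n R v" for v
      unfolding R_def spectral_quad_form using Q(2)
      by (intro sum_nonneg mult_nonneg_nonneg) (auto simp: less_imp_le)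
    show "(\<Sum>k<n. R i k * R k j) = B i j" if "i < n" "j < n" for i j
      unfolding R_def spectral_product[OF Q(1)] Q(3)[OF that]
      using Q(2) by (intro sum.cong refl) (simp add: less_imp_le)
  qed
  have "\<exists>!R. ?P R"
  proof (rule ex1I)
    show "?P R" by (rule PR)
    fix T assume T: "?P T"
    show "T = R"
    proof (intro ext)
      fix i j
      show "T i j = R i j"
      proof (cases "i < n \<and> j < n")
        case True
        then show ?thesis using psd_sqrt_unique[OF B, of T R i j] T PR by blast
      next
        case False
        then have "n \<le> i \<or> n \<le> j" by auto
        then show ?thesis using T PR by metis
      qed
    qed
  qed
  from theI'[OF this] have P: "?P (mat_sqrt n B)" unfolding mat_sqrt_def .
  assume ij: "i < n" "j < n"
  have "(\<Sum>k<n. mat_sqrt n B i k * mat_sqrt n B j k) = (\<Sum>k<n. mat_sqrt n B i k * mat_sqrt n B k j)"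
    using P ij unfolding sym_mat_def by (intro sum.cong refl) simp
  then show ?thesis using P ij by simp
qed

section \<open>Linear systems on a principal block\<close>

lemma pos_def_solution_unique:
  assumes B: "pos_def n B" and I: "I \<subseteq> {..<n}" and "\<And>i. i \<in> I \<Longrightarrow> (\<Sum>k\<in>I. B i k * x k) = (\<Sum>k\<in>I. B i k * y k)"
    and i: "i \<in> I"
  shows "x i = y i"
proof -
  define z where "z k = (if k \<in> I then x k - y k else 0)" for k
  have s: "(\<Sum>k<n. f k * z k) = (\<Sum>k\<in>I. f k * (x k - y k))" for f :: "nat \<Rightarrow> real"
  proof -
    have "(\<Sum>k<n. f k * z k) = (\<Sum>k\<in>I. f k * z k)"
      using I by (intro sum.mono_neutral_right) (auto simp: z_def)
    then show ?thesis unfolding z_def by simp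
  qed
  have "quad_form n B z = 0"
    unfolding quad_form_eq
  proof (intro sum.neutral ballI)
    fix i assume "i \<in> {..<n}"
    show "z i * (\<Sum>j<n. B i j * z j) = 0"
    proof (cases "i \<in> I")
      case True
      then show ?thesis unfolding s using assms(3) by (simp add: right_diff_distrib sum_subtractf)
    qed (simp add: z_def)
  qed
  moreover have "i < n" using i I by auto
  ultimately have "z i = 0" by (rule pos_def_quad_form_zero[OF B])
  then show ?thesis unfolding z_def using i by simp
qed

lemma restr_inv:
  assumes B: "pos_def n B" and I: "I \<subseteq> {..<n}"
  shows "i \<in> I \<Longrightarrow> j \<in> I \<Longrightarrow> (\<Sum>k\<in>I. B i k * restr_inv I B k j) = (if i = j then 1 else 0)"
    and "i \<notin> I \<or> j \<notin> I \<Longrightarrow> restr_inv I B i j = 0"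
proof -
  \<comment> \<open>The block on \<open>I\<close> is completed by the identity to a positive
    definite matrix of full size; the \<open>I\<close>-block of its inverse is the inverse
    wanted.\<close>
  define C where "C i j = (if i \<in> I \<and> j \<in> I then B i j else of_bool (i = j))" for i j
  have "pos_def n C"
    unfolding pos_def_def
  proof (intro conjI allI impI)
    show "sym_mat n C" using B unfolding pos_def_def sym_mat_def C_def by auto
    fix v :: "nat \<Rightarrow> real" assume v: "\<exists>i<n. v i \<noteq> 0"
    define v1 where "v1 k = (if k \<in> I then v k else 0)" for k
    have eq: "quad_form n C v = quad_form n B v1 + (\<Sum>i<n. if i \<in> I then 0 else (v i)\<^sup>2)"
      unfolding quad_form_def sum.distrib[symmetric]
    proof (intro sum.cong refl)
      fix i assume i: "i \<in> {..<n}"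
      show "(\<Sum>j<n. v i * C i j * v j) = (\<Sum>j<n. v1 i * B i j * v1 j) + (if i \<in> I then 0 else (v i)\<^sup>2)"
      proof (cases "i \<in> I")
        case True
        then show ?thesis by (auto simp: v1_def C_def intro!: sum.cong)
      next
        case False
        then have "(\<Sum>j<n. v i * C i j * v j) = (\<Sum>j<n. if j = i then (v i)\<^sup>2 else 0)"
          by (intro sum.cong refl) (auto simp: C_def power2_eq_square)
        then show ?thesis using False i by (simp add: v1_def)
      qed
    qed
    have nn: "0 \<le> (\<Sum>i<n. if i \<in> I then 0 else (v i)\<^sup>2)" by (intro sum_nonneg) auto
    show "0 < quad_form n C v"
    proof (cases "\<exists>i<n. v1 i \<noteq> 0")
      case True
      then have "0 < quad_form n B v1" using B unfolding pos_def_def by simp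
      then show ?thesis using eq nn by linarith
    next
      case False
      obtain i where i: "i < n" "v i \<noteq> 0" using v by blast
      have "i \<notin> I" using False i unfolding v1_def by auto
      then have "0 < (\<Sum>i<n. if i \<in> I then 0 else (v i)\<^sup>2)"
        using i by (intro sum_pos2[of _ i]) auto
      moreover have "0 \<le> quad_form n B v1" by (rule pos_def_quad_form_nonneg[OF B])
      ultimately show ?thesis using eq by linarith
    qed
  qed
  then obtain K where K: "\<And>i j. i < n \<Longrightarrow> j < n \<Longrightarrow> (\<Sum>k<n. C i k * K k j) = of_bool (i = j)"
    using pos_def_inverse by metis
  define a where "a i j = (if i \<in> I \<and> j \<in> I then K i j else 0)" for i j
  let ?P = "\<lambda>a. (\<forall>i\<in>I. \<forall>j\<in>I. (\<Sum>k\<in>I. B i k * a k j) = (if i = j then 1 else 0))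
      \<and> (\<forall>i j. (i \<notin> I \<or> j \<notin> I) \<longrightarrow> a i j = 0)"
  have Pa: "?P a"
  proof (intro conjI ballI allI impI)
    fix i j assume ij: "i \<in> I" "j \<in> I"
    have "(\<Sum>k\<in>I. B i k * a k j) = (\<Sum>k\<in>I. C i k * K k j)"
      using ij by (intro sum.cong refl) (simp add: a_def C_def)
    also have "\<dots> = (\<Sum>k<n. C i k * K k j)"
      using I ij by (intro sum.mono_neutral_left) (auto simp: C_def)
    also have "\<dots> = of_bool (i = j)" using I ij by (intro K) auto
    finally show "(\<Sum>k\<in>I. B i k * a k j) = (if i = j then 1 else 0)" by simp
  qed (auto simp: a_def)
  have "\<exists>!a. ?P a"
  proof (rule ex1I)
    show "?P a" by (rule Pa)
    fix c assume c: "?P c"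
    show "c = a"
    proof (intro ext)
      fix i j
      show "c i j = a i j"
      proof (cases "i \<in> I \<and> j \<in> I")
        case True
        then show ?thesis
          using c Pa by (intro pos_def_solution_unique[OF B I, of "\<lambda>k. c k j" "\<lambda>k. a k j"]) auto
      next
        case False
        then show ?thesis using c Pa by metis
      qed
    qed
  qed
  from theI'[OF this] have P: "?P (restr_inv I B)" unfolding restr_inv_def .
  show "i \<in> I \<Longrightarrow> j \<in> I \<Longrightarrow> (\<Sum>k\<in>I. B i k * restr_inv I B k j) = (if i = j then 1 else 0)"
    "i \<notin> I \<or> j \<notin> I \<Longrightarrow> restr_inv I B i j = 0"
    using P by blast+
qed

section \<open>The minimiser over the simplex and its stationarity conditions\<close>

lemma compact_std_simplex: "compact (std_simplex n)"
proof -
  define T where "T i = (if i < n then {0..1::real} else {0})" for i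
  have 1: "compact {w. \<forall>i. w i \<in> T i}" by (intro compact_Pi_UNIV) (auto simp: T_def)
  have 2: "closed {w :: nat \<Rightarrow> real. (\<Sum>i<n. w i) = 1}"
    by (intro closed_Collect_eq continuous_on_sum continuous_on_coord continuous_on_const)
  have "std_simplex n = {w. \<forall>i. w i \<in> T i} \<inter> {w. (\<Sum>i<n. w i) = 1}"
  proof (intro set_eqI iffI)
    fix w assume w: "w \<in> std_simplex n"
    have "w i \<le> 1" if "i < n" for i
    proof -
      have "w i \<le> (\<Sum>i<n. w i)" using w that unfolding std_simplex_def by (intro member_le_sum) auto
      then show ?thesis using w unfolding std_simplex_def by simp
    qed
    then show "w \<in> {w. \<forall>i. w i \<in> T i} \<inter> {w. (\<Sum>i<n. w i) = 1}"
      using w unfolding std_simplex_def T_def by (auto simp: not_less)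
  next
    fix w assume w: "w \<in> {w. \<forall>i. w i \<in> T i} \<inter> {w. (\<Sum>i<n. w i) = 1}"
    then have "w i \<in> T i" for i by blast
    then have "0 \<le> w i" "n \<le> i \<Longrightarrow> w i = 0" for i
      unfolding T_def by (metis atLeastAtMost_iff order_refl singletonD, metis not_less singletonD)
    then show "w \<in> std_simplex n" using w unfolding std_simplex_def by auto
  qed
  then show ?thesis using compact_Int_closed[OF 1 2] by simp
qed

lemma min_var_weights:
  assumes B: "pos_def n B" and n: "1 \<le> n"
  shows "min_var_weights n B \<in> std_simplex n"
    and "\<And>v. v \<in> std_simplex n \<Longrightarrow> quad_form n B (min_var_weights n B) \<le> quad_form n B v"
proof -
  have B_sym: "sym_mat n B" using B unfolding pos_def_def by simp
  let ?P = "\<lambda>w. w \<in> std_simplex n \<and> (\<forall>v\<in>std_simplex n. quad_form n B w \<le> quad_form n B v)"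
  have "(\<lambda>i. of_bool (i = 0)) \<in> std_simplex n" using n unfolding std_simplex_def by auto
  moreover have "continuous_on (std_simplex n) (quad_form n B)"
    unfolding quad_form_def
    by (intro continuous_on_sum continuous_on_mult continuous_on_coord continuous_on_const)
  ultimately obtain w where w: "?P w"
    using continuous_attains_inf[OF compact_std_simplex] by blast
  have "\<exists>!w. ?P w"
  proof (rule ex1I)
    show "?P w" by (rule w)
    fix u assume u: "?P u"
    have eq: "quad_form n B u = quad_form n B w" using u w by (intro antisym) auto
    \<comment> \<open>Strict convexity through the parallelogram identity: the midpoint
      \<open>z\<close> is feasible, so two minimisers leave no energy for their half difference
      \<open>y\<close>.\<close>
    define z where "z k = (u k + w k) / 2" for k
    define y where "y k = (u k - w k) / 2" for k
    have "z \<in> std_simplex n"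
      using u w unfolding std_simplex_def z_def
      by (auto simp: sum_divide_distrib[symmetric] sum.distrib)
    then have "quad_form n B w \<le> quad_form n B z" using w by blast
    moreover have "u = (\<lambda>k. z k + y k)" "w = (\<lambda>k. z k + (- 1) * y k)"
      unfolding z_def y_def by (auto simp: field_simps)
    then have "quad_form n B u + quad_form n B w = 2 * quad_form n B z + 2 * quad_form n B y"
      using quad_form_add[OF B_sym, of z y] quad_form_add[OF B_sym, of z "\<lambda>k. (- 1) * y k"]
      unfolding quad_form_scale by (simp add: sum_negf)
    ultimately have "quad_form n B y \<le> 0" using eq by linarith
    then have "quad_form n B y = 0" using pos_def_quad_form_nonneg[OF B, of y] by linarith
    then have y0: "y i = 0" if "i < n" for i using that by (rule pos_def_quad_form_zero[OF B])
    show "u = w"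
    proof
      fix i show "u i = w i"
        using u w y0[of i] unfolding y_def std_simplex_def by (cases "i < n") (auto simp: not_less)
    qed
  qed
  from theI'[OF this] have "?P (min_var_weights n B)" unfolding min_var_weights_def .
  then show "min_var_weights n B \<in> std_simplex n"
    "\<And>v. v \<in> std_simplex n \<Longrightarrow> quad_form n B (min_var_weights n B) \<le> quad_form n B v"
    by blast+
qed

text \<open>The inequality comes from moving \<open>w\<close> towards the vertex \<open>i\<close>.
  Averaging its slacks with the weights \<open>w\<close> gives 0, and as they are nonnegative each
  slack vanishes where \<open>w\<close> does not.\<close>

lemma min_var_weights_KKT:
  assumes B: "pos_def n B" and n: "1 \<le> n"
  defines "w \<equiv> min_var_weights n B"
  shows "0 < quad_form n B w"
    and "\<And>i. i < n \<Longrightarrow> quad_form n B w \<le> (\<Sum>j<n. B i j * w j)"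
    and "\<And>i. i < n \<Longrightarrow> w i \<noteq> 0 \<Longrightarrow> (\<Sum>j<n. B i j * w j) = quad_form n B w"
proof -
  have B_sym: "sym_mat n B" using B unfolding pos_def_def by simp
  note ws = min_var_weights(1)[OF B n, folded w_def] and wm = min_var_weights(2)[OF B n, folded w_def]
  have "\<exists>i<n. w i \<noteq> 0"
  proof (rule ccontr)
    assume "\<not> (\<exists>i<n. w i \<noteq> 0)"
    then have "(\<Sum>i<n. w i) = 0" by (intro sum.neutral) auto
    then show False using ws unfolding std_simplex_def by simp
  qed
  then show "0 < quad_form n B w" using B unfolding pos_def_def by simp
  show ge: "quad_form n B w \<le> (\<Sum>j<n. B i j * w j)" if i: "i < n" for i
  proof (rule ccontr)
    define u where "u k = of_bool (k = i) - w k" for k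
    define x where "x = (\<Sum>j<n. B i j * w j) - quad_form n B w"
    assume "\<not> quad_form n B w \<le> (\<Sum>j<n. B i j * w j)"
    then have x: "x < 0" unfolding x_def by simp
    have ux: "(\<Sum>k<n. \<Sum>j<n. u k * B k j * w j) = x"
    proof -
      define y where "y k = (\<Sum>j<n. B k j * w j)" for k
      have "(\<Sum>k<n. \<Sum>j<n. u k * B k j * w j) = (\<Sum>k<n. u k * y k)"
        unfolding y_def by (simp add: sum_distrib_left mult.assoc)
      also have "\<dots> = (\<Sum>k<n. (if k = i then y k else 0) - w k * y k)"
        unfolding u_def by (intro sum.cong refl) (simp add: left_diff_distrib)
      finally show ?thesis
        using i unfolding x_def quad_form_eq y_def[symmetric] by (simp add: sum_subtractf)
    qed
    define q where "q = quad_form n B u"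
    have q: "0 \<le> q" unfolding q_def by (rule pos_def_quad_form_nonneg[OF B])
    \<comment> \<open>The bound 1 keeps the perturbed point in the simplex; the other bound keeps
      the second-order term \<open>\<epsilon> * q\<close> below \<open>- x\<close>, so the negative
      first-order term \<open>2 * x\<close> wins.\<close>
    define \<epsilon> where "\<epsilon> = min 1 (- x / (q + 1))"
    have "0 < - x / (q + 1)" using x q by (intro divide_pos_pos) auto
    then have \<epsilon>: "0 < \<epsilon>" "\<epsilon> \<le> 1" "\<epsilon> \<le> - x / (q + 1)" unfolding \<epsilon>_def by auto
    have "(\<lambda>k. w k + \<epsilon> * u k) \<in> std_simplex n"
    proof -
      have e: "w k + \<epsilon> * u k = (1 - \<epsilon>) * w k + \<epsilon> * of_bool (k = i)" for k unfolding u_def by (simp add: algebra_simps)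
      show ?thesis
        unfolding e using ws \<epsilon>(1,2) i unfolding std_simplex_def
        by (auto simp: sum.distrib sum_distrib_left[symmetric] of_bool_def)
    qed
    from wm[OF this] have "0 \<le> 2 * (\<Sum>k<n. \<Sum>j<n. (\<epsilon> * u k) * B k j * w j) + \<epsilon>\<^sup>2 * q"
      unfolding quad_form_add[OF B_sym, of w] quad_form_scale q_def by simp
    also have "(\<Sum>k<n. \<Sum>j<n. (\<epsilon> * u k) * B k j * w j) = \<epsilon> * x"
      unfolding ux[symmetric] by (simp add: sum_distrib_left mult.assoc)
    also have "2 * (\<epsilon> * x) + \<epsilon>\<^sup>2 * q = \<epsilon> * (2 * x + \<epsilon> * q)" by (simp add: power2_eq_square algebra_simps)
    finally have "0 \<le> 2 * x + \<epsilon> * q" using \<epsilon>(1) by (simp add: zero_le_mult_iff)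
    moreover have "\<epsilon> * q \<le> - x"
    proof -
      have "\<epsilon> * (q + 1) \<le> - x" using \<epsilon>(3) q pos_le_divide_eq[of "q + 1" \<epsilon> "- x"] by linarith
      then show ?thesis using \<epsilon>(1) by (simp add: distrib_left)
    qed
    ultimately show False using x by linarith
  qed
  have "(\<Sum>k<n. w k * ((\<Sum>j<n. B k j * w j) - quad_form n B w)) = quad_form n B w - (\<Sum>k<n. w k) * quad_form n B w"
    unfolding right_diff_distrib sum_subtractf quad_form_eq[symmetric] sum_distrib_right ..
  also have "\<dots> = 0" using ws unfolding std_simplex_def by simp
  finally have "\<forall>k\<in>{..<n}. w k * ((\<Sum>j<n. B k j * w j) - quad_form n B w) = 0"
    using ws ge unfolding std_simplex_def by (subst (asm) sum_nonneg_eq_0_iff) auto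
  then show "(\<Sum>j<n. B i j * w j) = quad_form n B w" if "i < n" "w i \<noteq> 0" for i
    using that by auto
qed


section \<open>Gaussian integration by parts\<close>

abbreviation normal_measure :: "real \<Rightarrow> real measure" where
  "normal_measure \<sigma> \<equiv> density lborel (\<lambda>x. ennreal (normal_density 0 \<sigma> x))"

lemma integrable_exp_normal:
  assumes "0 < \<sigma>"
  shows "integrable lborel (\<lambda>u. normal_density 0 \<sigma> u * exp (c * u))"
proof -
  have "normal_density 0 \<sigma> u * exp (c * u) = exp (c\<^sup>2 * \<sigma>\<^sup>2 / 2) * normal_density (c * \<sigma>\<^sup>2) \<sigma> u" for u
  proof -
    have "- (u - 0)\<^sup>2 / (2 * \<sigma>\<^sup>2) + c * u = c\<^sup>2 * \<sigma>\<^sup>2 / 2 + - (u - c * \<sigma>\<^sup>2)\<^sup>2 / (2 * \<sigma>\<^sup>2)"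
      using assms by (simp add: field_simps power2_eq_square)
    then show ?thesis
      unfolding normal_density_def by (simp add: exp_add[symmetric] mult.left_commute)
  qed
  then show ?thesis using assms by simp
qed

lemma integrable_exp_abs_normal:
  assumes "0 < \<sigma>"
  shows "integrable lborel (\<lambda>u. normal_density 0 \<sigma> u * exp (c * \<bar>u\<bar>))"
proof (rule Bochner_Integration.integrable_bound)
  show "integrable lborel (\<lambda>u. normal_density 0 \<sigma> u * exp (c * u) + normal_density 0 \<sigma> u * exp ((-c) * u))"
    using integrable_exp_normal[OF assms] by (intro Bochner_Integration.integrable_add)
  show "AE u in lborel. norm (normal_density 0 \<sigma> u * exp (c * \<bar>u\<bar>))
      \<le> norm (normal_density 0 \<sigma> u * exp (c * u) + normal_density 0 \<sigma> u * exp ((-c) * u))"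
  proof (rule AE_I2)
    fix u
    have "exp (c * \<bar>u\<bar>) \<le> exp (c * u) + exp ((-c) * u)"
      by (cases "u \<ge> 0") auto
    then show "norm (normal_density 0 \<sigma> u * exp (c * \<bar>u\<bar>))
      \<le> norm (normal_density 0 \<sigma> u * exp (c * u) + normal_density 0 \<sigma> u * exp ((-c) * u))"
      by (simp add: abs_mult distrib_left[symmetric] mult_left_mono)
  qed
qed simp

lemma integrable_normal_exp_bounded:
  assumes "0 < \<sigma>" and [measurable]: "f \<in> borel_measurable borel" and "\<And>u. \<bar>f u\<bar> \<le> C * exp (c * \<bar>u\<bar>)"
  shows "integrable lborel (\<lambda>u. normal_density 0 \<sigma> u * f u)"
proof (rule Bochner_Integration.integrable_bound)
  show "integrable lborel (\<lambda>u. C * (normal_density 0 \<sigma> u * exp (c * \<bar>u\<bar>)))"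
    using integrable_exp_abs_normal[OF assms(1)] by simp
  show "AE u in lborel. norm (normal_density 0 \<sigma> u * f u) \<le> norm (C * (normal_density 0 \<sigma> u * exp (c * \<bar>u\<bar>)))"
  proof (rule AE_I2)
    fix u
    have "\<bar>f u\<bar> \<le> \<bar>C\<bar> * exp (c * \<bar>u\<bar>)"
      using assms(3)[of u] by (meson abs_ge_self exp_ge_zero mult_right_mono order_trans)
    then show "norm (normal_density 0 \<sigma> u * f u) \<le> norm (C * (normal_density 0 \<sigma> u * exp (c * \<bar>u\<bar>)))"
      by (simp add: abs_mult mult.left_commute[of "\<bar>C\<bar>"] mult_left_mono)
  qed
qed simp

text \<open>The integrand times the density is the derivative of
  \<open>- (\<sigma>\<^sup>2) * (f u * normal_density 0 \<sigma> u)\<close>. Integrals over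
  \<open>[-k, k]\<close> converge to the full one by domination, and the boundary terms vanish
  because the Gaussian decay beats \<open>exp (c * \<bar>u\<bar>)\<close>.\<close>

lemma normal_integration_by_parts:
  fixes f f' :: "real \<Rightarrow> real"
  assumes \<sigma>: "0 < \<sigma>" and c: "0 \<le> c"
    and der: "\<And>u. (f has_real_derivative f' u) (at u)"
    and f: "\<And>u. \<bar>f u\<bar> \<le> C * exp (c * \<bar>u\<bar>)"
    and f': "\<And>u. \<bar>f' u\<bar> \<le> C * exp (c * \<bar>u\<bar>)"
    and meas[measurable]: "f' \<in> borel_measurable borel"
  shows "(\<integral>u. u * f u - \<sigma>\<^sup>2 * f' u \<partial>normal_measure \<sigma>) = 0"
proof -
  have C: "0 \<le> C" using f[of 0] by simp
  have cont: "continuous_on UNIV f"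
    using der DERIV_isCont continuous_at_imp_continuous_on by blast
  have [measurable]: "f \<in> borel_measurable borel"
    using borel_measurable_continuous_onI[OF cont] .
  define \<psi> where "\<psi> u = normal_density 0 \<sigma> u * (u * f u - \<sigma>\<^sup>2 * f' u)" for u
  define F where "F u = - (\<sigma>\<^sup>2) * (f u * normal_density 0 \<sigma> u)" for u
  have uf: "\<bar>u * f u\<bar> \<le> C * exp ((c + 1) * \<bar>u\<bar>)" for u
  proof -
    have "\<bar>u\<bar> \<le> exp \<bar>u\<bar>" using exp_ge_add_one_self[of "\<bar>u\<bar>"] by linarith
    then have "\<bar>u\<bar> * \<bar>f u\<bar> \<le> exp \<bar>u\<bar> * (C * exp (c * \<bar>u\<bar>))"
      using f[of u] by (intro mult_mono) auto
    moreover have "exp ((c + 1) * \<bar>u\<bar>) = exp \<bar>u\<bar> * exp (c * \<bar>u\<bar>)"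
      by (simp add: exp_add[symmetric] algebra_simps)
    ultimately show ?thesis by (simp add: abs_mult mult.left_commute)
  qed
  have i1: "integrable lborel (\<lambda>u. normal_density 0 \<sigma> u * (u * f u))"
    by (rule integrable_normal_exp_bounded[OF \<sigma> _ uf]) simp
  have i2: "integrable lborel (\<lambda>u. normal_density 0 \<sigma> u * f' u)"
    by (rule integrable_normal_exp_bounded[OF \<sigma> _ f']) simp
  have "\<psi> = (\<lambda>u. normal_density 0 \<sigma> u * (u * f u) - \<sigma>\<^sup>2 * (normal_density 0 \<sigma> u * f' u))"
    by (auto simp: \<psi>_def fun_eq_iff algebra_simps)
  then have int: "integrable lborel \<psi>" using i1 i2 by simp
  have dF: "(F has_real_derivative \<psi> u) (at u)" for u
  proof -
    have "(normal_density 0 \<sigma> has_real_derivative - (u / \<sigma>\<^sup>2) * normal_density 0 \<sigma> u) (at u)"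
      unfolding normal_density_def using \<sigma>
      by (auto intro!: derivative_eq_intros simp: field_simps power2_eq_square)
    then have "(F has_real_derivative - (\<sigma>\<^sup>2) * (f' u * normal_density 0 \<sigma> u +
        (- (u / \<sigma>\<^sup>2) * normal_density 0 \<sigma> u) * f u)) (at u)"
      unfolding F_def by (rule DERIV_cmult[OF DERIV_mult[OF der]])
    moreover have "- (\<sigma>\<^sup>2) * (f' u * normal_density 0 \<sigma> u +
        (- (u / \<sigma>\<^sup>2) * normal_density 0 \<sigma> u) * f u) = \<psi> u"
      using \<sigma> by (simp add: \<psi>_def field_simps)
    ultimately show ?thesis by simp
  qed
  have "(\<lambda>k::nat. \<integral>u. indicator {- real k..real k} u * \<psi> u \<partial>lborel) \<longlonglongrightarrow> (\<integral>u. \<psi> u \<partial>lborel)"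
  proof (rule integral_dominated_convergence[where w="\<lambda>u. norm (\<psi> u)"])
    show "AE u in lborel. (\<lambda>k. indicator {- real k..real k} u * \<psi> u) \<longlonglongrightarrow> \<psi> u"
    proof (rule AE_I2)
      fix u :: real
      obtain K :: nat where "\<bar>u\<bar> \<le> real K" using real_arch_simple by blast
      then have "eventually (\<lambda>k. indicator {- real k..real k} u * \<psi> u = \<psi> u) sequentially"
        unfolding eventually_sequentially by (intro exI[of _ K]) (auto simp: indicator_def)
      then show "(\<lambda>k. indicator {- real k..real k} u * \<psi> u) \<longlonglongrightarrow> \<psi> u"
        by (rule tendsto_eventually)
    qed
  qed (use int in \<open>auto simp: indicator_def\<close>)
  moreover have "(\<integral>u. indicator {- real k..real k} u * \<psi> u \<partial>lborel) = F (real k) - F (- real k)" for k :: nat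
  proof -
    have "(\<psi> has_integral (F (real k) - F (- real k))) {- real k..real k}"
      by (rule fundamental_theorem_of_calculus)
        (auto intro: has_field_derivative_at_within[OF dF] simp: has_real_derivative_iff_has_vector_derivative[symmetric])
    moreover have si: "set_integrable lborel {- real k..real k} \<psi>"
      unfolding set_integrable_def using integrable_mult_indicator[OF _ int, of "{- real k..real k}"] by simp
    ultimately show ?thesis
      using set_borel_integral_eq_integral(2)[OF si] integral_unique
      by (simp add: set_lebesgue_integral_def)
  qed
  moreover have "(\<lambda>k::nat. F (real k) - F (- real k)) \<longlonglongrightarrow> 0"
  proof -
    define D where "D = \<sigma>\<^sup>2 * C / sqrt (2 * pi * \<sigma>\<^sup>2)"
    have Fb: "\<bar>F u\<bar> \<le> D * exp (c * \<bar>u\<bar> - \<bar>u\<bar>\<^sup>2 / (2 * \<sigma>\<^sup>2))" for u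
    proof -
      have "\<bar>F u\<bar> = \<sigma>\<^sup>2 * \<bar>f u\<bar> * normal_density 0 \<sigma> u"
        by (simp add: F_def abs_mult)
      also have "\<dots> \<le> \<sigma>\<^sup>2 * (C * exp (c * \<bar>u\<bar>)) * normal_density 0 \<sigma> u"
        using f[of u] by (intro mult_right_mono mult_left_mono) auto
      also have "\<dots> = D * exp (c * \<bar>u\<bar> - \<bar>u\<bar>\<^sup>2 / (2 * \<sigma>\<^sup>2))"
        by (simp add: D_def normal_density_def exp_diff exp_minus field_simps)
      finally show ?thesis .
    qed
    have "(\<lambda>k::nat. 2 * D * exp (c * real k - (real k)\<^sup>2 / (2 * \<sigma>\<^sup>2))) \<longlonglongrightarrow> 0"
      using \<sigma> by real_asymp
    then show ?thesis
    proof (rule Lim_null_comparison[rotated])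
      show "\<forall>\<^sub>F k in sequentially. norm (F (real k) - F (- real k)) \<le> 2 * D * exp (c * real k - (real k)\<^sup>2 / (2 * \<sigma>\<^sup>2))"
      proof (intro always_eventually allI)
        fix k :: nat
        have "\<bar>F (real k) - F (- real k)\<bar> \<le> \<bar>F (real k)\<bar> + \<bar>F (- real k)\<bar>"
          by (rule abs_triangle_ineq4)
        then show "norm (F (real k) - F (- real k)) \<le> 2 * D * exp (c * real k - (real k)\<^sup>2 / (2 * \<sigma>\<^sup>2))"
          using Fb[of "real k"] Fb[of "- real k"] by simp
      qed
    qed
  qed
  ultimately have "(\<integral>u. \<psi> u \<partial>lborel) = 0"
    using LIMSEQ_unique by (metis (no_types, lifting) ext)
  then show ?thesis
    by (subst integral_density) (auto simp: \<psi>_def)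
qed


text \<open>A class closed under sums and products that contains the coordinates and exponentials of
  linear forms; its measurable members are integrable against every product of normal laws. The
  bound is demanded at all \<open>w\<close>, so it survives changing one coordinate.\<close>

definition exp_bounded :: "nat \<Rightarrow> ((nat \<Rightarrow> real) \<Rightarrow> real) \<Rightarrow> bool" where
  "exp_bounded n f \<longleftrightarrow> (\<exists>C c. 0 \<le> c \<and> (\<forall>w. \<bar>f w\<bar> \<le> C * exp (c * (\<Sum>j<n. \<bar>w j\<bar>))))"

lemma exp_boundedI:
  assumes "0 \<le> c" "\<And>w. \<bar>f w\<bar> \<le> C * exp (c * (\<Sum>j<n. \<bar>w j\<bar>))"
  shows "exp_bounded n f"
  using assms unfolding exp_bounded_def by blast

lemma exp_bounded_const: "exp_bounded n (\<lambda>_. a)"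
  by (rule exp_boundedI[of 0 _ "\<bar>a\<bar>"]) auto

lemma exp_bounded_dominated:
  assumes "exp_bounded n g" "\<And>w. \<bar>f w\<bar> \<le> \<bar>g w\<bar>"
  shows "exp_bounded n f"
  using assms unfolding exp_bounded_def by (meson order_trans)

lemma exp_bounded_bounded:
  assumes "\<And>w. \<bar>f w\<bar> \<le> C"
  shows "exp_bounded n f"
  by (rule exp_boundedI[of 0 _ C]) (use assms in auto)

lemma exp_bounded_mult:
  assumes "exp_bounded n f" "exp_bounded n g"
  shows "exp_bounded n (\<lambda>w. f w * g w)"
proof -
  obtain C c where f: "0 \<le> c" "\<And>w. \<bar>f w\<bar> \<le> C * exp (c * (\<Sum>j<n. \<bar>w j\<bar>))"
    using assms(1) unfolding exp_bounded_def by blast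
  obtain D d where g: "0 \<le> d" "\<And>w. \<bar>g w\<bar> \<le> D * exp (d * (\<Sum>j<n. \<bar>w j\<bar>))"
    using assms(2) unfolding exp_bounded_def by blast
  show ?thesis
  proof (rule exp_boundedI)
    show "0 \<le> c + d" using f g by simp
    fix w
    have "\<bar>f w * g w\<bar> \<le> (C * exp (c * (\<Sum>j<n. \<bar>w j\<bar>))) * (D * exp (d * (\<Sum>j<n. \<bar>w j\<bar>)))"
      unfolding abs_mult by (rule mult_mono[OF f(2) g(2)]) (use f(2)[of w] abs_ge_zero order_trans in blast)+
    then show "\<bar>f w * g w\<bar> \<le> (C * D) * exp ((c + d) * (\<Sum>j<n. \<bar>w j\<bar>))"
      by (simp add: distrib_right exp_add mult_ac)
  qed
qed

lemma exp_bounded_add: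
  assumes "exp_bounded n f" "exp_bounded n g"
  shows "exp_bounded n (\<lambda>w. f w + g w)"
proof -
  obtain C c where f: "0 \<le> c" "\<And>w. \<bar>f w\<bar> \<le> C * exp (c * (\<Sum>j<n. \<bar>w j\<bar>))"
    using assms(1) unfolding exp_bounded_def by blast
  obtain D d where g: "0 \<le> d" "\<And>w. \<bar>g w\<bar> \<le> D * exp (d * (\<Sum>j<n. \<bar>w j\<bar>))"
    using assms(2) unfolding exp_bounded_def by blast
  have C: "0 \<le> C" and D: "0 \<le> D"
    using f(2)[of "\<lambda>_. 0"] g(2)[of "\<lambda>_. 0"] by auto
  show ?thesis
  proof (rule exp_boundedI)
    show "0 \<le> c + d" using f g by simp
    fix w :: "nat \<Rightarrow> real"
    define q where "q = (\<Sum>j<n. \<bar>w j\<bar>)"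
    have q: "0 \<le> q" unfolding q_def by (simp add: sum_nonneg)
    have "C * exp (c * q) \<le> C * exp ((c + d) * q)" "D * exp (d * q) \<le> D * exp ((c + d) * q)"
      using C D f(1) g(1) q by (auto intro!: mult_left_mono mult_right_mono)
    then show "\<bar>f w + g w\<bar> \<le> (C + D) * exp ((c + d) * (\<Sum>j<n. \<bar>w j\<bar>))"
      using f(2)[of w] g(2)[of w] unfolding q_def[symmetric] distrib_right[of C D] by linarith
  qed
qed

lemma exp_bounded_uminus: "exp_bounded n f \<Longrightarrow> exp_bounded n (\<lambda>w. - f w)"
  by (erule exp_bounded_dominated) simp

lemma exp_bounded_diff:
  assumes "exp_bounded n f" "exp_bounded n g"
  shows "exp_bounded n (\<lambda>w. f w - g w)"
  using exp_bounded_add[OF assms(1) exp_bounded_uminus[OF assms(2)]] by simp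

lemma exp_bounded_sum:
  assumes "\<And>i. i \<in> A \<Longrightarrow> exp_bounded n (f i)"
  shows "exp_bounded n (\<lambda>w. \<Sum>i\<in>A. f i w)"
  using assms
  by (induction A rule: infinite_finite_induct) (auto intro: exp_bounded_const exp_bounded_add)

lemma exp_bounded_coord:
  assumes "k < n"
  shows "exp_bounded n (\<lambda>w. w k)"
proof (rule exp_boundedI[of 1 _ 1])
  fix w :: "nat \<Rightarrow> real"
  have "\<bar>w k\<bar> \<le> (\<Sum>j<n. \<bar>w j\<bar>)"
    using assms by (intro member_le_sum) auto
  also have "\<dots> \<le> exp (\<Sum>j<n. \<bar>w j\<bar>)"
    using exp_ge_add_one_self[of "\<Sum>j<n. \<bar>w j\<bar>"] by linarith
  finally show "\<bar>w k\<bar> \<le> 1 * exp (1 * (\<Sum>j<n. \<bar>w j\<bar>))" by simp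
qed simp

lemma exp_bounded_exp_linear: "exp_bounded n (\<lambda>w. exp (a + (\<Sum>j<n. b j * w j)))"
proof (rule exp_boundedI)
  define c where "c = (\<Sum>j<n. \<bar>b j\<bar>)"
  show "0 \<le> c" unfolding c_def by (simp add: sum_nonneg)
  fix w :: "nat \<Rightarrow> real"
  have "(\<Sum>j<n. b j * w j) \<le> (\<Sum>j<n. c * \<bar>w j\<bar>)"
  proof (rule sum_mono)
    fix j assume "j \<in> {..<n}"
    then have "\<bar>b j\<bar> \<le> c" unfolding c_def by (intro member_le_sum) auto
    have "b j * w j \<le> \<bar>b j\<bar> * \<bar>w j\<bar>" by (metis abs_ge_self abs_mult)
    also have "\<dots> \<le> c * \<bar>w j\<bar>" using \<open>\<bar>b j\<bar> \<le> c\<close> by (simp add: mult_right_mono)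
    finally show "b j * w j \<le> c * \<bar>w j\<bar>" .
  qed
  then show "\<bar>exp (a + (\<Sum>j<n. b j * w j))\<bar> \<le> exp a * exp (c * (\<Sum>j<n. \<bar>w j\<bar>))"
    by (simp add: exp_add sum_distrib_left)
qed

lemmas exp_bounded_intros =
  exp_bounded_const exp_bounded_mult exp_bounded_add exp_bounded_diff exp_bounded_uminus
  exp_bounded_sum exp_bounded_coord exp_bounded_exp_linear

section \<open>Products of normal laws\<close>

definition normal_product :: "nat \<Rightarrow> real \<Rightarrow> (nat \<Rightarrow> real) measure" where
  "normal_product n \<sigma> = (\<Pi>\<^sub>M j\<in>{..<n}. normal_measure \<sigma>)"

lemma sets_normal_product: "sets (normal_product n \<sigma>) = sets (\<Pi>\<^sub>M j\<in>{..<n}. borel)"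
  unfolding normal_product_def by (rule sets_PiM_cong) auto

lemma measurable_normal_product:
  "borel_measurable (normal_product n \<sigma>) = borel_measurable (\<Pi>\<^sub>M j\<in>{..<n}. borel)"
  by (rule measurable_cong_sets) (simp_all add: sets_normal_product)

lemma integrable_exp_bounded:
  assumes \<sigma>: "0 < \<sigma>" and m: "f \<in> borel_measurable (\<Pi>\<^sub>M j\<in>{..<n}. borel)" and f: "exp_bounded n f"
  shows "integrable (normal_product n \<sigma>) f"
proof -
  interpret N: prob_space "normal_measure \<sigma>" by (rule prob_space_normal_density[OF \<sigma>])
  interpret PS: product_sigma_finite "\<lambda>_::nat. normal_measure \<sigma>" by standard
  obtain C c where C: "0 \<le> c" "\<And>w. \<bar>f w\<bar> \<le> C * exp (c * (\<Sum>j<n. \<bar>w j\<bar>))"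
    using f unfolding exp_bounded_def by blast
  show ?thesis
  proof (rule Bochner_Integration.integrable_bound)
    have "integrable (normal_product n \<sigma>) (\<lambda>w. \<Prod>j<n. exp (c * \<bar>w j\<bar>))"
      unfolding normal_product_def
    proof (rule PS.product_integrable_prod)
      show "integrable (normal_measure \<sigma>) (\<lambda>x. exp (c * \<bar>x\<bar>))"
        using integrable_exp_abs_normal[OF \<sigma>, of c] by (subst integrable_density) auto
    qed simp
    then show "integrable (normal_product n \<sigma>) (\<lambda>w. C * (\<Prod>j<n. exp (c * \<bar>w j\<bar>)))" by simp
    show "AE w in normal_product n \<sigma>. norm (f w) \<le> norm (C * (\<Prod>j<n. exp (c * \<bar>w j\<bar>)))"
    proof (rule AE_I2)
      fix w
      have "\<bar>f w\<bar> \<le> C * (\<Prod>j<n. exp (c * \<bar>w j\<bar>))"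
        using C(2)[of w] by (simp add: exp_sum[symmetric] sum_distrib_left)
      then show "norm (f w) \<le> norm (C * (\<Prod>j<n. exp (c * \<bar>w j\<bar>)))"
        by simp
    qed
  qed (use m in \<open>simp add: measurable_normal_product\<close>)
qed

text \<open>Fubini isolates coordinate \<open>k\<close>; for fixed other coordinates the inner
  integral vanishes by the one-dimensional formula.\<close>

lemma normal_product_integration_by_parts:
  assumes \<sigma>: "0 < \<sigma>" and k: "k < n"
    and m: "f \<in> borel_measurable (\<Pi>\<^sub>M j\<in>{..<n}. borel)" "f' \<in> borel_measurable (\<Pi>\<^sub>M j\<in>{..<n}. borel)"
    and b: "exp_bounded n f" "exp_bounded n f'"
    and der: "\<And>w. ((\<lambda>u. f (w(k := u))) has_real_derivative f' w) (at (w k))"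
  shows "(\<integral>w. w k * f w \<partial>normal_product n \<sigma>) = \<sigma>\<^sup>2 * (\<integral>w. f' w \<partial>normal_product n \<sigma>)"
proof -
  interpret N: prob_space "normal_measure \<sigma>" by (rule prob_space_normal_density[OF \<sigma>])
  interpret PS: product_sigma_finite "\<lambda>_::nat. normal_measure \<sigma>" by standard
  note [measurable] = m
  have [measurable]: "(\<lambda>w. w k) \<in> borel_measurable (\<Pi>\<^sub>M j\<in>{..<n}. borel)"
    using k by (intro measurable_component_singleton) auto
  have I1: "integrable (normal_product n \<sigma>) (\<lambda>w. w k * f w)"
    using k by (intro integrable_exp_bounded \<sigma> exp_bounded_intros b) measurable
  have I2: "integrable (normal_product n \<sigma>) f'"
    by (intro integrable_exp_bounded \<sigma> b) measurable
  define J where "J = {..<n} - {k}"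
  have ins: "{..<n} = insert k J" using k unfolding J_def by auto
  have J: "finite J" "k \<notin> J" unfolding J_def by auto
  obtain C c where C: "0 \<le> c" "\<And>w. \<bar>f w\<bar> \<le> C * exp (c * (\<Sum>j<n. \<bar>w j\<bar>))"
    using b(1) unfolding exp_bounded_def by blast
  obtain D d where D: "0 \<le> d" "\<And>w. \<bar>f' w\<bar> \<le> D * exp (d * (\<Sum>j<n. \<bar>w j\<bar>))"
    using b(2) unfolding exp_bounded_def by blast
  have CD: "0 \<le> C" "0 \<le> D"
    using C(2)[of "\<lambda>_. 0"] D(2)[of "\<lambda>_. 0"] by auto
  have "(\<integral>w. w k * f w - \<sigma>\<^sup>2 * f' w \<partial>normal_product n \<sigma>)
      = (\<integral>x. (\<integral>y. (x(k := y)) k * f (x(k := y)) - \<sigma>\<^sup>2 * f' (x(k := y)) \<partial>normal_measure \<sigma>)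
           \<partial>Pi\<^sub>M J (\<lambda>_. normal_measure \<sigma>))"
    unfolding normal_product_def ins
  proof (rule PS.product_integral_insert)
    show "integrable (Pi\<^sub>M (insert k J) (\<lambda>_. normal_measure \<sigma>)) (\<lambda>w. w k * f w - \<sigma>\<^sup>2 * f' w)"
      using I1 I2 unfolding normal_product_def ins by simp
  qed (simp_all add: J_def)
  also have "\<dots> = (\<integral>x. 0 \<partial>Pi\<^sub>M J (\<lambda>_. normal_measure \<sigma>))"
  proof (rule Bochner_Integration.integral_cong[OF refl])
    fix x assume x: "x \<in> space (Pi\<^sub>M J (\<lambda>_. normal_measure \<sigma>))"
    define q where "q = (\<Sum>j\<in>J. \<bar>x j\<bar>)"
    have q: "0 \<le> q" unfolding q_def by (simp add: sum_nonneg)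
    have s: "(\<Sum>j<n. \<bar>(x(k := y)) j\<bar>) = \<bar>y\<bar> + q" for y
    proof -
      have "(\<Sum>j\<in>J. \<bar>(x(k := y)) j\<bar>) = q"
        unfolding q_def using J by (intro sum.cong) auto
      then show ?thesis unfolding ins using J by (simp add: sum.insert)
    qed
    have e: "E * exp (b * (\<bar>y\<bar> + q)) \<le> (C * exp (c * q) + D * exp (d * q)) * exp ((c + d) * \<bar>y\<bar>)"
      if "(E, b) \<in> {(C, c), (D, d)}" for E b y
    proof -
      have "b * \<bar>y\<bar> \<le> (c + d) * \<bar>y\<bar>" "0 \<le> E"
        using that C(1) D(1) CD by (auto intro: mult_right_mono)
      then have "E * exp (b * (\<bar>y\<bar> + q)) \<le> E * exp (b * q + (c + d) * \<bar>y\<bar>)"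
        by (intro mult_left_mono) (auto simp: distrib_left)
      also have "\<dots> = E * exp (b * q) * exp ((c + d) * \<bar>y\<bar>)"
        by (simp add: exp_add)
      also have "E * exp (b * q) * exp ((c + d) * \<bar>y\<bar>)
          \<le> (C * exp (c * q) + D * exp (d * q)) * exp ((c + d) * \<bar>y\<bar>)"
        using that CD by (intro mult_right_mono) auto
      finally show ?thesis .
    qed
    have [measurable]: "(\<lambda>y. f' (x(k := y))) \<in> borel_measurable borel"
    proof -
      have "(\<lambda>y. x(k := y)) \<in> borel \<rightarrow>\<^sub>M (\<Pi>\<^sub>M j\<in>{..<n}. borel)"
      proof (rule measurable_PiM_single')
        show "(\<lambda>\<omega>. (x(k := \<omega>)) i) \<in> borel_measurable borel" if "i \<in> {..<n}" for i
          by (cases "i = k") auto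
        show "(\<lambda>y. x(k := y)) \<in> space borel \<rightarrow> (\<Pi>\<^sub>E i\<in>{..<n}. space borel)"
          using x unfolding ins space_PiM by (auto simp: PiE_def extensional_def)
      qed
      then show ?thesis by (rule measurable_compose[OF _ m(2)])
    qed
    show "(\<integral>y. (x(k := y)) k * f (x(k := y)) - \<sigma>\<^sup>2 * f' (x(k := y)) \<partial>normal_measure \<sigma>) = 0"
    proof (simp, rule normal_integration_by_parts[OF \<sigma>])
      show "0 \<le> c + d" using C D by simp
      show "((\<lambda>y. f (x(k := y))) has_real_derivative f' (x(k := u))) (at u)" for u
        using der[of "x(k := u)"] by simp
      show "\<bar>f (x(k := u))\<bar> \<le> (C * exp (c * q) + D * exp (d * q)) * exp ((c + d) * \<bar>u\<bar>)" for u
        using C(2)[of "x(k := u)"] e[of C c u] unfolding s by simp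
      show "\<bar>f' (x(k := u))\<bar> \<le> (C * exp (c * q) + D * exp (d * q)) * exp ((c + d) * \<bar>u\<bar>)" for u
        using D(2)[of "x(k := u)"] e[of D d u] unfolding s by simp
    qed simp
  qed
  finally show ?thesis using I1 I2 by simp
qed


text \<open>Each coordinate of \<open>w\<close> has variance \<open>t\<close>, so \<open>X\<close>
  has covariance \<open>t B\<close>; \<open>K\<close> is the inverse of \<open>B\<close>.\<close>

locale gaussian_vector =
  fixes n :: nat and t :: real and R B K :: "nat \<Rightarrow> nat \<Rightarrow> real" and \<mu> :: "nat \<Rightarrow> real"
  assumes t_pos: "0 < t"
    and RR: "\<And>i j. i < n \<Longrightarrow> j < n \<Longrightarrow> (\<Sum>k<n. R i k * R j k) = B i j"
    and KB: "\<And>i j. i < n \<Longrightarrow> j < n \<Longrightarrow> (\<Sum>k<n. K i k * B k j) = (if i = j then 1 else 0)"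
begin

abbreviation P :: "(nat \<Rightarrow> real) measure" where
  "P \<equiv> normal_product n (sqrt t)"

definition X :: "nat \<Rightarrow> (nat \<Rightarrow> real) \<Rightarrow> real" where
  "X k w = \<mu> k + (\<Sum>j<n. R k j * w j)"

definition Y :: "(nat \<Rightarrow> real) \<Rightarrow> real" where
  "Y w = (\<Sum>k<n. exp (X k w))"

text \<open>Minus the gradient of the log-density of \<open>X\<close>: the multiplier that
  integration by parts in the coordinates of \<open>X\<close> produces.\<close>

definition Z :: "nat \<Rightarrow> (nat \<Rightarrow> real) \<Rightarrow> real" where
  "Z m w = (\<Sum>l<n. K m l * (X l w - \<mu> l)) / t"

text \<open>In \<open>has_grad f F\<close>, \<open>F\<close> is the gradient with respect to \<open>X\<close>, not to \<open>w\<close>.\<close>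

definition tame :: "((nat \<Rightarrow> real) \<Rightarrow> real) \<Rightarrow> bool" where
  "tame f \<longleftrightarrow> f \<in> borel_measurable (\<Pi>\<^sub>M j\<in>{..<n}. borel) \<and> exp_bounded n f"

definition has_grad :: "((nat \<Rightarrow> real) \<Rightarrow> real) \<Rightarrow> (nat \<Rightarrow> (nat \<Rightarrow> real) \<Rightarrow> real) \<Rightarrow> bool" where
  "has_grad f F \<longleftrightarrow> tame f \<and> (\<forall>l<n. tame (F l)) \<and>
    (\<forall>w. \<forall>k<n. ((\<lambda>u. f (w(k := u))) has_real_derivative (\<Sum>l<n. R l k * F l w)) (at (w k)))"

section \<open>Calculus of tame functions and of gradients in log-price coordinates\<close>

lemma tame_const: "tame (\<lambda>_. a)"
  unfolding tame_def by (simp add: exp_bounded_const)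

lemma tame_mult: "tame f \<Longrightarrow> tame g \<Longrightarrow> tame (\<lambda>w. f w * g w)"
  unfolding tame_def by (auto intro: exp_bounded_mult)

lemma tame_add: "tame f \<Longrightarrow> tame g \<Longrightarrow> tame (\<lambda>w. f w + g w)"
  unfolding tame_def by (auto intro: exp_bounded_add)

lemma tame_diff: "tame f \<Longrightarrow> tame g \<Longrightarrow> tame (\<lambda>w. f w - g w)"
  unfolding tame_def by (auto intro: exp_bounded_diff)

lemma tame_divide_const: "tame f \<Longrightarrow> tame (\<lambda>w. f w / c)"
  using tame_mult[OF _ tame_const[of "1 / c"], of f] by simp

lemma tame_uminus: "tame f \<Longrightarrow> tame (\<lambda>w. - f w)"
  unfolding tame_def by (auto intro: exp_bounded_uminus)

lemma tame_sum: "(\<And>i. i \<in> I \<Longrightarrow> tame (f i)) \<Longrightarrow> tame (\<lambda>w. \<Sum>i\<in>I. f i w)"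
  unfolding tame_def by (auto intro!: exp_bounded_sum borel_measurable_sum)

lemma tame_If: "tame f \<Longrightarrow> tame g \<Longrightarrow> tame (\<lambda>w. if b then f w else g w)"
  by (cases b) simp_all

lemma tame_coord: "k < n \<Longrightarrow> tame (\<lambda>w. w k)"
  unfolding tame_def by (auto intro: exp_bounded_coord)

lemma tame_X: "k < n \<Longrightarrow> tame (X k)"
  unfolding X_def by (auto intro!: tame_add tame_sum tame_mult tame_const tame_coord)

lemma tame_exp_X: "k < n \<Longrightarrow> tame (\<lambda>w. exp (s * X k w))"
proof -
  assume k: "k < n"
  have "(\<lambda>w. exp (s * X k w)) = (\<lambda>w. exp (s * \<mu> k + (\<Sum>j<n. (s * R k j) * w j)))"
    by (simp add: X_def fun_eq_iff distrib_left sum_distrib_left mult.assoc)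
  moreover have "X k \<in> borel_measurable (\<Pi>\<^sub>M j\<in>{..<n}. borel)"
    using tame_X[OF k] unfolding tame_def by simp
  ultimately show ?thesis
    unfolding tame_def using exp_bounded_exp_linear[of n "s * \<mu> k" "\<lambda>j. s * R k j"] by simp
qed

lemma tame_exp_X1: "k < n \<Longrightarrow> tame (\<lambda>w. exp (X k w))"
  using tame_exp_X[of k 1] by simp

lemma tame_Y: "tame Y"
  unfolding Y_def by (auto intro!: tame_sum tame_exp_X1)

lemma tame_comp_Y:
  assumes "g \<in> borel_measurable borel" "\<And>y. \<bar>g y\<bar> \<le> C"
  shows "tame (\<lambda>w. g (Y w))"
  using assms tame_Y unfolding tame_def by (auto intro: exp_bounded_bounded measurable_compose)

lemma tame_Z: "m < n \<Longrightarrow> tame (Z m)"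
  unfolding Z_def
  by (auto intro!: tame_divide_const tame_sum tame_mult tame_const tame_diff tame_X)

lemmas tame_intros = tame_const tame_mult tame_add tame_diff tame_uminus tame_divide_const tame_sum
  tame_X tame_exp_X tame_exp_X1 tame_Y tame_Z tame_If

lemma integrable_tame: "tame f \<Longrightarrow> integrable P f"
  unfolding tame_def using t_pos by (intro integrable_exp_bounded) auto

lemma X_update: "k < n \<Longrightarrow> X i (w(k := u)) = X i w + R i k * (u - w k)"
proof -
  assume k: "k < n"
  have "(\<Sum>j<n. R i j * (w(k := u)) j) = (\<Sum>j<n. R i j * w j + (if j = k then R i k * (u - w k) else 0))"
    by (intro sum.cong) (auto simp: algebra_simps)
  then show ?thesis using k by (simp add: X_def sum.distrib)
qed

lemma X_DERIV: "k < n \<Longrightarrow> ((\<lambda>u. X i (w(k := u))) has_real_derivative R i k) (at u)"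
  unfolding X_update by (auto intro!: derivative_eq_intros)

lemma has_grad_const: "has_grad (\<lambda>_. a) (\<lambda>_ _. 0)"
  unfolding has_grad_def by (simp add: tame_const)

lemma has_grad_X:
  assumes "i < n"
  shows "has_grad (X i) (\<lambda>l w. if l = i then 1 else 0)"
  unfolding has_grad_def using assms X_DERIV by (auto simp: tame_X tame_const if_distrib[of "(*) _"] cong: if_cong)

lemma has_grad_add: "has_grad f F \<Longrightarrow> has_grad g G \<Longrightarrow> has_grad (\<lambda>w. f w + g w) (\<lambda>l w. F l w + G l w)"
  unfolding has_grad_def
  by (auto intro!: tame_add DERIV_add simp: distrib_left sum.distrib)

lemma has_grad_mult:
  assumes "has_grad f F" "has_grad g G"
  shows "has_grad (\<lambda>w. f w * g w) (\<lambda>l w. F l w * g w + f w * G l w)"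
  unfolding has_grad_def
proof (intro conjI allI impI)
  fix w k assume k: "k < n"
  have "((\<lambda>u. f (w(k := u)) * g (w(k := u))) has_real_derivative
      (\<Sum>l<n. R l k * F l w) * g (w(k := w k)) + (\<Sum>l<n. R l k * G l w) * f (w(k := w k))) (at (w k))"
    using assms k unfolding has_grad_def by (intro DERIV_mult) auto
  then show "((\<lambda>u. f (w(k := u)) * g (w(k := u))) has_real_derivative
      (\<Sum>l<n. R l k * (F l w * g w + f w * G l w))) (at (w k))"
    by (simp add: distrib_left sum.distrib sum_distrib_left sum_distrib_right mult_ac)
qed (use assms in \<open>auto simp: has_grad_def intro!: tame_intros\<close>)

lemma has_grad_exp_X:
  assumes "i < n"
  shows "has_grad (\<lambda>w. exp (s * X i w)) (\<lambda>l w. if l = i then s * exp (s * X i w) else 0)"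
  unfolding has_grad_def
proof (intro conjI allI impI)
  fix w k assume k: "k < n"
  have "((\<lambda>u. exp (s * X i (w(k := u)))) has_real_derivative exp (s * X i (w(k := w k))) * (s * R i k)) (at (w k))"
    by (auto intro!: derivative_eq_intros X_DERIV[OF k])
  moreover have "(\<Sum>l<n. R l k * (if l = i then s * exp (s * X i w) else 0)) = R i k * (s * exp (s * X i w))"
    using assms by (simp add: if_distrib[of "(*) _"] sum.delta cong: if_cong)
  ultimately show "((\<lambda>u. exp (s * X i (w(k := u)))) has_real_derivative
      (\<Sum>l<n. R l k * (if l = i then s * exp (s * X i w) else 0))) (at (w k))"
    by (simp add: mult_ac)
qed (use assms in \<open>auto intro!: tame_intros simp del: mult_eq_0_iff\<close>)

lemma has_grad_exp_sum: "has_grad (\<lambda>w. \<Sum>l<n. b l * exp (X l w)) (\<lambda>m w. b m * exp (X m w))"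
  unfolding has_grad_def
proof (intro conjI allI impI)
  fix w k assume k: "k < n"
  have "((\<lambda>u. \<Sum>l<n. b l * exp (X l (w(k := u)))) has_real_derivative
      (\<Sum>l<n. b l * (exp (X l (w(k := w k))) * R l k))) (at (w k))"
    by (intro DERIV_sum DERIV_cmult DERIV_fun_exp X_DERIV k)
  then show "((\<lambda>u. \<Sum>l<n. b l * exp (X l (w(k := u)))) has_real_derivative
      (\<Sum>l<n. R l k * (b l * exp (X l w)))) (at (w k))"
    by (simp add: mult_ac)
qed (auto intro!: tame_intros)

lemma has_grad_comp_Y:
  assumes g: "\<And>y. (g has_real_derivative g' y) (at y)" and g': "g' \<in> borel_measurable borel"
    and b: "\<And>y. \<bar>g y\<bar> \<le> C" "\<And>y. \<bar>g' y\<bar> \<le> C"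
  shows "has_grad (\<lambda>w. g (Y w)) (\<lambda>l w. g' (Y w) * exp (X l w))"
  unfolding has_grad_def
proof (intro conjI allI impI)
  have "continuous_on UNIV g"
    using g DERIV_isCont continuous_at_imp_continuous_on by blast
  then show "tame (\<lambda>w. g (Y w))"
    by (intro tame_comp_Y[OF _ b(1)] borel_measurable_continuous_onI)
  show "tame (\<lambda>w. g' (Y w) * exp (X l w))" if "l < n" for l
    by (intro tame_mult tame_comp_Y[OF g' b(2)] tame_exp_X1 that)
  fix w k assume k: "k < n"
  have "((\<lambda>u. Y (w(k := u))) has_real_derivative (\<Sum>l<n. exp (X l (w(k := w k))) * R l k)) (at (w k))"
    unfolding Y_def by (intro DERIV_sum DERIV_fun_exp X_DERIV k)
  then have "((\<lambda>u. g (Y (w(k := u)))) has_real_derivative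
      g' (Y (w(k := w k))) * (\<Sum>l<n. exp (X l (w(k := w k))) * R l k)) (at (w k))"
    by (rule DERIV_chain2[OF g])
  then show "((\<lambda>u. g (Y (w(k := u)))) has_real_derivative
      (\<Sum>l<n. R l k * (g' (Y w) * exp (X l w)))) (at (w k))"
    by (simp add: sum_distrib_left mult_ac)
qed

text \<open>Each coordinate formula contributes a column of \<open>R\<close>. Their combination
  collapses because \<open>K\<close> times \<open>R\<close> times the transpose of \<open>R\<close>
  is \<open>K B\<close>, the identity.\<close>

lemma integration_by_parts:
  assumes f: "has_grad f F" and m: "m < n"
  shows "(\<integral>w. Z m w * f w \<partial>P) = (\<integral>w. F m w \<partial>P)"
proof -
  have tame: "tame f" "\<And>l. l < n \<Longrightarrow> tame (F l)"
    using f unfolding has_grad_def by auto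
  have intF: "integrable P (F l)" if "l < n" for l
    using tame(2)[OF that] by (rule integrable_tame)
  have int1: "integrable P (\<lambda>w. w k * f w)" if "k < n" for k
    by (intro integrable_tame tame_mult tame_coord that tame)
  have coord: "(\<integral>w. w k * f w \<partial>P) = t * (\<Sum>l<n. R l k * (\<integral>w. F l w \<partial>P))" if k: "k < n" for k
  proof -
    have tS: "tame (\<lambda>w. \<Sum>l<n. R l k * F l w)"
      by (auto intro!: tame_sum tame_mult tame_const tame)
    have "(\<integral>w. w k * f w \<partial>P) = (sqrt t)\<^sup>2 * (\<integral>w. (\<Sum>l<n. R l k * F l w) \<partial>P)"
      using t_pos tS tame(1) f k unfolding tame_def has_grad_def
      by (intro normal_product_integration_by_parts) auto
    also have "(\<integral>w. (\<Sum>l<n. R l k * F l w) \<partial>P) = (\<Sum>l<n. R l k * (\<integral>w. F l w \<partial>P))"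
      using intF by (subst Bochner_Integration.integral_sum) auto
    finally show ?thesis using t_pos by simp
  qed
  have "(\<integral>w. Z m w * f w \<partial>P) = (\<integral>w. (\<Sum>k<n. (\<Sum>l<n. K m l * R l k) / t * (w k * f w)) \<partial>P)"
  proof (rule Bochner_Integration.integral_cong[OF refl])
    fix w
    have "(\<Sum>l<n. K m l * (X l w - \<mu> l)) = (\<Sum>k<n. (\<Sum>l<n. K m l * R l k) * w k)"
      unfolding X_def by (simp add: sum_distrib_left sum_distrib_right mult.assoc) (rule sum.swap)
    then show "Z m w * f w = (\<Sum>k<n. (\<Sum>l<n. K m l * R l k) / t * (w k * f w))"
      by (simp add: Z_def sum_divide_distrib sum_distrib_right mult.assoc)
  qed
  also have "\<dots> = (\<Sum>k<n. (\<Sum>l<n. K m l * R l k) / t * (\<integral>w. w k * f w \<partial>P))"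
    using int1 by (subst Bochner_Integration.integral_sum) auto
  also have "\<dots> = (\<Sum>k<n. (\<Sum>l<n. K m l * R l k) * (\<Sum>j<n. R j k * (\<integral>w. F j w \<partial>P)))"
    using t_pos by (intro sum.cong) (auto simp: coord)
  also have "\<dots> = (\<Sum>k<n. \<Sum>l<n. \<Sum>j<n. K m l * (R l k * R j k) * (\<integral>w. F j w \<partial>P))"
    by (simp add: sum_product mult_ac)
  also have "\<dots> = (\<Sum>l<n. \<Sum>j<n. \<Sum>k<n. K m l * (R l k * R j k) * (\<integral>w. F j w \<partial>P))"
  proof -
    let ?f = "\<lambda>l k. \<Sum>j<n. K m l * (R l k * R j k) * (\<integral>w. F j w \<partial>P)"
    have "(\<Sum>k<n. \<Sum>l<n. ?f l k) = (\<Sum>l<n. \<Sum>k<n. ?f l k)"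
      by (rule sum.swap)
    also have "\<dots> = (\<Sum>l<n. \<Sum>j<n. \<Sum>k<n. K m l * (R l k * R j k) * (\<integral>w. F j w \<partial>P))"
      by (rule sum.cong[OF refl], rule sum.swap)
    finally show ?thesis .
  qed
  also have "\<dots> = (\<Sum>l<n. \<Sum>j<n. K m l * B l j * (\<integral>w. F j w \<partial>P))"
    by (intro sum.cong refl) (simp add: RR[symmetric] sum_distrib_left sum_distrib_right mult.assoc)
  also have "\<dots> = (\<Sum>j<n. \<Sum>l<n. K m l * B l j * (\<integral>w. F j w \<partial>P))"
    by (rule sum.swap)
  also have "\<dots> = (\<Sum>j<n. (if m = j then 1 else 0) * (\<integral>w. F j w \<partial>P))"
    using m by (intro sum.cong refl) (simp add: KB[symmetric] sum_distrib_right)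
  also have "\<dots> = (\<integral>w. F m w \<partial>P)"
    using m by (simp add: if_distrib[of "\<lambda>x. x * _"] cong: if_cong)
  finally show ?thesis .
qed

lemma directional_integration_by_parts:
  assumes f: "has_grad f F"
  shows "(\<integral>w. (\<Sum>m<n. c m * Z m w) * f w \<partial>P) = (\<integral>w. (\<Sum>m<n. c m * F m w) \<partial>P)"
proof -
  have tame: "tame f" "\<And>l. l < n \<Longrightarrow> tame (F l)"
    using f unfolding has_grad_def by auto
  have "(\<integral>w. (\<Sum>m<n. c m * Z m w) * f w \<partial>P) = (\<integral>w. (\<Sum>m<n. c m * (Z m w * f w)) \<partial>P)"
    by (simp add: sum_distrib_right mult.assoc)
  also have "\<dots> = (\<Sum>m<n. c m * (\<integral>w. Z m w * f w \<partial>P))"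
    by (subst Bochner_Integration.integral_sum) (auto intro!: integrable_tame tame_intros tame)
  also have "\<dots> = (\<Sum>m<n. c m * (\<integral>w. F m w \<partial>P))"
    by (intro sum.cong refl) (simp add: integration_by_parts[OF f])
  also have "\<dots> = (\<integral>w. (\<Sum>m<n. c m * F m w) \<partial>P)"
    by (subst Bochner_Integration.integral_sum) (auto intro!: integrable_tame tame_intros tame)
  finally show ?thesis .
qed

text \<open>The vector field \<open>(\<partial>\<^sub>b Y) \<partial>\<^sub>c - (\<partial>\<^sub>c Y) \<partial>\<^sub>b\<close> is tangent to the level sets of \<open>Y\<close>, so the
  derivative of \<open>g\<close> cancels. This is what makes the identity usable for conditional expectations
  given \<open>Y\<close>: no density of \<open>Y\<close> is needed.\<close>

lemma tilted_tangential_integration_by_parts: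
  fixes b c :: "nat \<Rightarrow> real" and s :: real
  assumes q: "has_grad q Q" and i: "i < n"
    and g: "\<And>y. (g has_real_derivative g' y) (at y)" "g' \<in> borel_measurable borel"
    and bd: "\<And>y. \<bar>g y\<bar> \<le> C" "\<And>y. \<bar>g' y\<bar> \<le> C"
  defines "Zs \<equiv> \<lambda>m w. Z m w - (if m = i then s else 0)"
  shows "(\<integral>w. ((\<Sum>m<n. c m * Zs m w) * (\<Sum>l<n. b l * exp (X l w))
              - (\<Sum>l<n. b l * Zs l w) * (\<Sum>m<n. c m * exp (X m w))) * q w
              * (exp (s * X i w) * g (Y w)) \<partial>P)
    = (\<integral>w. ((\<Sum>l<n. b l * exp (X l w)) * (\<Sum>m<n. c m * Q m w)
              - (\<Sum>m<n. c m * exp (X m w)) * (\<Sum>l<n. b l * Q l w))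
              * (exp (s * X i w) * g (Y w)) \<partial>P)"
proof -
  define \<rho> where "\<rho> w = exp (s * X i w) * g (Y w)" for w
  define U where "U c w = (\<Sum>m<n. c m * exp (X m w))" for c :: "nat \<Rightarrow> real" and w
  define V where "V c w = (\<Sum>m<n. c m * Q m w)" for c :: "nat \<Rightarrow> real" and w
  define ZZ where "ZZ c w = (\<Sum>m<n. c m * Z m w)" for c :: "nat \<Rightarrow> real" and w
  define G where "G w = exp (s * X i w) * g' (Y w) * q w" for w
  define CC where "CC w = (\<Sum>m<n. c m * b m * exp (X m w)) * q w * \<rho> w" for w
  note gY = has_grad_comp_Y[OF g bd]
  note h = has_grad_mult[OF q has_grad_mult[OF has_grad_exp_X[OF i] gY], of s]
  have tq: "tame q" "\<And>l. l < n \<Longrightarrow> tame (Q l)" "tame (\<lambda>w. g (Y w))"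
    using q gY unfolding has_grad_def by auto
  have tG: "tame G"
    unfolding G_def using i by (intro tame_intros tq tame_comp_Y[OF g(2) bd(2)])
  have tU: "tame (U c)" "tame (V c)" "tame (ZZ c)" for c
    unfolding U_def V_def ZZ_def by (intro tame_intros tq; simp)+
  have t\<rho>: "tame \<rho>" unfolding \<rho>_def using i by (intro tame_intros tq)
  have tCC: "tame CC" unfolding CC_def by (intro tame_intros tq t\<rho>) auto
  \<comment> \<open>Result of integrating by parts in direction \<open>c\<close> against
    \<open>U b * q * \<rho>\<close>. The mixed second derivative \<open>CC\<close> and the term with
    \<open>g'\<close> are symmetric in the two directions and drop out of the antisymmetric
    difference; the term with \<open>s\<close> is the shift of the score caused by the tilt.
    \<open>CC\<close> is fixed once, and the premise on it in \<open>ibp\<close> lets it serve both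
    orders.\<close>
  define N where "N c b w = CC w + U b w * V c w * \<rho> w + U b w * (s * c i) * q w * \<rho> w + U b w * U c w * G w"
    for c b :: "nat \<Rightarrow> real" and w
  have tN: "tame (N c b)" for c b
    unfolding N_def by (intro tame_intros tCC tU t\<rho> tq tG)
  have ibp: "(\<integral>w. ZZ c w * (U b w * (q w * \<rho> w)) \<partial>P) = (\<integral>w. N c b w \<partial>P)"
    if sym: "\<And>w. (\<Sum>m<n. c m * b m * exp (X m w)) * q w * \<rho> w = CC w" for c b
  proof -
    have "(\<integral>w. ZZ c w * (U b w * (q w * \<rho> w)) \<partial>P)
      = (\<integral>w. (\<Sum>m<n. c m * (b m * exp (X m w) * (q w * (exp (s * X i w) * g (Y w))) + U b w *
          (Q m w * (exp (s * X i w) * g (Y w)) + q w * ((if m = i then s * exp (s * X i w) else 0) * g (Y w)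
            + exp (s * X i w) * (g' (Y w) * exp (X m w)))))) \<partial>P)"
      unfolding ZZ_def \<rho>_def by (rule directional_integration_by_parts[OF has_grad_mult[OF has_grad_exp_sum[folded U_def] h]])
    also have "\<dots> = (\<integral>w. N c b w \<partial>P)"
    proof (intro Bochner_Integration.integral_cong refl)
      fix w
      have d: "(\<Sum>m<n. c m * (if m = i then s * exp (s * X i w) else 0)) = s * c i * exp (s * X i w)"
        using i by (simp add: if_distrib[of "(*) _"] cong: if_cong)
      have "N c b w = (\<Sum>m<n. c m * b m * exp (X m w)) * q w * \<rho> w + U b w * V c w * \<rho> w
          + U b w * (\<Sum>m<n. c m * (if m = i then s * exp (s * X i w) else 0)) * q w * g (Y w) + U b w * U c w * G w"
        unfolding N_def sym d unfolding \<rho>_def by simp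
      then show "(\<Sum>m<n. c m * (b m * exp (X m w) * (q w * (exp (s * X i w) * g (Y w))) + U b w *
          (Q m w * (exp (s * X i w) * g (Y w)) + q w * ((if m = i then s * exp (s * X i w) else 0) * g (Y w)
            + exp (s * X i w) * (g' (Y w) * exp (X m w)))))) = N c b w"
        unfolding V_def U_def[of c] G_def \<rho>_def
        by (simp only: sum_distrib_left sum_distrib_right sum.distrib[symmetric]) (intro sum.cong refl, simp add: algebra_simps)
    qed
    finally show ?thesis .
  qed
  have Zs: "(\<Sum>m<n. c m * Zs m w) = ZZ c w - s * c i" for c w
    unfolding Zs_def ZZ_def using i
    by (simp add: right_diff_distrib sum_subtractf if_distrib[of "(*) _"] mult.commute cong: if_cong)
  have int: "integrable P (\<lambda>w. ZZ c w * (U b w * (q w * \<rho> w)))" for c b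
    by (intro integrable_tame tame_intros tU tq t\<rho>)
  have i2: "integrable P (\<lambda>w. s * (c i * U b w - b i * U c w) * q w * \<rho> w)" for c b
    by (intro integrable_tame tame_intros tU tq t\<rho>)
  have "(\<integral>w. ((ZZ c w - s * c i) * U b w - (ZZ b w - s * b i) * U c w) * q w * \<rho> w \<partial>P)
     = (\<integral>w. ZZ c w * (U b w * (q w * \<rho> w)) - ZZ b w * (U c w * (q w * \<rho> w))
          - s * (c i * U b w - b i * U c w) * q w * \<rho> w \<partial>P)"
    by (intro Bochner_Integration.integral_cong refl) (simp add: algebra_simps)
  also have "\<dots> = (\<integral>w. N c b w \<partial>P) - (\<integral>w. N b c w \<partial>P) - (\<integral>w. s * (c i * U b w - b i * U c w) * q w * \<rho> w \<partial>P)"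
  proof -
    have "(\<integral>w. ZZ c w * (U b w * (q w * \<rho> w)) \<partial>P) = (\<integral>w. N c b w \<partial>P)"
      "(\<integral>w. ZZ b w * (U c w * (q w * \<rho> w)) \<partial>P) = (\<integral>w. N b c w \<partial>P)"
      by (rule ibp, simp add: CC_def mult.commute)+
    then show ?thesis using int i2 by simp
  qed
  also have "\<dots> = (\<integral>w. N c b w - N b c w - s * (c i * U b w - b i * U c w) * q w * \<rho> w \<partial>P)"
    using i2 integrable_tame[OF tN] by simp
  also have "\<dots> = (\<integral>w. (U b w * V c w - U c w * V b w) * \<rho> w \<partial>P)"
    by (intro Bochner_Integration.integral_cong refl) (simp add: N_def algebra_simps)
  finally show ?thesis unfolding Zs U_def[symmetric] V_def[symmetric] \<rho>_def[symmetric] .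
qed

end

section \<open>Deterministic estimates\<close>

text \<open>Later \<open>A\<close> is a multiple of the optimal weights and
  \<open>\<beta> = B A\<close>. The \<open>k\<close>-th asset has typical size \<open>x\<close> to
  the power \<open>\<beta> k\<close>, so the gap \<open>b\<close> makes assets outside
  \<open>I\<close> negligible. \<open>D\<close> bounds all corrections of order one.\<close>

locale tail_parameters =
  fixes n :: nat and I :: "nat set" and A \<beta> :: "nat \<Rightarrow> real" and S D b \<beta>m Am :: real
  assumes I: "I \<subseteq> {..<n}"
    and S_def: "S = (\<Sum>k\<in>I. A k)" and S_pos: "0 < S"
    and Am: "0 < Am" "\<And>k. k \<in> I \<Longrightarrow> Am \<le> A k"
    and D: "0 \<le> D" and b: "0 < b"
    and \<beta>I: "\<And>k. k \<in> I \<Longrightarrow> \<beta> k = 1"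
    and \<beta>J: "\<And>k. k < n \<Longrightarrow> k \<notin> I \<Longrightarrow> 1 + b \<le> \<beta> k"
    and \<beta>m: "1 \<le> \<beta>m" "\<And>k. k < n \<Longrightarrow> \<beta> k \<le> \<beta>m"
begin

definition J :: "nat set" where "J = {..<n} - I"

text \<open>Error constant of \<open>pv_ge\<close>, in units of \<open>1 / L\<close>: 1 for the
  width of the window of \<open>Y\<close>, and \<open>exp (D / 2) * (2 / b)\<close> for each asset
  outside \<open>I\<close>.\<close>

definition slack :: real where "slack = 1 + real n * exp (D / 2) * (2 / b)"

definition Dn :: real where "Dn = real n * (\<beta>m * D)"

text \<open>The summands serve, in order: \<open>1 - 1 / L \<ge> 1 / 2\<close>; half of the tail
  exponent exceeding \<open>b * L / 4 + 1\<close>; \<open>\<bar>bd\<bar> \<le> L * S / 2\<close>;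
  and absorption of the errors proportional to \<open>a\<close> into
  \<open>L / 4 * a\<close>.\<close>

definition Lmin :: real where
  "Lmin = 2 + (2 * D + 4) / b + 2 * Dn / S + 4 * (Dn / Am + slack)"

lemma finite_IJ [simp]: "finite I" "finite J"
  using I finite_subset unfolding J_def by auto

lemma sum_IJ: "(\<Sum>k<n. f k) = (\<Sum>k\<in>I. f k) + (\<Sum>k\<in>J. f k)" for f :: "nat \<Rightarrow> real"
proof -
  have "{..<n} = I \<union> J" "I \<inter> J = {}" using I unfolding J_def by auto
  then show ?thesis by (simp add: sum.union_disjoint)
qed

lemma A_pos: "k \<in> I \<Longrightarrow> 0 < A k"
  using Am by force

lemma slack_ge: "1 \<le> slack" unfolding slack_def using b by simp

lemma Dn_ge: "0 \<le> Dn" unfolding Dn_def using \<beta>m D by simp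

lemma Lmin_pos: "2 \<le> Lmin"
proof -
  have "0 \<le> (2 * D + 4) / b" "0 \<le> 2 * Dn / S" "0 \<le> 4 * (Dn / Am + slack)"
    using D b S_pos Dn_ge slack_ge Am by auto
  then show ?thesis unfolding Lmin_def by linarith
qed

end

text \<open>Here \<open>exp (v k + \<kappa> k - (\<beta> k - 1) * L)\<close> is the fraction \<open>exp X\<^sub>k / x\<close> of the \<open>k\<close>-th asset and \<open>Q\<close>
  stands for the inverse covariance form at \<open>v\<close>. The quantity \<open>a / S\<close> below is the relative entropy
  of the weights \<open>A / S\<close> with respect to these fractions.\<close>

locale tail_point = tail_parameters +
  fixes L :: real and v \<kappa> d :: "nat \<Rightarrow> real" and Q :: real
  assumes L: "Lmin \<le> L"
    and \<kappa>I: "\<And>k. k \<in> I \<Longrightarrow> \<kappa> k = ln (A k / S)"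
    and \<kappa>D: "\<And>k. k < n \<Longrightarrow> \<bar>\<kappa> k\<bar> \<le> D"
    and dI: "\<And>k. k < n \<Longrightarrow> k \<notin> I \<Longrightarrow> d k = 0"
    and dD: "\<And>k. k \<in> I \<Longrightarrow> \<bar>d k\<bar> \<le> D"
    and Q: "0 \<le> Q"
    and sum_le: "(\<Sum>k<n. exp (v k + \<kappa> k - (\<beta> k - 1) * L)) \<le> 1"
    and sum_ge: "1 - 1 / L \<le> (\<Sum>k<n. exp (v k + \<kappa> k - (\<beta> k - 1) * L))"
begin

definition p :: "nat \<Rightarrow> real" where "p k = exp (v k + \<kappa> k - (\<beta> k - 1) * L)"
definition a :: real where "a = - (\<Sum>k\<in>I. A k * v k)"
text \<open>The derivative of \<open>Y\<close> in direction \<open>\<beta>\<close>, divided by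
  \<open>x\<close>.\<close>

definition \<gamma> :: real where "\<gamma> = (\<Sum>k<n. \<beta> k * p k)"
definition pJ :: real where "pJ = (\<Sum>k\<in>J. p k)"
definition dv :: real where "dv = (\<Sum>k<n. d k * v k)"
definition pv :: real where "pv = (\<Sum>k<n. p k * v k)"
definition bd :: real where "bd = (\<Sum>k<n. \<beta> k * d k)"
definition r :: "nat \<Rightarrow> real" where "r k = exp (v k) - 1 - v k"
text \<open>The powers of \<open>L\<close> match the expected sizes of \<open>Q\<close>,
  \<open>a\<close> and \<open>pJ\<close>, so that every summand is of order one on average; all
  error terms are measured by this quantity.\<close>

definition control :: real where "control = 1 + Q + L * a + L\<^sup>2 * pJ"

section \<open>Pointwise bounds on entropy, tail fractions and energy\<close>

lemma L_ge: "2 \<le> L" "b * L \<ge> 2 * D + 4" "S * L \<ge> 2 * Dn" "L \<ge> 4 * (Dn / Am + slack)"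
proof -
  have nn: "0 \<le> (2 * D + 4) / b" "0 \<le> 2 * Dn / S" "0 \<le> 4 * (Dn / Am + slack)"
    using D b S_pos Dn_ge slack_ge Am by auto
  then show "2 \<le> L" "L \<ge> 4 * (Dn / Am + slack)" using L unfolding Lmin_def by linarith+
  have "(2 * D + 4) / b \<le> L" "2 * Dn / S \<le> L" using nn L unfolding Lmin_def by linarith+
  then show "b * L \<ge> 2 * D + 4" "S * L \<ge> 2 * Dn" using b S_pos by (auto simp: field_simps)
qed

lemma p_pos: "0 < p k" unfolding p_def by simp

lemma p_I: "k \<in> I \<Longrightarrow> S * p k = A k * exp (v k)"
  using \<kappa>I[of k] \<beta>I[of k] A_pos[of k] S_pos by (simp add: p_def exp_add)

lemma pJ_nonneg: "0 \<le> pJ" unfolding pJ_def using p_pos by (simp add: sum_nonneg less_imp_le)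

lemma y_split: "(\<Sum>k<n. p k) = (\<Sum>k\<in>I. p k) + pJ"
  unfolding pJ_def by (rule sum_IJ)

lemma y_bounds: "(\<Sum>k<n. p k) \<le> 1" "1 - 1 / L \<le> (\<Sum>k<n. p k)"
  using sum_le sum_ge unfolding p_def by auto

lemma pI_nonneg: "0 \<le> (\<Sum>k\<in>I. p k)" using p_pos by (simp add: sum_nonneg less_imp_le)

lemma pJ_le: "pJ \<le> 1" using y_split y_bounds pI_nonneg by linarith

lemma r_nonneg: "0 \<le> r k" unfolding r_def using exp_ge_add_one_self[of "v k"] by linarith

text \<open>Because \<open>S * p k = A k * exp (v k)\<close> on \<open>I\<close>, the entropy splits
  into nonnegative pieces \<open>A k * r k\<close> and a mass defect. The fractions sum to at most
  1, so \<open>a\<close> dominates every piece.\<close>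

lemma sum_A_r: "(\<Sum>k\<in>I. A k * r k) = S * ((\<Sum>k\<in>I. p k) - 1) + a"
proof -
  have "(\<Sum>k\<in>I. A k * r k) = (\<Sum>k\<in>I. S * p k - A k - A k * v k)"
    by (intro sum.cong refl) (simp add: p_I r_def algebra_simps)
  then show ?thesis
    by (simp add: sum_subtractf a_def S_def[symmetric] sum_distrib_left right_diff_distrib)
qed

lemma a_ge_sum: "(\<Sum>k\<in>I. A k * r k) \<le> a"
proof -
  have "(\<Sum>k\<in>I. p k) - 1 \<le> 0" using y_split y_bounds pJ_nonneg by linarith
  then have "S * ((\<Sum>k\<in>I. p k) - 1) \<le> 0" using S_pos by (simp add: mult_nonneg_nonpos)
  then show ?thesis unfolding sum_A_r by simp
qed

lemma A_r_le: "k \<in> I \<Longrightarrow> A k * r k \<le> a"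
proof -
  assume k: "k \<in> I"
  have "A k * r k \<le> (\<Sum>k\<in>I. A k * r k)"
    using k A_pos r_nonneg by (intro member_le_sum) (auto simp: less_imp_le)
  then show ?thesis using a_ge_sum by linarith
qed

lemma a_nonneg: "0 \<le> a"
proof -
  have "0 \<le> (\<Sum>k\<in>I. A k * r k)"
    using A_pos r_nonneg by (intro sum_nonneg) (simp add: less_imp_le)
  then show ?thesis using a_ge_sum by linarith
qed

text \<open>\<open>exp v - 1 - v\<close> grows at least linearly in both directions, quadratically
  in fact for positive \<open>v\<close>.\<close>

lemma abs_v_le: "k \<in> I \<Longrightarrow> \<bar>v k\<bar> \<le> 1 + a / Am"
proof -
  assume k: "k \<in> I"
  have "\<bar>v k\<bar> \<le> r k + 1"
  proof (cases "v k \<ge> 0")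
    case True
    have "1 + v k + (v k)\<^sup>2 / 2 \<le> exp (v k)" by (rule exp_lower_Taylor_quadratic[OF True])
    moreover have "0 \<le> (v k - 1)\<^sup>2" by simp
    ultimately show ?thesis using True unfolding r_def by (simp add: power2_eq_square algebra_simps)
  next
    case False
    then show ?thesis unfolding r_def by (simp add: less_imp_le)
  qed
  moreover have "r k \<le> a / Am"
  proof -
    have "Am * r k \<le> A k * r k" using Am(2)[OF k] r_nonneg by (rule mult_right_mono)
    then show ?thesis using A_r_le[OF k] Am(1) by (simp add: pos_le_divide_eq mult.commute)
  qed
  ultimately show ?thesis by simp
qed

lemma card_I_le: "real (card I) \<le> real n"
  using card_mono[OF _ I] by simp

lemma abs_dv_le: "\<bar>dv\<bar> \<le> real n * D * (1 + a / Am)"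
proof -
  have "dv = (\<Sum>k\<in>I. d k * v k)"
    unfolding dv_def sum_IJ using dI unfolding J_def by simp
  then have "\<bar>dv\<bar> \<le> (\<Sum>k\<in>I. \<bar>d k * v k\<bar>)" by simp
  also have "\<dots> \<le> (\<Sum>k\<in>I. D * (1 + a / Am))"
    unfolding abs_mult using dD abs_v_le D by (intro sum_mono mult_mono) auto
  also have "\<dots> = real (card I) * (D * (1 + a / Am))" by simp
  also have "\<dots> \<le> real n * (D * (1 + a / Am))"
    using card_I_le D a_nonneg Am by (intro mult_right_mono) auto
  finally show ?thesis by (simp add: mult.assoc)
qed

lemma abs_bd_le: "\<bar>bd\<bar> \<le> Dn"
proof -
  have "bd = (\<Sum>k\<in>I. d k)"
    unfolding bd_def sum_IJ using dI \<beta>I unfolding J_def by simp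
  then have "\<bar>bd\<bar> \<le> (\<Sum>k\<in>I. \<bar>d k\<bar>)" by simp
  also have "\<dots> \<le> (\<Sum>k\<in>I. D)" using dD by (intro sum_mono) auto
  also have "\<dots> \<le> real n * D" using card_I_le D by (simp add: mult_right_mono)
  also have "\<dots> \<le> Dn" unfolding Dn_def using D \<beta>m by (simp add: mult_left_mono mult_right_mono mult.commute[of \<beta>m] mult_le_cancel_left1)
  finally show ?thesis .
qed

lemma \<gamma>_eq: "\<gamma> = (\<Sum>k<n. p k) + (\<Sum>k\<in>J. (\<beta> k - 1) * p k)"
proof -
  have "\<gamma> = (\<Sum>k<n. p k) + (\<Sum>k<n. (\<beta> k - 1) * p k)"
    unfolding \<gamma>_def sum.distrib[symmetric] by (simp add: algebra_simps)
  also have "(\<Sum>k<n. (\<beta> k - 1) * p k) = (\<Sum>k\<in>J. (\<beta> k - 1) * p k)"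
    unfolding sum_IJ using \<beta>I by simp
  finally show ?thesis .
qed

lemma excess_bounds: "0 \<le> (\<Sum>k\<in>J. (\<beta> k - 1) * p k)" "(\<Sum>k\<in>J. (\<beta> k - 1) * p k) \<le> \<beta>m * pJ"
proof -
  show "0 \<le> (\<Sum>k\<in>J. (\<beta> k - 1) * p k)"
    using \<beta>J b p_pos unfolding J_def by (intro sum_nonneg mult_nonneg_nonneg) (auto simp: less_imp_le, force)
  have "(\<Sum>k\<in>J. (\<beta> k - 1) * p k) \<le> (\<Sum>k\<in>J. \<beta>m * p k)"
  proof (intro sum_mono mult_right_mono)
    show "\<beta> k - 1 \<le> \<beta>m" if "k \<in> J" for k using \<beta>m(2)[of k] that unfolding J_def by auto
  qed (simp add: p_pos less_imp_le)
  then show "(\<Sum>k\<in>J. (\<beta> k - 1) * p k) \<le> \<beta>m * pJ" by (simp add: pJ_def sum_distrib_left)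
qed

lemma \<gamma>_ge: "1 / 2 \<le> \<gamma>"
proof -
  have "1 / L \<le> 1 / 2" using L_ge(1) by (simp add: field_simps)
  then show ?thesis using \<gamma>_eq excess_bounds(1) y_bounds(2) by linarith
qed

lemma \<gamma>_le: "\<gamma> \<le> \<beta>m"
proof -
  have "\<gamma> \<le> (\<Sum>k<n. \<beta>m * p k)"
    unfolding \<gamma>_def using \<beta>m(2) p_pos by (intro sum_mono mult_right_mono) (auto simp: less_imp_le)
  also have "\<dots> = \<beta>m * (\<Sum>k<n. p k)" by (simp add: sum_distrib_left)
  also have "\<dots> \<le> \<beta>m * 1" using y_bounds \<beta>m by (intro mult_left_mono) auto
  finally show ?thesis by simp
qed

text \<open>\<open>\<gamma>\<close> falls short of 1 at most by the window width
  \<open>1 / L\<close> and exceeds it only through the excess of \<open>\<beta>\<close> over 1 on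
  the tail.\<close>

lemma \<gamma>_minus_1: "\<bar>L * (\<gamma> - 1)\<bar> \<le> \<beta>m * (L * pJ) + 1"
proof -
  have "- (1 / L) \<le> \<gamma> - 1" "\<gamma> - 1 \<le> \<beta>m * pJ"
    using \<gamma>_eq excess_bounds y_bounds by linarith+
  then have "L * (- (1 / L)) \<le> L * (\<gamma> - 1)" "L * (\<gamma> - 1) \<le> L * (\<beta>m * pJ)"
    using L_ge(1) by (intro mult_left_mono; simp)+
  moreover have "L * (- (1 / L)) = - 1" using L_ge(1) by simp
  moreover have "0 \<le> \<beta>m * (L * pJ)" using \<beta>m L_ge pJ_nonneg by simp
  ultimately show ?thesis by (simp add: mult.left_commute)
qed

text \<open>On \<open>I\<close>, \<open>exp v * (1 - v) \<le> 1\<close> bounds the sum below by a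
  mass defect. Outside \<open>I\<close> an asset with a sizeable fraction must have a deviation of
  order \<open>L\<close>, which yields the gain proportional to \<open>L * pJ\<close>.\<close>

lemma pv_ge: "- (slack / L) + b * L / 4 * pJ \<le> pv"
proof -
  have "(\<Sum>k\<in>I. p k * v k) \<ge> (\<Sum>k\<in>I. p k - A k / S)"
  proof (rule sum_mono)
    fix k assume k: "k \<in> I"
    have "1 - v k \<le> exp (- v k)" using exp_ge_add_one_self[of "- v k"] by simp
    then have "exp (v k) * (1 - v k) \<le> exp (v k) * exp (- v k)" by (intro mult_left_mono) auto
    then have "exp (v k) - exp (v k) * v k \<le> 1" by (simp add: exp_minus right_diff_distrib)
    then have "A k * (exp (v k) - exp (v k) * v k) \<le> A k * 1"
      using A_pos[OF k] by (intro mult_left_mono) auto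
    then have "A k * exp (v k) - A k * exp (v k) * v k \<le> A k"
      by (simp add: algebra_simps)
    then have "S * p k - S * p k * v k \<le> A k" unfolding p_I[OF k] .
    then show "p k - A k / S \<le> p k * v k" using S_pos by (simp add: field_simps)
  qed
  moreover have "(\<Sum>k\<in>I. p k - A k / S) = (\<Sum>k\<in>I. p k) - 1"
    using S_pos by (simp add: sum_subtractf S_def[symmetric] sum_divide_distrib[symmetric])
  ultimately have 1: "(\<Sum>k\<in>I. p k * v k) \<ge> - (1 / L) - pJ"
    using y_split y_bounds(2) by linarith
  have "(\<Sum>k\<in>J. p k * v k) \<ge> (\<Sum>k\<in>J. (b * L / 4 + 1) * p k - exp (D / 2) * (2 / b) / L)"
  proof (rule sum_mono)
    fix k assume "k \<in> J"
    then have k: "k < n" "k \<notin> I" unfolding J_def by auto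
    define \<tau> where "\<tau> = (\<beta> k - 1) * L - \<kappa> k"
    have "b * L \<le> (\<beta> k - 1) * L" using \<beta>J[OF k] L_ge(1) by (intro mult_right_mono) auto
    then have \<tau>: "b * L - D \<le> \<tau>" unfolding \<tau>_def using \<kappa>D[OF k(1)] by linarith
    have pk: "p k = exp (v k - \<tau>)" unfolding p_def \<tau>_def by (simp add: algebra_simps)
    have z: "- 1 \<le> z * exp z" for z :: real
    proof -
      have "z * exp z \<ge> exp z - 1" 
      proof -
        have "1 - z \<le> exp (- z)" using exp_ge_add_one_self[of "- z"] by simp
        then have "exp z * (1 - z) \<le> exp z * exp (- z)" by (intro mult_left_mono) auto
        then show ?thesis by (simp add: exp_minus algebra_simps)
      qed
      then show ?thesis using exp_gt_zero[of z] by linarith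
    qed
    \<comment> \<open>Half of \<open>\<tau>\<close> is kept as the coefficient of
      \<open>p k\<close>; the other half becomes the small factor in front of
      \<open>z * exp z\<close>, which is at least -1.\<close>
    have "p k * (v k - \<tau> / 2) = exp (- (\<tau> / 2)) * ((v k - \<tau> / 2) * exp (v k - \<tau> / 2))"
      unfolding pk by (simp add: exp_add[symmetric] mult.left_commute)
    also have "\<dots> \<ge> exp (- (\<tau> / 2)) * (- 1)"
      using z by (intro mult_left_mono) auto
    finally have 2: "p k * v k \<ge> \<tau> / 2 * p k - exp (- (\<tau> / 2))"
      by (simp add: algebra_simps)
    \<comment> \<open>The extra 1 compensates the loss \<open>- pJ\<close> incurred on
      \<open>I\<close>.\<close>
    have "b * L / 4 + 1 \<le> \<tau> / 2" using \<tau> L_ge(2) by (simp add: field_simps)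
    then have 3: "(b * L / 4 + 1) * p k \<le> \<tau> / 2 * p k" using p_pos[of k] by (intro mult_right_mono) auto
    have "exp (- (\<tau> / 2)) \<le> exp (D / 2 + - (b * L / 2))" using \<tau> by (simp add: field_simps)
    also have "\<dots> = exp (D / 2) * exp (- (b * L / 2))" by (rule exp_add)
    also have "exp (- (b * L / 2)) \<le> 1 / (b * L / 2)"
    proof -
      have "b * L / 2 \<le> exp (b * L / 2)" using exp_ge_add_one_self[of "b * L / 2"] by linarith
      then show ?thesis using b L_ge(1) by (simp add: exp_minus field_simps)
    qed
    finally have "exp (- (\<tau> / 2)) \<le> exp (D / 2) * (2 / b) / L" by (simp add: mult_left_mono)
    with 2 3 show "(b * L / 4 + 1) * p k - exp (D / 2) * (2 / b) / L \<le> p k * v k" by linarith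
  qed
  also have "(\<Sum>k\<in>J. (b * L / 4 + 1) * p k - exp (D / 2) * (2 / b) / L)
      = (b * L / 4 + 1) * pJ - real (card J) * (exp (D / 2) * (2 / b) / L)"
    by (simp add: sum_subtractf pJ_def sum_distrib_left)
  finally have 4: "(\<Sum>k\<in>J. p k * v k) \<ge> (b * L / 4 + 1) * pJ - real (card J) * (exp (D / 2) * (2 / b) / L)" .
  have "card J \<le> n" unfolding J_def using card_mono[of "{..<n}" "{..<n} - I"] by simp
  then have "real (card J) * (exp (D / 2) * (2 / b) / L) \<le> real n * (exp (D / 2) * (2 / b) / L)"
    using b L_ge(1) by (intro mult_right_mono) auto
  then have 5: "(\<Sum>k\<in>J. p k * v k) \<ge> (b * L / 4 + 1) * pJ - real n * (exp (D / 2) * (2 / b) / L)"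
    using 4 by linarith
  have "slack / L = 1 / L + real n * (exp (D / 2) * (2 / b) / L)"
    unfolding slack_def by (simp add: add_divide_distrib)
  then show ?thesis
    unfolding pv_def sum_IJ using 1 5 by (simp add: algebra_simps)
qed

text \<open>\<open>\<gamma> \<ge> 1 / 2\<close> secures half of \<open>Q + L * a\<close>. The factor
  of \<open>pv\<close> lies between \<open>L * S / 2\<close> and \<open>a + 2 * (L * S)\<close>, so
  \<open>pv_ge\<close> adds the term with \<open>L\<^sup>2 * pJ\<close> at bounded cost plus a
  multiple of \<open>a\<close>; half of \<open>L / 2 * a\<close> pays for all multiples of
  \<open>a\<close>.\<close>

lemma energy_ge:
  "Q / 2 + L / 4 * a + S * b / 8 * (L\<^sup>2 * pJ) - (Dn + 2 * S * slack)
    \<le> \<gamma> * (Q + L * a + dv) + (a + L * S - bd) * pv"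
proof -
  have nn: "0 \<le> Q + L * a" using Q L_ge(1) a_nonneg by simp
  have "1 / 2 * (Q + L * a) \<le> \<gamma> * (Q + L * a)" using \<gamma>_ge nn by (rule mult_right_mono)
  moreover have "\<gamma> * dv \<ge> - (Dn + Dn / Am * a)"
  proof -
    have "\<bar>\<gamma> * dv\<bar> \<le> \<beta>m * (real n * D * (1 + a / Am))"
      unfolding abs_mult using \<gamma>_ge \<gamma>_le abs_dv_le by (intro mult_mono) auto
    also have "\<dots> = Dn + Dn / Am * a" unfolding Dn_def by (simp add: algebra_simps)
    finally show ?thesis by linarith
  qed
  moreover have "(a + L * S - bd) * pv \<ge> S * b / 8 * (L\<^sup>2 * pJ) - a * slack - 2 * S * slack"
  proof -
    have f1: "L * S / 2 \<le> a + L * S - bd" and f2: "a + L * S - bd \<le> a + 2 * (L * S)"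
      using abs_bd_le a_nonneg L_ge(3) by (auto simp: mult.commute[of L])
    have LS: "0 \<le> L * S" using L_ge(1) S_pos by simp
    have "(a + L * S - bd) * pv \<ge> (a + L * S - bd) * (- (slack / L) + b * L / 4 * pJ)"
      using pv_ge f1 LS by (intro mult_left_mono) auto
    moreover have "(a + L * S - bd) * (slack / L) \<le> (a + 2 * (L * S)) * (slack / L)"
      using f2 slack_ge L_ge(1) by (intro mult_right_mono) auto
    moreover have "(a + 2 * (L * S)) * (slack / L) \<le> a * slack + 2 * S * slack"
    proof -
      have "slack / L \<le> slack" using slack_ge L_ge(1) by (simp add: field_simps mult_le_cancel_left1)
      then have "a * (slack / L) \<le> a * slack" using a_nonneg by (rule mult_left_mono)
      moreover have "2 * (L * S) * (slack / L) = 2 * S * slack" using L_ge(1) by simp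
      ultimately show ?thesis by (simp only: distrib_right)
    qed
    moreover have "(a + L * S - bd) * (b * L / 4 * pJ) \<ge> L * S / 2 * (b * L / 4 * pJ)"
      using f1 b L_ge(1) pJ_nonneg by (intro mult_right_mono) auto
    moreover have "L * S / 2 * (b * L / 4 * pJ) = S * b / 8 * (L\<^sup>2 * pJ)"
      by (simp add: power2_eq_square)
    ultimately show ?thesis unfolding distrib_left mult_minus_right by linarith
  qed
  moreover have "L / 4 * a \<ge> (Dn / Am + slack) * a"
  proof (rule mult_right_mono[OF _ a_nonneg])
    show "Dn / Am + slack \<le> L / 4" using L_ge(4) by (simp add: pos_le_divide_eq mult.commute)
  qed
  ultimately show ?thesis by (simp add: algebra_simps)
qed

lemma control_ge: "1 \<le> control" "Q \<le> control" "L * a \<le> control" "L\<^sup>2 * pJ \<le> control" "a \<le> control" "L * pJ \<le> control"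
proof -
  have 1: "0 \<le> L * a" "0 \<le> L\<^sup>2 * pJ" "a \<le> L * a" "L * pJ \<le> L\<^sup>2 * pJ"
    using L_ge(1) a_nonneg pJ_nonneg
    by (auto simp: mult_le_cancel_right1 power2_eq_square mult_right_mono)
  then show "1 \<le> control" "Q \<le> control" "L * a \<le> control" "L\<^sup>2 * pJ \<le> control" "a \<le> control" "L * pJ \<le> control"
    unfolding control_def using Q by linarith+
qed

lemma control_le_energy:
  defines "c \<equiv> min (1 / 4) (S * b / 8)"
  shows "c * control \<le> \<gamma> * (Q + L * a + dv) + (a + L * S - bd) * pv + (Dn + 2 * S * slack + 1)"
proof -
  have c: "c \<le> 1/4" "c \<le> S * b / 8" unfolding c_def by auto
  have "0 \<le> L * a" "0 \<le> L\<^sup>2 * pJ" using L_ge(1) a_nonneg pJ_nonneg by auto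
  then have "c * (L * a) \<le> 1 / 4 * (L * a)" "c * (L\<^sup>2 * pJ) \<le> S * b / 8 * (L\<^sup>2 * pJ)" "c * Q \<le> 1 / 4 * Q"
    using c Q by (intro mult_right_mono; simp)+
  then show ?thesis using energy_ge c Q unfolding control_def distrib_left by simp
qed

text \<open>The subtracted expression is the integrand of an identity with average 0. After
  replacing \<open>A k * v k\<close> by \<open>S * p k - A k - A k * r k\<close> the terms of order
  \<open>L\<close> cancel up to \<open>L * (\<gamma> - 1)\<close> and
  \<open>L * (A k * r k)\<close>, both within \<open>control\<close>.\<close>

lemma core_deviation:
  assumes k: "k \<in> I" and kv: "\<bar>kv\<bar> \<le> c5 * (1 + Q)" and c5: "0 \<le> c5"
  shows "\<bar>L * (A k * v k) - (\<gamma> * (kv - L * A k + d k) + (a + L * S - bd) * p k)\<bar>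
    \<le> (2 + A k * (\<beta>m + 1) + \<beta>m * (2 * c5 + D) + Dn) * control"
proof -
  have Av: "A k * v k = S * p k - A k - A k * r k"
    unfolding p_I[OF k] r_def by (simp add: algebra_simps)
  have pk: "0 \<le> p k" "p k \<le> 1"
  proof -
    have "p k \<le> (\<Sum>k<n. p k)" using k I p_pos by (intro member_le_sum) (auto simp: less_imp_le)
    then show "p k \<le> 1" using y_bounds by linarith
  qed (simp add: p_pos less_imp_le)
  have eq: "L * (A k * v k) - (\<gamma> * (kv - L * A k + d k) + (a + L * S - bd) * p k)
    = A k * (L * (\<gamma> - 1)) - L * (A k * r k) - \<gamma> * (kv + d k) - (a - bd) * p k"
    unfolding Av by (simp add: algebra_simps)
  have "\<bar>A k * (L * (\<gamma> - 1))\<bar> \<le> A k * ((\<beta>m + 1) * control)"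
  proof -
    have "\<beta>m * (L * pJ) + 1 \<le> \<beta>m * control + control"
      using control_ge \<beta>m(1) by (intro add_mono mult_left_mono) auto
    then have "\<bar>L * (\<gamma> - 1)\<bar> \<le> (\<beta>m + 1) * control" using \<gamma>_minus_1 by (simp add: algebra_simps)
    then show ?thesis using A_pos[OF k] by (simp add: abs_mult[of "A k"] mult_left_mono)
  qed
  moreover have "\<bar>L * (A k * r k)\<bar> \<le> control"
  proof -
    have "0 \<le> A k * r k" using A_pos[OF k] r_nonneg by simp
    moreover have "L * (A k * r k) \<le> L * a" using A_r_le[OF k] L_ge(1) by (intro mult_left_mono) auto
    ultimately have "0 \<le> L * (A k * r k)" "L * (A k * r k) \<le> control"
      using control_ge(3) L_ge(1) by (simp, linarith)
    then show ?thesis by (simp only: abs_of_nonneg)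
  qed
  moreover have "\<bar>\<gamma> * (kv + d k)\<bar> \<le> \<beta>m * ((2 * c5 + D) * control)"
  proof -
    have "c5 * (1 + Q) \<le> c5 * (2 * control)" using control_ge c5 by (intro mult_left_mono) auto
    moreover have "D * 1 \<le> D * control" using control_ge D by (intro mult_left_mono) auto
    ultimately have "\<bar>kv + d k\<bar> \<le> (2 * c5 + D) * control"
      using kv dD[OF k] by (simp add: algebra_simps)
    then show ?thesis unfolding abs_mult using \<gamma>_ge \<gamma>_le by (intro mult_mono) auto
  qed
  moreover have "\<bar>(a - bd) * p k\<bar> \<le> (1 + Dn) * control"
  proof -
    have "Dn * 1 \<le> Dn * control" using control_ge Dn_ge by (intro mult_left_mono) auto
    then have "\<bar>a - bd\<bar> \<le> (1 + Dn) * control"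
      using abs_bd_le a_nonneg control_ge(5) by (simp add: distrib_right)
    then have "\<bar>a - bd\<bar> * \<bar>p k\<bar> \<le> (1 + Dn) * control * 1" using pk by (intro mult_mono) auto
    then show ?thesis by (simp add: abs_mult)
  qed
  ultimately show ?thesis unfolding eq by (simp add: algebra_simps)
qed

text \<open>Here \<open>c\<close> stands for a direction \<open>B f\<close> and \<open>fv\<close>
  for the form \<open>f\<close> at \<open>v\<close>. Since \<open>c\<close> vanishes on
  \<open>I\<close>, only tail fractions enter the second term, and \<open>L\<^sup>2 * pJ\<close>
  pays for both powers of \<open>L\<close>.\<close>

lemma tail_deviation:
  assumes c: "\<And>k. k \<in> I \<Longrightarrow> c k = 0" "\<And>k. k < n \<Longrightarrow> \<bar>c k\<bar> \<le> c6" and F: "0 \<le> F" "0 \<le> c6"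
    and fv: "\<And>\<tau>. 2 * \<bar>\<tau> * fv\<bar> \<le> \<tau>\<^sup>2 * F + Q"
  shows "\<bar>L * fv - L * (\<gamma> * fv + (a + L * S - bd) * (\<Sum>k<n. c k * p k))\<bar>
    \<le> ((\<beta>m\<^sup>2 + 1) * F + 1 + c6 * (1 + S + Dn)) * control"
proof -
  \<comment> \<open>Taking \<open>\<tau> = L * (\<gamma> - 1)\<close> leaves the square of
    \<open>L * pJ\<close>, which is at most \<open>L\<^sup>2 * pJ\<close> since
    \<open>pJ \<le> 1\<close>.\<close>
  have "2 * \<bar>L * (\<gamma> - 1) * fv\<bar> \<le> (L * (\<gamma> - 1))\<^sup>2 * F + Q" by (rule fv)
  moreover have "(L * (\<gamma> - 1))\<^sup>2 \<le> 2 * (\<beta>m\<^sup>2 + 1) * control"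
  proof -
    have "(L * (\<gamma> - 1))\<^sup>2 \<le> (\<beta>m * (L * pJ) + 1)\<^sup>2"
      using \<gamma>_minus_1 by (rule abs_le_square_iff[THEN iffD1, OF order_trans]) simp
    also have "\<dots> \<le> 2 * (\<beta>m * (L * pJ))\<^sup>2 + 2"
      using sum_squares_bound[of "\<beta>m * (L * pJ)" 1] by (simp add: power2_sum)
    also have "(\<beta>m * (L * pJ))\<^sup>2 = \<beta>m\<^sup>2 * (L\<^sup>2 * pJ * pJ)" by (simp add: power2_eq_square)
    also have "\<dots> \<le> \<beta>m\<^sup>2 * (control * 1)"
      using control_ge(1,4) pJ_le pJ_nonneg L_ge(1) by (intro mult_left_mono mult_mono) auto
    finally show ?thesis using control_ge(1) by (simp add: algebra_simps)
  qed
  then have "(L * (\<gamma> - 1))\<^sup>2 * F \<le> 2 * (\<beta>m\<^sup>2 + 1) * control * F" using F(1) by (rule mult_right_mono)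
  moreover have "\<bar>L * ((a + L * S - bd) * (\<Sum>k<n. c k * p k))\<bar> \<le> c6 * (1 + S + Dn) * control"
  proof -
    have "(\<Sum>k<n. c k * p k) = (\<Sum>k\<in>J. c k * p k)" unfolding sum_IJ using c(1) by simp
    also have "\<bar>\<dots>\<bar> \<le> (\<Sum>k\<in>J. \<bar>c k * p k\<bar>)" by (rule sum_abs)
    also have "\<dots> \<le> (\<Sum>k\<in>J. c6 * p k)"
      unfolding abs_mult using c(2) p_pos F(2) unfolding J_def
      by (intro sum_mono mult_mono) (auto simp: less_imp_le abs_of_pos)
    also have "\<dots> = c6 * pJ" by (simp add: pJ_def sum_distrib_left)
    finally have s: "\<bar>\<Sum>k<n. c k * p k\<bar> \<le> c6 * pJ" .
    have nn: "\<bar>a + L * S - bd\<bar> \<le> a + L * S + Dn"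
    proof -
      have "0 \<le> L * S" using L_ge(1) S_pos by simp
      then show ?thesis using abs_bd_le a_nonneg by linarith
    qed
    have "\<bar>L * ((a + L * S - bd) * (\<Sum>k<n. c k * p k))\<bar> \<le> L * ((a + L * S + Dn) * (c6 * pJ))"
      unfolding abs_mult using nn s L_ge(1) by (intro mult_mono) auto
    also have "\<dots> = c6 * (L * a * pJ + S * (L\<^sup>2 * pJ) + Dn * (L * pJ))"
      by (simp add: power2_eq_square algebra_simps)
    also have "\<dots> \<le> c6 * (control * 1 + S * control + Dn * control)"
      using F control_ge pJ_le pJ_nonneg L_ge(1) a_nonneg S_pos Dn_ge
      by (intro mult_left_mono add_mono mult_mono) auto
    finally show ?thesis by (simp add: algebra_simps)
  qed
  moreover have "L * fv - L * (\<gamma> * fv + (a + L * S - bd) * (\<Sum>k<n. c k * p k))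
      = - (L * (\<gamma> - 1) * fv) - L * ((a + L * S - bd) * (\<Sum>k<n. c k * p k))"
    by (simp add: algebra_simps)
  moreover have "((\<beta>m\<^sup>2 + 1) * F + 1 + c6 * (1 + S + Dn)) * control
      = 2 * (\<beta>m\<^sup>2 + 1) * control * F / 2 + control + c6 * (1 + S + Dn) * control"
    by (simp add: algebra_simps)
  ultimately show ?thesis using control_ge(1,2) by linarith
qed

end


section \<open>Conditional means of the log-prices\<close>

text \<open>Under the tilt \<open>s\<close> the mean of \<open>X\<close> moves by
  \<open>s * t\<close> times column \<open>i\<close> of \<open>B\<close>; the correction
  \<open>d0 + s * d1\<close>, supported on \<open>I\<close>, compensates this there
  (\<open>\<kappa>_I\<close>), so the predicted fractions on \<open>I\<close> are the optimal
  weights \<open>A k / S\<close> for every \<open>s\<close>. The vector \<open>f j\<close> is the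
  residual of the regression of asset \<open>j\<close> on the assets in \<open>I\<close>: by
  \<open>f_B\<close> it is uncorrelated with them.\<close>

locale basket = gaussian_vector n t R B K \<mu> + tail_parameters n I A \<beta> S D b \<beta>m Am
  for n t R B K \<mu> I A \<beta> S D b \<beta>m Am +
  fixes i :: nat and d0 d1 :: "nat \<Rightarrow> real" and f :: "nat \<Rightarrow> nat \<Rightarrow> real"
  assumes i: "i < n"
    and B_sym: "sym_mat n B" and K_sym: "sym_mat n K"
    and K_psd: "\<And>v. 0 \<le> quad_form n K v"
    and A_off: "\<And>k. k < n \<Longrightarrow> k \<notin> I \<Longrightarrow> A k = 0"
    and \<beta>_def: "\<And>k. k < n \<Longrightarrow> \<beta> k = (\<Sum>l<n. B k l * A l)"
    and d_off: "\<And>k. k < n \<Longrightarrow> k \<notin> I \<Longrightarrow> d0 k = 0 \<and> d1 k = 0"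
    and d_bound: "\<And>s k. 0 \<le> s \<Longrightarrow> s \<le> 1 \<Longrightarrow> k \<in> I \<Longrightarrow> \<bar>d0 k + s * d1 k\<bar> \<le> D"
    and \<kappa>_I: "\<And>s k. k \<in> I \<Longrightarrow> \<mu> k + s * t * B k i + (\<Sum>l<n. B k l * (d0 l + s * d1 l)) = ln (A k / S)"
    and \<kappa>_bound: "\<And>s k. 0 \<le> s \<Longrightarrow> s \<le> 1 \<Longrightarrow> k < n \<Longrightarrow>
        \<bar>\<mu> k + s * t * B k i + (\<Sum>l<n. B k l * (d0 l + s * d1 l))\<bar> \<le> D"
    and f_diag: "\<And>j. j < n \<Longrightarrow> j \<notin> I \<Longrightarrow> f j j = 1"
    and f_off: "\<And>j k. j < n \<Longrightarrow> j \<notin> I \<Longrightarrow> k < n \<Longrightarrow> k \<notin> I \<Longrightarrow> k \<noteq> j \<Longrightarrow> f j k = 0"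
    and f_B: "\<And>j k. j < n \<Longrightarrow> j \<notin> I \<Longrightarrow> k \<in> I \<Longrightarrow> (\<Sum>l<n. B k l * f j l) = 0"
begin

definition d :: "real \<Rightarrow> nat \<Rightarrow> real" where "d s k = d0 k + s * d1 k"
definition \<kappa> :: "real \<Rightarrow> nat \<Rightarrow> real" where
  "\<kappa> s k = \<mu> k + s * t * B k i + (\<Sum>l<n. B k l * d s l)"
definition control_const :: real where
  "control_const = (t * real n * \<beta>m + (Dn + 2 * S * slack + 1)) / min (1 / 4) (S * b / 8)"

definition K_max :: real where "K_max = 1 + (\<Sum>k<n. \<bar>K k k\<bar>)"

definition core_const :: "nat \<Rightarrow> real" where
  "core_const k = (2 + A k * (\<beta>m + 1) + \<beta>m * (2 * K_max + D) + Dn) * control_const / A k"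

definition Bf :: "nat \<Rightarrow> nat \<Rightarrow> real" where "Bf j k = (\<Sum>l<n. B k l * f j l)"
definition Bf_max :: "nat \<Rightarrow> real" where "Bf_max j = (\<Sum>k<n. \<bar>Bf j k\<bar>)"

definition tail_const :: "nat \<Rightarrow> real" where
  "tail_const j = ((\<beta>m\<^sup>2 + 1) * quad_form n K (Bf j) + 1 + Bf_max j * (1 + S + Dn)) * control_const
      + (\<Sum>k\<in>I. \<bar>f j k\<bar> * core_const k)"

definition conv_const :: real where
  "conv_const = (if i \<in> I then \<bar>core_const i\<bar> else \<bar>tail_const i\<bar>)"

text \<open>Predicted value of \<open>X k\<close> given \<open>Y = exp (- L)\<close> under the tilt
  \<open>s\<close>: the tilted mean plus \<open>B (d s - L A)\<close>.\<close>

definition m :: "real \<Rightarrow> real \<Rightarrow> nat \<Rightarrow> real" where "m s L k = \<kappa> s k - \<beta> k * L"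

lemma KB_sum: "k < n \<Longrightarrow> (\<Sum>l<n. K k l * (\<Sum>j<n. B l j * u j)) = u k"
proof -
  assume k: "k < n"
  have "(\<Sum>l<n. K k l * (\<Sum>j<n. B l j * u j)) = (\<Sum>l<n. \<Sum>j<n. K k l * B l j * u j)"
    by (simp add: sum_distrib_left mult.assoc)
  also have "\<dots> = (\<Sum>j<n. (\<Sum>l<n. K k l * B l j) * u j)"
    by (subst sum.swap) (simp add: sum_distrib_right)
  also have "\<dots> = (\<Sum>j<n. if k = j then u j else 0)"
    using k by (intro sum.cong refl) (simp add: KB)
  finally show ?thesis using k by simp
qed

lemma BK_bilinear: "(\<Sum>k<n. \<Sum>j<n. (\<Sum>l<n. B k l * u l) * K k j * v j) = (\<Sum>j<n. u j * v j)"
proof -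
  have "(\<Sum>k<n. \<Sum>j<n. (\<Sum>l<n. B k l * u l) * K k j * v j)
      = (\<Sum>j<n. \<Sum>k<n. (\<Sum>l<n. B k l * u l) * K k j * v j)"
    by (rule sum.swap)
  also have "\<dots> = (\<Sum>j<n. (\<Sum>k<n. K j k * (\<Sum>l<n. B k l * u l)) * v j)"
  proof (rule sum.cong[OF refl])
    fix j assume "j \<in> {..<n}"
    then have "(\<Sum>k<n. (\<Sum>l<n. B k l * u l) * K k j * v j) = (\<Sum>k<n. (K j k * (\<Sum>l<n. B k l * u l)) * v j)"
      using K_sym unfolding sym_mat_def by (intro sum.cong refl) (simp add: mult.commute)
    then show "(\<Sum>k<n. (\<Sum>l<n. B k l * u l) * K k j * v j) = (\<Sum>k<n. K j k * (\<Sum>l<n. B k l * u l)) * v j"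
      by (simp only: sum_distrib_right)
  qed
  also have "\<dots> = (\<Sum>j<n. u j * v j)"
    by (intro sum.cong refl) (simp add: KB_sum)
  finally show ?thesis .
qed

end

locale basket_point = basket +
  fixes s L C :: real and g g' :: "real \<Rightarrow> real"
  assumes s: "0 \<le> s" "s \<le> 1" and L: "Lmin \<le> L"
    and g: "\<And>y. (g has_real_derivative g' y) (at y)" "g' \<in> borel_measurable borel"
    and g_bd: "\<And>y. \<bar>g y\<bar> \<le> C" "\<And>y. \<bar>g' y\<bar> \<le> C"
    and g_nonneg: "\<And>y. 0 \<le> g y"
    and g_supp: "\<And>y. g y \<noteq> 0 \<Longrightarrow> (1 - 1 / L) * exp (- L) \<le> y \<and> y \<le> exp (- L)"
begin

definition \<rho> :: "(nat \<Rightarrow> real) \<Rightarrow> real" where "\<rho> w = exp (s * X i w) * g (Y w)"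
text \<open>Unnormalised, so every estimate carries the total mass
  \<open>avg (\<lambda>_. 1)\<close> as a factor.\<close>

definition avg :: "((nat \<Rightarrow> real) \<Rightarrow> real) \<Rightarrow> real" where "avg h = (\<integral>w. h w * \<rho> w \<partial>P)"
definition v :: "(nat \<Rightarrow> real) \<Rightarrow> nat \<Rightarrow> real" where "v w k = X k w - m s L k"
definition p :: "(nat \<Rightarrow> real) \<Rightarrow> nat \<Rightarrow> real" where "p w k = exp (X k w) * exp L"
definition Q :: "(nat \<Rightarrow> real) \<Rightarrow> real" where "Q w = quad_form n K (v w)"
definition Kv :: "(nat \<Rightarrow> real) \<Rightarrow> nat \<Rightarrow> real" where "Kv w k = (\<Sum>l<n. K k l * v w l)"
definition a :: "(nat \<Rightarrow> real) \<Rightarrow> real" where "a w = - (\<Sum>k\<in>I. A k * v w k)"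
definition \<gamma> :: "(nat \<Rightarrow> real) \<Rightarrow> real" where "\<gamma> w = (\<Sum>k<n. \<beta> k * p w k)"
definition pJ :: "(nat \<Rightarrow> real) \<Rightarrow> real" where "pJ w = (\<Sum>k\<in>J. p w k)"
definition bd :: real where "bd = (\<Sum>k<n. \<beta> k * d s k)"
definition control :: "(nat \<Rightarrow> real) \<Rightarrow> real" where "control w = 1 + Q w + L * a w + L\<^sup>2 * pJ w"
definition energy :: "(nat \<Rightarrow> real) \<Rightarrow> real" where
  "energy w = \<gamma> w * (Q w + L * a w + (\<Sum>k<n. d s k * v w k))
        + (a w + L * S - bd) * (\<Sum>k<n. p w k * v w k)"

section \<open>Weighted averages over the window of \<open>Y\<close>\<close>

lemma tame_gY: "tame (\<lambda>w. g (Y w))"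
  using has_grad_comp_Y[OF g g_bd] unfolding has_grad_def by auto

lemma tame_\<rho>: "tame \<rho>"
  unfolding \<rho>_def using i by (intro tame_intros tame_gY)

lemma tame_v: "k < n \<Longrightarrow> tame (\<lambda>w. v w k)"
  unfolding v_def by (intro tame_intros)

lemma tame_p: "k < n \<Longrightarrow> tame (\<lambda>w. p w k)"
  unfolding p_def by (intro tame_intros)

lemma tame_Q: "tame Q"
  unfolding Q_def quad_form_def by (intro tame_intros tame_v) auto

lemma tame_Kv: "k < n \<Longrightarrow> tame (\<lambda>w. Kv w k)"
  unfolding Kv_def by (intro tame_intros tame_v) auto

lemma tame_a: "tame a"
  unfolding a_def using I by (intro tame_intros tame_v) auto

lemma tame_\<gamma>: "tame \<gamma>"
  unfolding \<gamma>_def by (intro tame_intros tame_p) auto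

lemma tame_pJ: "tame pJ"
  unfolding pJ_def by (intro tame_intros tame_p) (auto simp: J_def)

lemma tame_control: "tame control"
  unfolding control_def by (intro tame_intros tame_Q tame_a tame_pJ)

lemma tame_energy: "tame energy"
  unfolding energy_def by (intro tame_intros tame_Q tame_a tame_\<gamma> tame_v tame_p) auto

lemmas tame_all = tame_intros tame_\<rho> tame_v tame_p tame_Q tame_Kv tame_a tame_\<gamma> tame_pJ tame_control tame_energy

lemma avg_integrable: "tame h \<Longrightarrow> integrable P (\<lambda>w. h w * \<rho> w)"
  by (intro integrable_tame tame_mult tame_\<rho>)

lemma \<rho>_nonneg: "0 \<le> \<rho> w" unfolding \<rho>_def using g_nonneg by simp

lemma avg_add: "tame h \<Longrightarrow> tame k \<Longrightarrow> avg (\<lambda>w. h w + k w) = avg h + avg k"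
  unfolding avg_def by (simp add: distrib_right avg_integrable)

lemma avg_diff: "tame h \<Longrightarrow> tame k \<Longrightarrow> avg (\<lambda>w. h w - k w) = avg h - avg k"
  unfolding avg_def by (simp add: left_diff_distrib avg_integrable)

lemma avg_cmult: "avg (\<lambda>w. c * h w) = c * avg h"
  unfolding avg_def by (simp add: mult.assoc)

lemma avg_sum: "(\<And>k. k \<in> M \<Longrightarrow> tame (h k)) \<Longrightarrow> avg (\<lambda>w. \<Sum>k\<in>M. h k w) = (\<Sum>k\<in>M. avg (h k))"
  unfolding avg_def sum_distrib_right
  by (rule Bochner_Integration.integral_sum) (rule avg_integrable)

lemma avg_mono:
  assumes "tame h" "tame k" "\<And>w. g (Y w) \<noteq> 0 \<Longrightarrow> h w \<le> k w"
  shows "avg h \<le> avg k"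
  unfolding avg_def
proof (rule integral_mono)
  fix w show "h w * \<rho> w \<le> k w * \<rho> w"
  proof (cases "g (Y w) = 0")
    case True then show ?thesis by (simp add: \<rho>_def)
  next
    case False then show ?thesis using assms(3) \<rho>_nonneg by (intro mult_right_mono) auto
  qed
qed (use assms avg_integrable in auto)

lemma avg_abs_le:
  assumes "tame h" "tame k" "\<And>w. g (Y w) \<noteq> 0 \<Longrightarrow> \<bar>h w\<bar> \<le> k w"
  shows "\<bar>avg h\<bar> \<le> avg k"
proof -
  have "avg h \<le> avg k" using assms by (intro avg_mono) (auto simp: abs_le_iff)
  moreover have "- avg h \<le> avg k"
    using avg_mono[of "\<lambda>w. (-1) * h w" k] avg_cmult[of "-1" h] assms
    by (auto simp: abs_le_iff intro: tame_uminus)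
  ultimately show ?thesis by (simp add: abs_le_iff)
qed

lemma p_eq: "k < n \<Longrightarrow> exp (v w k + \<kappa> s k - (\<beta> k - 1) * L) = p w k"
  unfolding v_def m_def p_def by (simp add: exp_add[symmetric] algebra_simps)

lemma sum_p: "(\<Sum>k<n. p w k) = Y w * exp L"
  unfolding p_def Y_def by (simp add: sum_distrib_right)

text \<open>Multiplied by \<open>exp L\<close>, the support condition on \<open>g\<close> becomes
  the two bounds on the sum of the fractions, so the deterministic estimates apply wherever the
  weight is nonzero.\<close>

lemma tail_point:
  assumes "g (Y w) \<noteq> 0"
  shows "tail_point n I A \<beta> S D b \<beta>m Am L (v w) (\<kappa> s) (d s) (Q w)"
proof unfold_locales
  have e: "(\<Sum>k<n. exp (v w k + \<kappa> s k - (\<beta> k - 1) * L)) = Y w * exp L"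
    by (simp add: p_eq sum_p)
  have y: "(1 - 1 / L) * exp (- L) * exp L \<le> Y w * exp L" "Y w * exp L \<le> exp (- L) * exp L"
    using g_supp[OF assms] by (auto intro: mult_right_mono)
  show "(\<Sum>k<n. exp (v w k + \<kappa> s k - (\<beta> k - 1) * L)) \<le> 1"
    "1 - 1 / L \<le> (\<Sum>k<n. exp (v w k + \<kappa> s k - (\<beta> k - 1) * L))"
    unfolding e using y by (simp_all add: mult.assoc exp_add[symmetric])
qed (use s L K_psd d_off d_bound \<kappa>_I \<kappa>_bound in \<open>auto simp: \<kappa>_def d_def Q_def\<close>)

text \<open>By the choice of prediction, \<open>X - \<mu>\<close> is \<open>v\<close> plus
  \<open>B\<close> applied to \<open>s * t\<close> times the \<open>i\<close>-th unit vector
  \<open>+ d s - L A\<close>. \<open>K\<close> undoes \<open>B\<close>, and the tilt cancels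
  exactly.\<close>

lemma Zs_eq:
  assumes k: "k < n"
  shows "Z k w - (if k = i then s else 0) = (Kv w k - L * A k + d s k) / t"
proof -
  have "X l w - \<mu> l = v w l - L * (\<Sum>j<n. B l j * A j) + (s * t) * (\<Sum>j<n. B l j * (if j = i then 1 else 0))
      + (\<Sum>j<n. B l j * d s j)" if "l < n" for l
    using i that unfolding v_def m_def \<kappa>_def
    by (simp add: \<beta>_def if_distrib[of "(*) _"] mult_ac cong: if_cong)
  then have "(\<Sum>l<n. K k l * (X l w - \<mu> l)) = (\<Sum>l<n. K k l * (v w l - L * (\<Sum>j<n. B l j * A j)
      + (s * t) * (\<Sum>j<n. B l j * (if j = i then 1 else 0)) + (\<Sum>j<n. B l j * d s j)))"
    by (intro sum.cong refl) auto
  also have "\<dots> = Kv w k - L * (\<Sum>l<n. K k l * (\<Sum>j<n. B l j * A j))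
      + (s * t) * (\<Sum>l<n. K k l * (\<Sum>j<n. B l j * (if j = i then 1 else 0)))
      + (\<Sum>l<n. K k l * (\<Sum>j<n. B l j * d s j))"
  proof -
    have "(\<Sum>l<n. K k l * (x l - L * y l + (s * t) * z l + u l))
      = (\<Sum>l<n. K k l * x l) - L * (\<Sum>l<n. K k l * y l) + (s * t) * (\<Sum>l<n. K k l * z l) + (\<Sum>l<n. K k l * u l)"
      for x y z u :: "nat \<Rightarrow> real"
      by (simp add: algebra_simps sum.distrib sum_subtractf sum_distrib_left)
    then show ?thesis unfolding Kv_def .
  qed
  also have "\<dots> = Kv w k - L * A k + s * t * (if k = i then 1 else 0) + d s k"
    unfolding KB_sum[OF k] ..
  finally show ?thesis unfolding Z_def using t_pos by (auto simp: field_simps)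
qed

lemma \<beta>_inner:
  assumes "\<And>k. k < n \<Longrightarrow> k \<notin> I \<Longrightarrow> u k = 0"
  shows "(\<Sum>k<n. \<beta> k * u k) = (\<Sum>k\<in>I. u k)"
  unfolding sum_IJ using assms \<beta>I by (simp add: J_def)

text \<open>As \<open>\<beta> = B A\<close>, pairing with \<open>K v\<close> gives the pairing of
  \<open>A\<close> with \<open>v\<close>, that is \<open>- a\<close>; and \<open>\<beta>\<close>
  paired with \<open>A\<close> is \<open>S\<close> because \<open>\<beta>\<close> is 1 on
  \<open>I\<close>.\<close>

lemma \<beta>_Zs: "(\<Sum>k<n. \<beta> k * (Z k w - (if k = i then s else 0))) = - (a w + L * S - bd) / t"
proof -
  have "(\<Sum>k<n. \<beta> k * Kv w k) = (\<Sum>k<n. \<Sum>j<n. (\<Sum>l<n. B k l * A l) * K k j * v w j)"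
    unfolding Kv_def by (intro sum.cong refl) (simp add: \<beta>_def sum_distrib_left mult.assoc)
  also have "\<dots> = (\<Sum>j<n. A j * v w j)" by (rule BK_bilinear)
  also have "\<dots> = - a w" unfolding a_def sum_IJ using A_off by (simp add: J_def)
  finally have 1: "(\<Sum>k<n. \<beta> k * Kv w k) = - a w" .
  have 2: "(\<Sum>k<n. \<beta> k * A k) = S" using \<beta>_inner[of A] A_off S_def by simp
  have "(\<Sum>k<n. \<beta> k * (Z k w - (if k = i then s else 0))) = (\<Sum>k<n. \<beta> k * Kv w k - L * (\<beta> k * A k) + \<beta> k * d s k) / t"
    unfolding sum_divide_distrib by (intro sum.cong refl) (simp add: Zs_eq algebra_simps add_divide_distrib diff_divide_distrib)
  also have "\<dots> = (- a w - L * S + bd) / t"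
    by (simp add: sum.distrib sum_subtractf sum_distrib_left[symmetric] 1 2 bd_def)
  finally show ?thesis by (simp add: algebra_simps minus_divide_left)
qed

text \<open>Tangential integration by parts with second direction \<open>\<beta>\<close>, multiplied
  by \<open>t * exp L\<close> to pass from prices to fractions. For constant \<open>q\<close> the
  right-hand side vanishes.\<close>

lemma identity:
  assumes q: "has_grad q G"
  shows "avg (\<lambda>w. ((\<Sum>k<n. c k * (Kv w k - L * A k + d s k)) * \<gamma> w
        + (a w + L * S - bd) * (\<Sum>k<n. c k * p w k)) * q w)
    = t * avg (\<lambda>w. \<gamma> w * (\<Sum>k<n. c k * G k w) - (\<Sum>k<n. c k * p w k) * (\<Sum>k<n. \<beta> k * G k w))"
proof -
  have pe: "(\<Sum>k<n. u k * p w k) = (\<Sum>k<n. u k * exp (X k w)) * exp L" for u w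
    by (simp add: p_def sum_distrib_right mult.assoc)
  have cZ: "(\<Sum>k<n. c k * (Z k w - (if k = i then s else 0))) = (\<Sum>k<n. c k * (Kv w k - L * A k + d s k)) / t" for w
    unfolding sum_divide_distrib by (intro sum.cong refl) (simp add: Zs_eq)
  have "avg (\<lambda>w. ((\<Sum>k<n. c k * (Kv w k - L * A k + d s k)) * \<gamma> w
        + (a w + L * S - bd) * (\<Sum>k<n. c k * p w k)) * q w)
     = (t * exp L) * (\<integral>w. ((\<Sum>k<n. c k * (Z k w - (if k = i then s else 0))) * (\<Sum>l<n. \<beta> l * exp (X l w))
              - (\<Sum>l<n. \<beta> l * (Z l w - (if l = i then s else 0))) * (\<Sum>m<n. c m * exp (X m w))) * q w
              * (exp (s * X i w) * g (Y w)) \<partial>P)"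
    unfolding avg_def integral_mult_right_zero[symmetric] cZ \<beta>_Zs \<gamma>_def pe \<rho>_def
    using t_pos by (intro Bochner_Integration.integral_cong refl) (simp add: field_simps)
  also have "\<dots> = (t * exp L) * (\<integral>w. ((\<Sum>l<n. \<beta> l * exp (X l w)) * (\<Sum>m<n. c m * G m w)
              - (\<Sum>m<n. c m * exp (X m w)) * (\<Sum>l<n. \<beta> l * G l w))
              * (exp (s * X i w) * g (Y w)) \<partial>P)"
    unfolding tilted_tangential_integration_by_parts[OF q i g g_bd] ..
  also have "\<dots> = t * avg (\<lambda>w. \<gamma> w * (\<Sum>k<n. c k * G k w) - (\<Sum>k<n. c k * p w k) * (\<Sum>k<n. \<beta> k * G k w))"
    unfolding avg_def integral_mult_right_zero[symmetric] \<gamma>_def pe \<rho>_def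
    by (intro Bochner_Integration.integral_cong refl) (simp add: algebra_simps)
  finally show ?thesis .
qed

lemma delta_sum: "k < n \<Longrightarrow> (\<Sum>j<n. (if j = k then 1 else 0) * u j) = u k" for u :: "nat \<Rightarrow> real"
  by (simp add: if_distrib[of "\<lambda>x. x * _"] cong: if_cong)

lemma delta_sum': "k < n \<Longrightarrow> (\<Sum>j<n. u j * (if j = k then 1 else 0)) = u k" for u :: "nat \<Rightarrow> real"
  by (simp add: if_distrib[of "(*) _"] cong: if_cong)

lemma has_grad_v: "k < n \<Longrightarrow> has_grad (\<lambda>w. v w k) (\<lambda>l w. if l = k then 1 else 0)"
  using has_grad_add[OF has_grad_X[of k] has_grad_const[of "- m s L k"]] unfolding v_def by simp

text \<open>Direction \<open>k\<close> is tested with \<open>v k\<close> and the results are summed: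
  the left-hand sides assemble the quadratic form and the entropy. The right-hand sides
  \<open>\<gamma> - p k * \<beta> k\<close> sum to \<open>(n - 1) * \<gamma>\<close>, since the
  subtracted terms again add up to \<open>\<gamma>\<close>.\<close>

lemma energy_identity: "avg energy = t * (real n - 1) * avg \<gamma>"
proof -
  define T where "T k w = ((Kv w k - L * A k + d s k) * \<gamma> w + (a w + L * S - bd) * p w k) * v w k" for k w
  have T: "avg (T k) = t * avg (\<lambda>w. \<gamma> w - p w k * \<beta> k)" if k: "k < n" for k
    using identity[OF has_grad_v[OF k], of "\<lambda>j. if j = k then 1 else 0"]
    unfolding delta_sum[OF k] delta_sum'[OF k] T_def[symmetric] by simp
  have tT: "tame (T k)" if "k < n" for k
    unfolding T_def using that by (intro tame_all) auto
  have "energy = (\<lambda>w. \<Sum>k<n. T k w)"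
  proof
    fix w
    have "Q w = (\<Sum>k<n. Kv w k * v w k)"
      unfolding Q_def quad_form_def Kv_def sum_distrib_right
      by (intro sum.cong refl) (simp add: mult_ac)
    moreover have "a w = - (\<Sum>k<n. A k * v w k)"
      unfolding a_def sum_IJ using A_off by (simp add: J_def)
    ultimately show "energy w = (\<Sum>k<n. T k w)"
      unfolding energy_def T_def
      by (simp add: sum.distrib sum_subtractf sum_distrib_left algebra_simps)
  qed
  then have "avg energy = (\<Sum>k<n. t * avg (\<lambda>w. \<gamma> w - p w k * \<beta> k))"
    using avg_sum[of "{..<n}" T] tT T by simp
  also have "\<dots> = t * avg (\<lambda>w. \<Sum>k<n. \<gamma> w - p w k * \<beta> k)"
    by (subst avg_sum) (auto intro!: tame_all simp: sum_distrib_left)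
  also have "(\<lambda>w. \<Sum>k<n. \<gamma> w - p w k * \<beta> k) = (\<lambda>w. (real n - 1) * \<gamma> w)"
    by (simp add: sum_subtractf fun_eq_iff \<gamma>_def algebra_simps)
  finally show ?thesis by (simp add: avg_cmult)
qed

lemma tail_point_eqs:
  assumes "g (Y w) \<noteq> 0"
  shows "tail_point.a I A (v w) = a w" "tail_point.\<gamma> n \<beta> L (v w) (\<kappa> s) = \<gamma> w"
    "tail_point.pJ n I \<beta> L (v w) (\<kappa> s) = pJ w" "tail_point.control n I A \<beta> L (v w) (\<kappa> s) (Q w) = control w"
    "tail_point.dv n (v w) (d s) = (\<Sum>k<n. d s k * v w k)" "tail_point.bd n \<beta> (d s) = bd"
    "tail_point.pv n \<beta> L (v w) (\<kappa> s) = (\<Sum>k<n. p w k * v w k)"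
    "\<And>k. k < n \<Longrightarrow> tail_point.p \<beta> L (v w) (\<kappa> s) k = p w k"
proof -
  interpret tp: tail_point n I A \<beta> S D b \<beta>m Am L "v w" "\<kappa> s" "d s" "Q w"
    by (rule tail_point[OF assms])
  show 1: "tp.p k = p w k" if "k < n" for k
    unfolding tp.p_def by (rule p_eq[OF that])
  show 2: "tp.a = a w" unfolding tp.a_def a_def ..
  show "tp.\<gamma> = \<gamma> w" unfolding tp.\<gamma>_def \<gamma>_def by (simp add: 1)
  show 3: "tp.pJ = pJ w" unfolding tp.pJ_def pJ_def by (intro sum.cong refl 1) (auto simp: J_def)
  show "tp.control = control w" unfolding tp.control_def control_def 2 3 ..
  show "tp.dv = (\<Sum>k<n. d s k * v w k)" by (rule tp.dv_def)
  show "tp.bd = bd" unfolding tp.bd_def bd_def ..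
  show "tp.pv = (\<Sum>k<n. p w k * v w k)" unfolding tp.pv_def by (simp add: 1)
qed


lemma avg_1_nonneg: "0 \<le> avg (\<lambda>_. 1)"
  unfolding avg_def by (intro integral_nonneg_AE AE_I2) (simp add: \<rho>_nonneg)

text \<open>The energy dominates \<open>control\<close> pointwise up to a constant, while its
  average is of order one because \<open>\<gamma> \<le> \<beta>m\<close>.\<close>

lemma avg_control_le: "avg control \<le> control_const * avg (\<lambda>_. 1)"
proof -
  define c where "c = min (1 / 4) (S * b / 8)"
  have c: "0 < c" unfolding c_def using S_pos b by simp
  have "avg (\<lambda>w. c * control w) \<le> avg (\<lambda>w. energy w + (Dn + 2 * S * slack + 1) * 1)"
  proof (rule avg_mono)
    fix w assume w: "g (Y w) \<noteq> 0"
    show "c * control w \<le> energy w + (Dn + 2 * S * slack + 1) * 1"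
      using tail_point.control_le_energy[OF tail_point[OF w]]
      unfolding tail_point_eqs[OF w] c_def energy_def by simp
  qed (intro tame_all)+
  also have "\<dots> = avg energy + (Dn + 2 * S * slack + 1) * avg (\<lambda>_. 1)"
    by (subst avg_add, intro tame_all, intro tame_all, subst avg_cmult, simp)
  also have "avg energy \<le> t * real n * \<beta>m * avg (\<lambda>_. 1)"
  proof -
    have "avg \<gamma> \<le> avg (\<lambda>w. \<beta>m * 1)"
    proof (rule avg_mono)
      fix w assume w: "g (Y w) \<noteq> 0"
      show "\<gamma> w \<le> \<beta>m * 1"
        using tail_point.\<gamma>_le[OF tail_point[OF w]] unfolding tail_point_eqs[OF w] by simp
    qed (intro tame_all)+
    then have 1: "avg \<gamma> \<le> \<beta>m * avg (\<lambda>_. 1)" by (simp only: avg_cmult)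
    have "t * (real n - 1) * avg \<gamma> \<le> t * (real n - 1) * (\<beta>m * avg (\<lambda>_. 1))"
      using t_pos i 1 by (intro mult_left_mono mult_nonneg_nonneg) auto
    also have "\<dots> \<le> t * real n * (\<beta>m * avg (\<lambda>_. 1))"
      using t_pos \<beta>m avg_1_nonneg by (intro mult_right_mono mult_left_mono mult_nonneg_nonneg) auto
    finally show ?thesis unfolding energy_identity by (simp add: mult.assoc)
  qed
  finally have "c * avg control \<le> (t * real n * \<beta>m + (Dn + 2 * S * slack + 1)) * avg (\<lambda>_. 1)"
    unfolding avg_cmult by (simp add: distrib_right)
  then show ?thesis unfolding control_const_def c_def[symmetric] using c by (simp add: field_simps)
qed

lemma avg_deviation:
  assumes tame: "tame h" "tame q" and h: "\<And>w. g (Y w) \<noteq> 0 \<Longrightarrow> \<bar>L * h w - q w\<bar> \<le> M * control w"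
    and q: "avg q = 0" and M: "0 \<le> M"
  shows "\<bar>L * avg h\<bar> \<le> M * control_const * avg (\<lambda>_. 1)"
proof -
  have "\<bar>avg (\<lambda>w. L * h w - q w)\<bar> \<le> avg (\<lambda>w. M * control w)"
    using h tame by (intro avg_abs_le tame_intros tame_control) auto
  moreover have "avg (\<lambda>w. L * h w - q w) = L * avg h"
    using tame q by (subst avg_diff) (auto intro!: tame_intros simp: avg_cmult)
  moreover have "avg (\<lambda>w. M * control w) \<le> M * (control_const * avg (\<lambda>_. 1))"
    unfolding avg_cmult using avg_control_le M by (rule mult_left_mono)
  ultimately show ?thesis by (simp add: mult.assoc)
qed

lemma K_max_nonneg: "0 \<le> K_max" unfolding K_max_def by (simp add: sum_nonneg add_nonneg_nonneg)

lemma Kv_bound: "k < n \<Longrightarrow> \<bar>Kv w k\<bar> \<le> K_max * (1 + Q w)"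
proof -
  assume k: "k < n"
  have "2 * \<bar>\<Sum>i<n. \<Sum>j<n. (if i = k then 1 else 0) * K i j * v w j\<bar>
      \<le> quad_form n K (\<lambda>i. if i = k then 1 else 0) + quad_form n K (v w)"
    by (rule quad_form_mixed_le[OF K_sym K_psd])
  moreover have "(\<Sum>i<n. \<Sum>j<n. (if i = k then 1 else 0) * K i j * v w j) = Kv w k"
    unfolding Kv_def using delta_sum[OF k, of "\<lambda>i. \<Sum>j<n. K i j * v w j"]
    by (simp add: sum_distrib_left mult.assoc)
  moreover have "quad_form n K (\<lambda>i. if i = k then 1 else 0) = K k k"
    unfolding quad_form_def delta_sum'[OF k] by (rule delta_sum[OF k])
  moreover have "K k k \<le> K_max"
  proof -
    have "\<bar>K k k\<bar> \<le> (\<Sum>k<n. \<bar>K k k\<bar>)" using k by (intro member_le_sum) auto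
    then show ?thesis unfolding K_max_def by linarith
  qed
  moreover have Q: "0 \<le> Q w" unfolding Q_def by (rule K_psd)
  moreover have "1 * Q w \<le> K_max * Q w"
    using Q unfolding K_max_def by (intro mult_right_mono) (auto simp: sum_nonneg)
  moreover have "K_max \<ge> 0" by (rule K_max_nonneg)
  ultimately show ?thesis unfolding Q_def[symmetric] by (simp add: distrib_left)
qed

text \<open>The identity with \<open>q = 1\<close> in the \<open>k\<close>-th unit direction has
  average 0, and by \<open>core_deviation\<close> its integrand differs from
  \<open>L * (A k * v k)\<close> by a multiple of \<open>control\<close>.\<close>

lemma core_estimate:
  assumes k: "k \<in> I"
  shows "\<bar>L * avg (\<lambda>w. v w k)\<bar> \<le> core_const k * avg (\<lambda>_. 1)"
proof -
  have kn: "k < n" using k I by auto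
  define q where "q w = \<gamma> w * (Kv w k - L * A k + d s k) + (a w + L * S - bd) * p w k" for w
  define M where "M = 2 + A k * (\<beta>m + 1) + \<beta>m * (2 * K_max + D) + Dn"
  have "\<bar>L * avg (\<lambda>w. A k * v w k)\<bar> \<le> M * control_const * avg (\<lambda>_. 1)"
  proof (rule avg_deviation)
    show "tame (\<lambda>w. A k * v w k)" "tame q"
      unfolding q_def using kn by (intro tame_all; simp)+
    show "avg q = 0"
      using identity[OF has_grad_const[of 1], of "\<lambda>j. if j = k then 1 else 0"]
      unfolding delta_sum[OF kn] delta_sum'[OF kn] q_def by (simp add: avg_def mult.commute[of "\<gamma> _"])
    show "0 \<le> M"
      unfolding M_def using A_pos[OF k] \<beta>m K_max_nonneg D Dn_ge
      by (intro add_nonneg_nonneg mult_nonneg_nonneg) auto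
    fix w assume w: "g (Y w) \<noteq> 0"
    show "\<bar>L * (A k * v w k) - q w\<bar> \<le> M * control w"
      using tail_point.core_deviation[OF tail_point[OF w] k Kv_bound[OF kn] K_max_nonneg]
      unfolding tail_point_eqs[OF w] tail_point_eqs(8)[OF w kn] q_def M_def .
  qed
  then have "A k * \<bar>L * avg (\<lambda>w. v w k)\<bar> \<le> M * control_const * avg (\<lambda>_. 1)"
    unfolding avg_cmult using A_pos[OF k] by (simp add: abs_mult mult_ac)
  then show ?thesis
    unfolding core_const_def M_def[symmetric] using A_pos[OF k] by (simp add: field_simps)
qed

text \<open>The direction \<open>Bf j\<close> bounds the mean of the regression residual
  \<open>fv\<close>; asset \<open>j\<close> is recovered from it by subtracting the multiples of the
  deviations on \<open>I\<close>, already estimated.\<close>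

lemma tail_estimate:
  assumes j: "j < n" "j \<notin> I"
  shows "\<bar>L * avg (\<lambda>w. v w j)\<bar> \<le> tail_const j * avg (\<lambda>_. 1)"
proof -
  define fv where "fv w = (\<Sum>k<n. f j k * v w k)" for w
  define q where "q w = L * (\<gamma> w * fv w + (a w + L * S - bd) * (\<Sum>k<n. Bf j k * p w k))" for w
  define M where "M = (\<beta>m\<^sup>2 + 1) * quad_form n K (Bf j) + 1 + Bf_max j * (1 + S + Dn)"
  have tfv: "tame fv" unfolding fv_def by (intro tame_all) auto
  have BfI: "Bf j k = 0" if "k \<in> I" for k unfolding Bf_def by (rule f_B[OF j that])
  have BK: "(\<Sum>k<n. \<Sum>l<n. Bf j k * K k l * v w l) = fv w" for w
    unfolding Bf_def fv_def by (rule BK_bilinear)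
  have Bf_max_nn: "0 \<le> Bf_max j" unfolding Bf_max_def by (simp add: sum_nonneg)
  have "\<bar>L * avg fv\<bar> \<le> M * control_const * avg (\<lambda>_. 1)"
  proof (rule avg_deviation)
    show "tame fv" by (rule tfv)
    show "tame q" unfolding q_def by (intro tame_all tfv) auto
    \<comment> \<open>\<open>Bf j\<close> vanishes on \<open>I\<close> while \<open>A\<close> and
      \<open>d s\<close> vanish off \<open>I\<close>, so the term of order \<open>L\<close>
      disappears.\<close>
    have "(\<Sum>k<n. Bf j k * (Kv w k - L * A k + d s k)) = fv w" for w
    proof -
      have "Bf j k * A k = 0" "Bf j k * d s k = 0" if "k < n" for k
        using BfI[of k] A_off[of k] d_off[of k] that by (cases "k \<in> I"; simp add: d_def)+
      then have "(\<Sum>k<n. Bf j k * (Kv w k - L * A k + d s k)) = (\<Sum>k<n. Bf j k * Kv w k)"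
      proof (intro sum.cong refl)
        fix k assume "k \<in> {..<n}"
        then have z: "Bf j k * A k = 0" "Bf j k * d s k = 0"
          using \<open>\<And>k. k < n \<Longrightarrow> Bf j k * A k = 0\<close> \<open>\<And>k. k < n \<Longrightarrow> Bf j k * d s k = 0\<close> by auto
        have "Bf j k * (Kv w k - L * A k + d s k) = Bf j k * Kv w k - L * (Bf j k * A k) + Bf j k * d s k"
          by (simp add: algebra_simps)
        then show "Bf j k * (Kv w k - L * A k + d s k) = Bf j k * Kv w k" unfolding z by simp
      qed
      then show ?thesis unfolding BK[symmetric] Kv_def by (simp add: sum_distrib_left mult.assoc)
    qed
    then show "avg q = 0"
      using identity[OF has_grad_const[of 1], of "Bf j"]
      unfolding q_def avg_cmult by (simp add: avg_def mult.commute[of "\<gamma> _"])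
    show "0 \<le> M"
      unfolding M_def using K_psd Bf_max_nn S_pos Dn_ge by (intro add_nonneg_nonneg mult_nonneg_nonneg) auto
    fix w assume w: "g (Y w) \<noteq> 0"
    have "\<bar>L * fv w - L * (tail_point.\<gamma> n \<beta> L (v w) (\<kappa> s) * fv w
         + (tail_point.a I A (v w) + L * S - tail_point.bd n \<beta> (d s))
            * (\<Sum>k<n. Bf j k * tail_point.p \<beta> L (v w) (\<kappa> s) k))\<bar>
       \<le> M * tail_point.control n I A \<beta> L (v w) (\<kappa> s) (Q w)"
      unfolding M_def
    proof (rule tail_point.tail_deviation[OF tail_point[OF w]])
      show "\<bar>Bf j k\<bar> \<le> Bf_max j" if "k < n" for k
        unfolding Bf_max_def using that by (intro member_le_sum) auto
      show "2 * \<bar>\<tau> * fv w\<bar> \<le> \<tau>\<^sup>2 * quad_form n K (Bf j) + Q w" for \<tau>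
        using quad_form_mixed_le[OF K_sym K_psd, of "\<lambda>k. \<tau> * Bf j k" "v w"]
        unfolding quad_form_scale Q_def BK[symmetric]
        by (simp add: sum_distrib_left mult.assoc)
    qed (use BfI K_psd Bf_max_nn in auto)
    moreover have "(\<Sum>k<n. Bf j k * tail_point.p \<beta> L (v w) (\<kappa> s) k) = (\<Sum>k<n. Bf j k * p w k)"
      by (intro sum.cong refl) (simp add: tail_point_eqs(8)[OF w])
    ultimately show "\<bar>L * fv w - q w\<bar> \<le> M * control w"
      unfolding q_def tail_point_eqs[OF w] by simp
  qed
  moreover have "avg (\<lambda>w. v w j) = avg fv - (\<Sum>k\<in>I. f j k * avg (\<lambda>w. v w k))"
  proof -
    have "fv w = v w j + (\<Sum>k\<in>I. f j k * v w k)" for w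
    proof -
      have "(\<Sum>k\<in>J. f j k * v w k) = (\<Sum>k\<in>J. (if k = j then v w j else 0))"
        using f_diag[OF j] f_off[OF j] by (intro sum.cong refl) (auto simp: J_def)
      also have "\<dots> = v w j" using j by (simp add: J_def)
      finally show ?thesis unfolding fv_def sum_IJ by simp
    qed
    then have "fv = (\<lambda>w. v w j + (\<Sum>k\<in>I. f j k * v w k))" by blast
    then have "avg fv = avg (\<lambda>w. v w j) + (\<Sum>k\<in>I. avg (\<lambda>w. f j k * v w k))"
      using I j by (subst avg_sum[symmetric], intro tame_all, force, simp)
         (rule avg_add; intro tame_all; auto)
    then show ?thesis by (simp add: avg_cmult)
  qed
  moreover have "\<bar>\<Sum>k\<in>I. f j k * (L * avg (\<lambda>w. v w k))\<bar> \<le> (\<Sum>k\<in>I. \<bar>f j k\<bar> * core_const k) * avg (\<lambda>_. 1)"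
  proof -
    have "\<bar>\<Sum>k\<in>I. f j k * (L * avg (\<lambda>w. v w k))\<bar> \<le> (\<Sum>k\<in>I. \<bar>f j k\<bar> * \<bar>L * avg (\<lambda>w. v w k)\<bar>)"
      unfolding abs_mult[symmetric] by (rule sum_abs)
    also have "\<dots> \<le> (\<Sum>k\<in>I. \<bar>f j k\<bar> * (core_const k * avg (\<lambda>_. 1)))"
      by (intro sum_mono mult_left_mono core_estimate) auto
    finally show ?thesis by (simp add: sum_distrib_right mult.assoc)
  qed
  moreover have "L * (avg fv - (\<Sum>k\<in>I. f j k * avg (\<lambda>w. v w k)))
      = L * avg fv - (\<Sum>k\<in>I. f j k * (L * avg (\<lambda>w. v w k)))"
    by (simp add: right_diff_distrib sum_distrib_left mult.left_commute)
  ultimately have "\<bar>L * avg (\<lambda>w. v w j)\<bar> \<le> M * control_const * avg (\<lambda>_. 1)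
      + (\<Sum>k\<in>I. \<bar>f j k\<bar> * core_const k) * avg (\<lambda>_. 1)"
  proof -
    let ?x = "L * avg fv" and ?y = "\<Sum>k\<in>I. f j k * (L * avg (\<lambda>w. v w k))"
    have "L * avg (\<lambda>w. v w j) = ?x - ?y"
      using \<open>avg (\<lambda>w. v w j) = _\<close> \<open>L * (avg fv - _) = _\<close> by simp
    then show ?thesis
      using \<open>\<bar>?x\<bar> \<le> _\<close> \<open>\<bar>?y\<bar> \<le> _\<close> by linarith
  qed
  then show ?thesis
    unfolding tail_const_def M_def[symmetric] distrib_right[of "M * control_const"] .
qed

lemma log_price_estimate: "\<bar>L * avg (\<lambda>w. X i w - m s L i)\<bar> \<le> conv_const * avg (\<lambda>_. 1)"
proof -
  have "\<bar>L * avg (\<lambda>w. v w i)\<bar> \<le> (if i \<in> I then core_const i else tail_const i) * avg (\<lambda>_. 1)"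
    using core_estimate[of i] tail_estimate[of i] i by auto
  also have "\<dots> \<le> conv_const * avg (\<lambda>_. 1)"
    unfolding conv_const_def using avg_1_nonneg by (intro mult_right_mono) auto
  finally show ?thesis unfolding v_def .
qed

end


section \<open>From log-prices to prices\<close>

text \<open>An Euler product: \<open>N\<close> steps of length \<open>1 / N\<close> multiply the
  bounds. The drifts sum to \<open>m + \<sigma> * (N - 1) / (2 * N)\<close> and the errors form
  \<open>(1 - c / N) ^ N\<close>; the limit in \<open>N\<close> gives the claim.\<close>

lemma exponential_tilt_lower:
  fixes \<Phi> :: "real \<Rightarrow> real"
  assumes c: "0 \<le> c" and \<Phi>0: "0 \<le> \<Phi> 0"
    and step: "\<And>s s'. 0 \<le> s \<Longrightarrow> s \<le> 1 \<Longrightarrow> 0 \<le> s' \<Longrightarrow> s' \<le> 1 \<Longrightarrow>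
      exp ((s' - s) * (m + s * \<sigma>)) * \<Phi> s * (1 - \<bar>s' - s\<bar> * c) \<le> \<Phi> s'"
  shows "exp (m + \<sigma> / 2 - c) * \<Phi> 0 \<le> \<Phi> 1"
proof -
  \<comment> \<open>From here on \<open>1 - c / N\<close> is nonnegative, as multiplying the
    inequalities requires.\<close>
  obtain N0 :: nat where N0: "c \<le> real N0" using real_arch_simple by blast
  have le: "exp (m + \<sigma> * (real N - 1) / (2 * real N)) * (1 + (- c) / real N) ^ N * \<Phi> 0 \<le> \<Phi> 1"
    if N: "N \<ge> Suc N0" for N
  proof -
    define h where "h = 1 / real N"
    have h: "0 < h" "h * real N = 1" "0 \<le> 1 - h * c" unfolding h_def using N N0 by (auto simp: field_simps)
    have "exp (h * real k * m + h\<^sup>2 * \<sigma> * (real k * (real k - 1) / 2)) * (1 - h * c) ^ k * \<Phi> 0 \<le> \<Phi> (h * real k)"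
      if "k \<le> N" for k
      using that
    proof (induction k)
      case (Suc k)
      define s where "s = h * real k"
      have "h * real (Suc k) \<le> h * real N" using Suc.prems h by (intro mult_left_mono) auto
      then have s: "0 \<le> s" "s + h \<le> 1" "h * real (Suc k) = s + h"
        using h unfolding s_def by (auto simp: distrib_left)
      have "exp (h * real k * m + h\<^sup>2 * \<sigma> * (real k * (real k - 1) / 2)) * (1 - h * c) ^ k * \<Phi> 0 \<le> \<Phi> s"
        using Suc unfolding s_def by simp
      then have "exp (h * (m + s * \<sigma>)) * (exp (h * real k * m + h\<^sup>2 * \<sigma> * (real k * (real k - 1) / 2)) * (1 - h * c) ^ k * \<Phi> 0) * (1 - h * c)
          \<le> exp (h * (m + s * \<sigma>)) * \<Phi> s * (1 - h * c)"
        using h by (intro mult_right_mono mult_left_mono) auto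
      also have "\<dots> \<le> \<Phi> (s + h)" using step[of s "s + h"] s h by simp
      also have "exp (h * (m + s * \<sigma>)) * (exp (h * real k * m + h\<^sup>2 * \<sigma> * (real k * (real k - 1) / 2)) * (1 - h * c) ^ k * \<Phi> 0) * (1 - h * c)
         = exp (h * (m + s * \<sigma>) + (h * real k * m + h\<^sup>2 * \<sigma> * (real k * (real k - 1) / 2))) * (1 - h * c) ^ Suc k * \<Phi> 0"
        by (simp add: exp_add mult_ac)
      also have "h * (m + s * \<sigma>) + (h * real k * m + h\<^sup>2 * \<sigma> * (real k * (real k - 1) / 2))
         = h * real (Suc k) * m + h\<^sup>2 * \<sigma> * (real (Suc k) * (real (Suc k) - 1) / 2)"
        unfolding s_def by (simp add: field_simps power2_eq_square)
      finally show ?case unfolding s(3) .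
    qed simp
    from this[of N] have "exp (m + h\<^sup>2 * \<sigma> * (real N * (real N - 1) / 2)) * (1 - h * c) ^ N * \<Phi> 0 \<le> \<Phi> 1"
      using h(2) by simp
    moreover have "h\<^sup>2 * \<sigma> * (real N * (real N - 1) / 2) = \<sigma> * (real N - 1) / (2 * real N)"
      unfolding h_def using N by (simp add: field_simps power2_eq_square)
    ultimately show ?thesis unfolding h_def by (simp add: mult.commute)
  qed
  have "(\<lambda>N. \<sigma> * (real N - 1) / (2 * real N)) \<longlonglongrightarrow> \<sigma> / 2" by real_asymp
  then have "(\<lambda>N. exp (m + \<sigma> * (real N - 1) / (2 * real N)) * (1 + (- c) / real N) ^ N * \<Phi> 0)
      \<longlonglongrightarrow> exp (m + \<sigma> / 2) * exp (- c) * \<Phi> 0"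
    by (intro tendsto_mult tendsto_exp tendsto_add tendsto_const tendsto_exp_limit_sequentially)
  then have "exp (m + \<sigma> / 2) * exp (- c) * \<Phi> 0 \<le> \<Phi> 1"
    by (rule Lim_bounded) (use le in blast)
  then show ?thesis by (simp add: exp_add[symmetric])
qed

text \<open>The positive part of a parabola, squared to make it continuously differentiable as
  integration by parts demands; for \<open>u < v\<close> it is positive exactly between
  \<open>u\<close> and \<open>v\<close>.\<close>

definition bump :: "real \<Rightarrow> real \<Rightarrow> real \<Rightarrow> real" where
  "bump u v y = (max 0 ((y - u) * (v - y)))\<^sup>2"

definition bump' :: "real \<Rightarrow> real \<Rightarrow> real \<Rightarrow> real" where
  "bump' u v y = 2 * max 0 ((y - u) * (v - y)) * (u + v - 2 * y)"

lemma max_0_square_DERIV: "((\<lambda>z::real. (max 0 z)\<^sup>2) has_real_derivative 2 * max 0 z) (at z)"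
proof -
  consider "z < 0" | "z > 0" | "z = 0" by linarith
  then show ?thesis
  proof cases
    case 1
    have "((\<lambda>z::real. 0) has_real_derivative 2 * max 0 z) (at z)" using 1 by simp
    then show ?thesis
      by (rule has_field_derivative_transform_within_open[of _ _ _ "{..<0}"]) (use 1 in auto)
  next
    case 2
    have "((\<lambda>z::real. z\<^sup>2) has_real_derivative 2 * max 0 z) (at z)"
      using 2 by (auto intro!: derivative_eq_intros)
    then show ?thesis
      by (rule has_field_derivative_transform_within_open[of _ _ _ "{0<..}"]) (use 2 in auto)
  next
    case 3
    have "((\<lambda>h::real. (max 0 h)\<^sup>2 / h) \<longlongrightarrow> 0) (at 0)"
    proof (rule Lim_null_comparison)
      show "\<forall>\<^sub>F h in at 0. norm ((max 0 h)\<^sup>2 / h) \<le> \<bar>h\<bar>"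
        by (intro always_eventually allI) (auto simp: max_def power2_eq_square)
      show "((\<lambda>h::real. \<bar>h\<bar>) \<longlongrightarrow> 0) (at 0)" by (rule tendsto_rabs_zero) (rule tendsto_ident_at)
    qed
    then show ?thesis unfolding 3 DERIV_def by simp
  qed
qed

lemma bump_DERIV: "(bump u v has_real_derivative bump' u v y) (at y)"
proof -
  have "((\<lambda>y. (y - u) * (v - y)) has_real_derivative (u + v - 2 * y)) (at y)"
    by (auto intro!: derivative_eq_intros simp: algebra_simps)
  from DERIV_chain2[OF max_0_square_DERIV this] show ?thesis
    unfolding bump_def bump'_def by simp
qed

lemma bump_nonneg: "0 \<le> bump u v y"
  unfolding bump_def by simp

lemma bump_pos: "u < y \<Longrightarrow> y < v \<Longrightarrow> 0 < bump u v y"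
  unfolding bump_def by (simp add: max_def)

lemma positive_product_interval:
  assumes "u < v" "0 < (y - u) * (v - y)"
  shows "u < y \<and> y < (v::real)"
  using assms by (auto simp: zero_less_mult_iff)

lemma bump_support: "u < v \<Longrightarrow> bump u v y \<noteq> 0 \<Longrightarrow> u \<le> y \<and> y \<le> v"
proof -
  assume uv: "u < v" and "bump u v y \<noteq> 0"
  have "0 < (y - u) * (v - y)"
  proof (rule ccontr)
    assume "\<not> 0 < (y - u) * (v - y)"
    then have "max 0 ((y - u) * (v - y)) = 0" by (intro max_absorb1) linarith
    then show False using \<open>bump u v y \<noteq> 0\<close> unfolding bump_def by simp
  qed
  then show ?thesis using positive_product_interval[OF uv] by force
qed

lemma bump_bounded:
  assumes "u < v"
  shows "\<bar>bump u v y\<bar> \<le> (v - u) ^ 4 + 2 * (v - u) ^ 3" "\<bar>bump' u v y\<bar> \<le> (v - u) ^ 4 + 2 * (v - u) ^ 3"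
proof -
  have vu: "0 \<le> (v - u) ^ 4" "0 \<le> 2 * (v - u) ^ 3" using assms by auto
  have "\<bar>bump u v y\<bar> \<le> (v - u) ^ 4 \<and> \<bar>bump' u v y\<bar> \<le> 2 * (v - u) ^ 3"
  proof (cases "0 < (y - u) * (v - y)")
    case True
    then have y: "u < y" "y < v" using positive_product_interval[OF assms True] by auto
    have q: "(y - u) * (v - y) \<le> (v - u) * (v - u)" using y by (intro mult_mono) auto
    have "bump u v y \<le> ((v - u) * (v - u))\<^sup>2"
      unfolding bump_def using True q by (intro power_mono) auto
    moreover have "\<bar>bump' u v y\<bar> \<le> 2 * ((v - u) * (v - u)) * (v - u)"
      unfolding bump'_def abs_mult using True q y by (intro mult_mono) (auto simp: abs_le_iff)
    ultimately show ?thesis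
      using bump_nonneg[of u v y] by (simp add: power_numeral_reduce mult_ac)
  next
    case False
    then show ?thesis using vu by (simp add: bump_def bump'_def max_def)
  qed
  then show "\<bar>bump u v y\<bar> \<le> (v - u) ^ 4 + 2 * (v - u) ^ 3" "\<bar>bump' u v y\<bar> \<le> (v - u) ^ 4 + 2 * (v - u) ^ 3"
    using vu by linarith+
qed

lemma bump'_measurable: "bump' u v \<in> borel_measurable borel"
  unfolding bump'_def by measurable

context basket
begin

section \<open>Positive mass of the bump weights\<close>

lemma BK_sum: "k < n \<Longrightarrow> (\<Sum>l<n. B k l * (\<Sum>j<n. K l j * u j)) = u k"
proof -
  assume k: "k < n"
  have "(\<Sum>l<n. B k l * (\<Sum>j<n. K l j * u j)) = (\<Sum>l<n. \<Sum>j<n. B k l * K l j * u j)"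
    by (simp add: sum_distrib_left mult.assoc)
  also have "\<dots> = (\<Sum>j<n. (\<Sum>l<n. B k l * K l j) * u j)"
    by (subst sum.swap) (simp add: sum_distrib_right)
  also have "\<dots> = (\<Sum>j<n. (\<Sum>l<n. K j l * B l k) * u j)"
  proof (rule sum.cong[OF refl])
    fix j assume j: "j \<in> {..<n}"
    have "B k l * K l j = K j l * B l k" if "l < n" for l
    proof -
      have "B k l = B l k" "K l j = K j l"
        using k j that B_sym K_sym unfolding sym_mat_def by auto
      then show ?thesis by simp
    qed
    then show "(\<Sum>l<n. B k l * K l j) * u j = (\<Sum>l<n. K j l * B l k) * u j" by simp
  qed
  also have "\<dots> = (\<Sum>j<n. if j = k then u j else 0)"
    using k by (intro sum.cong refl) (simp add: KB)
  finally show ?thesis using k by simp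
qed

lemma Y_measurable [measurable]: "Y \<in> borel_measurable P"
  using tame_Y unfolding tame_def measurable_normal_product by simp

lemma Y_interval_positive:
  assumes uv: "0 < u" "u < v"
  shows "0 < emeasure P {w \<in> space P. u < Y w \<and> Y w < v}"
proof -
  define q where "q = ln (v / u)"
  have q: "0 < q" unfolding q_def using uv by simp
  have v: "v = u * exp q" unfolding q_def using uv by simp
  \<comment> \<open>If every \<open>X k\<close> equals \<open>\<tau>\<close>, then \<open>Y\<close>
    is the geometric mean of \<open>u\<close> and \<open>v\<close>. The point \<open>w0\<close>, the
    transpose of \<open>R\<close> applied to \<open>K (\<tau> - \<mu>)\<close>, achieves this; in
    the box of radius \<open>r\<close> around it each \<open>X k\<close> moves by at most
    \<open>q / 4\<close>, which keeps \<open>Y\<close> strictly inside.\<close>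
  define \<tau> where "\<tau> = ln (u / real n) + q / 2"
  define z where "z l = (\<Sum>j<n. K l j * (\<tau> - \<mu> j))" for l
  define w0 where "w0 j = (\<Sum>l<n. R l j * z l)" for j
  have Xw0: "X k w0 = \<tau>" if k: "k < n" for k
  proof -
    have "(\<Sum>j<n. R k j * w0 j) = (\<Sum>j<n. \<Sum>l<n. R k j * R l j * z l)"
      unfolding w0_def by (simp add: sum_distrib_left mult.assoc)
    also have "\<dots> = (\<Sum>l<n. (\<Sum>j<n. R k j * R l j) * z l)"
      by (subst sum.swap) (simp add: sum_distrib_right)
    also have "\<dots> = (\<Sum>l<n. B k l * z l)" using k by (intro sum.cong refl) (simp add: RR)
    also have "\<dots> = \<tau> - \<mu> k" unfolding z_def by (rule BK_sum[OF k])
    finally show ?thesis unfolding X_def by simp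
  qed
  define Rs where "Rs = 1 + (\<Sum>k<n. \<Sum>j<n. \<bar>R k j\<bar>)"
  have Rs: "1 \<le> Rs" unfolding Rs_def by (simp add: sum_nonneg)
  define r where "r = q / (4 * Rs)"
  have r: "0 < r" "r * Rs = q / 4" unfolding r_def using q Rs by auto
  define U where "U j = {w0 j - r <..< w0 j + r}" for j
  interpret N: prob_space "normal_measure (sqrt t)" using prob_space_normal_density t_pos by simp
  interpret PS: product_sigma_finite "\<lambda>_::nat. normal_measure (sqrt t)" by standard
  have "0 < (\<Prod>j<n. emeasure (normal_measure (sqrt t)) (U j))"
  proof -
    have "emeasure (normal_measure (sqrt t)) (U j) \<noteq> 0" for j
    proof
      assume "emeasure (normal_measure (sqrt t)) (U j) = 0"
      then have "AE x in lborel. x \<in> U j \<longrightarrow> normal_density 0 (sqrt t) x \<le> 0"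
        by (subst (asm) emeasure_density)
          (auto simp: U_def nn_integral_0_iff_AE indicator_def ennreal_eq_0_iff intro: AE_mp)
      then have "AE x in lborel. x \<notin> U j"
        using normal_density_pos[of "sqrt t" 0] t_pos by (auto simp: not_le[symmetric])
      then have "U j \<in> null_sets lborel"
        by (subst AE_iff_null_sets) (auto simp: U_def)
      then have "emeasure lborel (U j) = 0" by (rule null_setsD1)
      then show False using r unfolding U_def by simp
    qed
    then show ?thesis by (simp add: zero_less_iff_neq_zero)
  qed
  also have "\<dots> = emeasure P (\<Pi>\<^sub>E j\<in>{..<n}. U j)"
    unfolding normal_product_def by (subst PS.emeasure_PiM) (auto simp: U_def)
  also have "\<dots> \<le> emeasure P {w \<in> space P. u < Y w \<and> Y w < v}"
  proof (rule emeasure_mono)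
    show "{w \<in> space P. u < Y w \<and> Y w < v} \<in> sets P"
      by measurable
    show "(\<Pi>\<^sub>E j\<in>{..<n}. U j) \<subseteq> {w \<in> space P. u < Y w \<and> Y w < v}"
    proof safe
      fix w assume w: "w \<in> (\<Pi>\<^sub>E j\<in>{..<n}. U j)"
      then show "w \<in> space P" by (auto simp: normal_product_def space_PiM PiE_def)
      have X: "\<bar>X k w - \<tau>\<bar> \<le> q / 4" if k: "k < n" for k
      proof -
        have "X k w - \<tau> = (\<Sum>j<n. R k j * (w j - w0 j))"
          unfolding Xw0[OF k, symmetric] X_def by (simp add: right_diff_distrib sum_subtractf)
        also have "\<bar>\<dots>\<bar> \<le> (\<Sum>j<n. \<bar>R k j\<bar> * \<bar>w j - w0 j\<bar>)"
          unfolding abs_mult[symmetric] by (rule sum_abs)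
        also have "\<dots> \<le> (\<Sum>j<n. \<bar>R k j\<bar> * r)"
        proof (intro sum_mono mult_left_mono)
          fix j assume "j \<in> {..<n}"
          then have "w j \<in> U j" using w by (rule PiE_mem[rotated])
          then show "\<bar>w j - w0 j\<bar> \<le> r" unfolding U_def by auto
        qed simp
        also have "\<dots> = (\<Sum>j<n. \<bar>R k j\<bar>) * r" by (simp add: sum_distrib_right)
        also have "\<dots> \<le> Rs * r"
        proof (rule mult_right_mono)
          have "(\<Sum>j<n. \<bar>R k j\<bar>) \<le> (\<Sum>k<n. \<Sum>j<n. \<bar>R k j\<bar>)"
            using k by (intro member_le_sum[of k "{..<n}" "\<lambda>k. \<Sum>j<n. \<bar>R k j\<bar>"]) (auto simp: sum_nonneg)
          then show "(\<Sum>j<n. \<bar>R k j\<bar>) \<le> Rs" unfolding Rs_def by linarith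
        qed (use r in simp)
        finally show ?thesis using r by (simp add: mult.commute)
      qed
      have n: "0 < real n" using i by simp
      have lo: "(u / real n) * exp (q / 4) \<le> exp (X k w)" and hi: "exp (X k w) \<le> (u / real n) * exp (3 * q / 4)" if k: "k < n" for k
      proof -
        define l where "l = ln (u / real n)"
        have e: "(u / real n) * exp c = exp (l + c)" for c
          unfolding l_def using uv n by (simp add: exp_add)
        have "l + q / 4 \<le> X k w" "X k w \<le> l + 3 * q / 4"
          using X[OF k] unfolding \<tau>_def l_def[symmetric] by linarith+
        then show "(u / real n) * exp (q / 4) \<le> exp (X k w)" "exp (X k w) \<le> (u / real n) * exp (3 * q / 4)"
          unfolding e exp_le_cancel_iff .
      qed
      have "u < u * exp (q / 4)" using uv q by simp
      also have "\<dots> = (\<Sum>k<n. (u / real n) * exp (q / 4))" using n by simp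
      also have "\<dots> \<le> Y w" unfolding Y_def by (intro sum_mono lo) simp
      finally show "u < Y w" .
      have "Y w \<le> (\<Sum>k<n. (u / real n) * exp (3 * q / 4))" unfolding Y_def by (intro sum_mono hi) simp
      also have "\<dots> = u * exp (3 * q / 4)" using n by simp
      also have "\<dots> < v" unfolding v using uv q by simp
      finally show "Y w < v" .
    qed
  qed
  finally show ?thesis .
qed

lemma integral_bump_positive:
  assumes uv: "0 < u" "u < v"
  shows "0 < (\<integral>w. bump u v (Y w) \<partial>P)"
proof -
  have tb: "tame (\<lambda>w. bump u v (Y w))"
    using has_grad_comp_Y[OF bump_DERIV bump'_measurable bump_bounded[OF uv(2)]]
    unfolding has_grad_def by auto
  have int: "integrable P (\<lambda>w. bump u v (Y w))" by (rule integrable_tame[OF tb])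
  have "(\<integral>w. bump u v (Y w) \<partial>P) \<noteq> 0"
  proof
    assume "(\<integral>w. bump u v (Y w) \<partial>P) = 0"
    then have "AE w in P. bump u v (Y w) = 0"
      using integral_nonneg_eq_0_iff_AE[OF int] by (simp add: bump_nonneg)
    then have "AE w in P. \<not> (u < Y w \<and> Y w < v)"
      by (rule AE_mp) (use bump_pos in \<open>force intro!: AE_I2\<close>)
    moreover have "{w \<in> space P. u < Y w \<and> Y w < v} \<in> sets P"
      by measurable
    ultimately have "emeasure P {w \<in> space P. u < Y w \<and> Y w < v} = 0"
      by (subst (asm) AE_iff_measurable[OF _ refl]) auto
    then show False using Y_interval_positive[OF uv] by simp
  qed
  moreover have "0 \<le> (\<integral>w. bump u v (Y w) \<partial>P)" by (intro integral_nonneg_AE AE_I2 bump_nonneg)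
  ultimately show ?thesis by linarith
qed

text \<open>This is \<open>m (1 / 2) L i\<close>, the integral of the affine function
  \<open>m s L i\<close> over \<open>s\<close> in [0,1].\<close>

definition log_limit :: "real \<Rightarrow> real" where
  "log_limit L = \<mu> i - \<beta> i * L + (\<Sum>l<n. B i l * (d0 l + d1 l / 2)) + t * B i i / 2"

text \<open>\<open>1 + z \<le> exp z\<close> with \<open>z = (s' - s) * (X i w - m s L i)\<close>
  reduces the change of tilt to the mean of \<open>X i\<close> at \<open>s\<close>. The sign of
  \<open>s' - s\<close> is free, so the step can be used in both directions.\<close>

lemma tilt_step:
  assumes s: "0 \<le> s" "s \<le> 1" and L: "Lmin \<le> L"
    and g: "\<And>y. (g has_real_derivative g' y) (at y)" "g' \<in> borel_measurable borel"
    and g_bd: "\<And>y. \<bar>g y\<bar> \<le> C" "\<And>y. \<bar>g' y\<bar> \<le> C"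
    and g_nonneg: "\<And>y. 0 \<le> g y"
    and g_supp: "\<And>y. g y \<noteq> 0 \<Longrightarrow> (1 - 1 / L) * exp (- L) \<le> y \<and> y \<le> exp (- L)"
  defines "\<Phi> \<equiv> \<lambda>s. \<integral>w. exp (s * X i w) * g (Y w) \<partial>P"
  shows "exp ((s' - s) * m s L i) * \<Phi> s * (1 - \<bar>s' - s\<bar> * (conv_const / L)) \<le> \<Phi> s'"
proof -
  interpret bp: basket_point n t R B K \<mu> I A \<beta> S D b \<beta>m Am i d0 d1 f s L C g g'
    by unfold_locales (use assms in auto)
  define h where "h = s' - s"
  have L0: "0 < L" using L Lmin_pos by simp
  have avg1: "bp.avg (\<lambda>_. 1) = \<Phi> s" unfolding bp.avg_def bp.\<rho>_def \<Phi>_def by simp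
  have tX: "tame (\<lambda>w. X i w - m s L i)" using i by (intro tame_intros)
  have tg: "tame (\<lambda>w. exp (s' * X i w) * g (Y w))" using i by (intro tame_intros bp.tame_gY)
  have "\<bar>h * bp.avg (\<lambda>w. X i w - m s L i)\<bar> \<le> \<bar>h\<bar> * (conv_const / L) * \<Phi> s"
  proof -
    have "\<bar>bp.avg (\<lambda>w. X i w - m s L i)\<bar> \<le> conv_const / L * \<Phi> s"
      using bp.log_price_estimate L0 unfolding avg1 by (simp add: abs_mult field_simps)
    then show ?thesis unfolding abs_mult mult.assoc by (intro mult_left_mono) auto
  qed
  then have "\<Phi> s * (1 - \<bar>h\<bar> * (conv_const / L)) \<le> \<Phi> s + h * bp.avg (\<lambda>w. X i w - m s L i)"
    by (simp add: right_diff_distrib mult_ac)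
  also have "\<dots> = bp.avg (\<lambda>w. 1 + h * (X i w - m s L i))"
    unfolding avg1[symmetric] bp.avg_cmult[symmetric]
    by (rule bp.avg_add[symmetric]) (use tX in \<open>auto intro!: tame_intros\<close>)
  finally have "exp (h * m s L i) * (\<Phi> s * (1 - \<bar>h\<bar> * (conv_const / L)))
      \<le> exp (h * m s L i) * bp.avg (\<lambda>w. 1 + h * (X i w - m s L i))"
    by (intro mult_left_mono) auto
  also have "\<dots> = bp.avg (\<lambda>w. exp (h * m s L i) * (1 + h * (X i w - m s L i)))"
    by (rule bp.avg_cmult[symmetric])
  also have "\<dots> \<le> \<Phi> s'"
    unfolding bp.avg_def \<Phi>_def
  proof (rule integral_mono)
    show "integrable P (\<lambda>w. exp (h * m s L i) * (1 + h * (X i w - m s L i)) * bp.\<rho> w)"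
      by (intro bp.avg_integrable tame_intros) (use i in auto)
    show "integrable P (\<lambda>w. exp (s' * X i w) * g (Y w))" by (rule integrable_tame[OF tg])
    fix w
    have "exp (h * m s L i) * (1 + h * (X i w - m s L i)) \<le> exp (h * m s L i) * exp (h * (X i w - m s L i))"
      by (intro mult_left_mono exp_ge_add_one_self) auto
    also have "\<dots> = exp (h * X i w)" by (simp add: exp_add[symmetric] algebra_simps)
    finally have "exp (h * m s L i) * (1 + h * (X i w - m s L i)) * bp.\<rho> w \<le> exp (h * X i w) * bp.\<rho> w"
      using bp.\<rho>_nonneg by (rule mult_right_mono)
    also have "\<dots> = exp (s' * X i w) * g (Y w)"
      unfolding bp.\<rho>_def h_def by (simp add: exp_add[symmetric] algebra_simps)
    finally show "exp (h * m s L i) * (1 + h * (X i w - m s L i)) * bp.\<rho> w \<le> exp (s' * X i w) * g (Y w)" .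
  qed
  finally show ?thesis unfolding h_def by (simp add: mult.assoc)
qed

theorem localized_ratio:
  assumes L: "Lmin \<le> L"
    and g: "\<And>y. (g has_real_derivative g' y) (at y)" "g' \<in> borel_measurable borel"
    and g_bd: "\<And>y. \<bar>g y\<bar> \<le> C" "\<And>y. \<bar>g' y\<bar> \<le> C"
    and g_nonneg: "\<And>y. 0 \<le> g y"
    and g_supp: "\<And>y. g y \<noteq> 0 \<Longrightarrow> (1 - 1 / L) * exp (- L) \<le> y \<and> y \<le> exp (- L)"
  shows "exp (log_limit L - conv_const / L) * (\<integral>w. g (Y w) \<partial>P) \<le> (\<integral>w. exp (X i w) * g (Y w) \<partial>P)"
    and "(\<integral>w. exp (X i w) * g (Y w) \<partial>P) \<le> exp (log_limit L + conv_const / L) * (\<integral>w. g (Y w) \<partial>P)"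
proof -
  define \<Phi> where "\<Phi> s = (\<integral>w. exp (s * X i w) * g (Y w) \<partial>P)" for s
  define \<sigma> where "\<sigma> = t * B i i + (\<Sum>l<n. B i l * d1 l)"
  define m0 where "m0 = m 0 L i"
  have m: "m s L i = m0 + s * \<sigma>" for s
    unfolding m0_def m_def \<kappa>_def d_def \<sigma>_def
    by (simp add: distrib_left sum.distrib sum_distrib_left mult_ac)
  have c: "0 \<le> conv_const / L"
  proof -
    have "0 \<le> conv_const" unfolding conv_const_def by simp
    then show ?thesis using L Lmin_pos by simp
  qed
  have \<Phi>_nn: "0 \<le> \<Phi> s" for s unfolding \<Phi>_def using g_nonneg by (intro integral_nonneg_AE AE_I2) auto
  have lim: "log_limit L = m0 + \<sigma> / 2"
    unfolding log_limit_def m0_def m_def \<kappa>_def d_def \<sigma>_def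
    by (simp add: distrib_left sum.distrib sum_divide_distrib add_divide_distrib)
  note step = tilt_step[OF _ _ assms, folded \<Phi>_def, unfolded m]
  have "exp (m0 + \<sigma> / 2 - conv_const / L) * \<Phi> 0 \<le> \<Phi> 1"
    by (rule exponential_tilt_lower[OF c \<Phi>_nn]) (rule step)
  then show "exp (log_limit L - conv_const / L) * (\<integral>w. g (Y w) \<partial>P) \<le> (\<integral>w. exp (X i w) * g (Y w) \<partial>P)"
    unfolding lim \<Phi>_def by simp
  \<comment> \<open>Upper bound by reversing the tilt: in the parameter \<open>1 - s\<close> the
    drift starts at \<open>- (m0 + \<sigma>)\<close> and has the same slope
    \<open>\<sigma>\<close>.\<close>
  have "exp (- (m0 + \<sigma>) + \<sigma> / 2 - conv_const / L) * \<Phi> (1 - 0) \<le> \<Phi> (1 - 1)"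
  proof (rule exponential_tilt_lower[where \<Phi> = "\<lambda>s. \<Phi> (1 - s)", OF c \<Phi>_nn])
    fix s s' :: real assume s: "0 \<le> s" "s \<le> 1" "0 \<le> s'" "s' \<le> 1"
    have "(s' - s) * (- (m0 + \<sigma>) + s * \<sigma>) = ((1 - s') - (1 - s)) * (m0 + (1 - s) * \<sigma>)"
      by (simp add: algebra_simps)
    moreover have "\<bar>s' - s\<bar> = \<bar>(1 - s') - (1 - s)\<bar>" by simp
    ultimately show "exp ((s' - s) * (- (m0 + \<sigma>) + s * \<sigma>)) * \<Phi> (1 - s) * (1 - \<bar>s' - s\<bar> * (conv_const / L)) \<le> \<Phi> (1 - s')"
      using step[of "1 - s" "1 - s'"] s by simp
  qed
  then have "exp (m0 + \<sigma> / 2 + conv_const / L) * (exp (- (m0 + \<sigma>) + \<sigma> / 2 - conv_const / L) * \<Phi> 1)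
     \<le> exp (m0 + \<sigma> / 2 + conv_const / L) * \<Phi> 0"
    by (intro mult_left_mono) auto
  moreover have "exp (m0 + \<sigma> / 2 + conv_const / L) * (exp (- (m0 + \<sigma>) + \<sigma> / 2 - conv_const / L) * \<Phi> 1) = \<Phi> 1"
  proof -
    have "(m0 + \<sigma> / 2 + conv_const / L) + (- (m0 + \<sigma>) + \<sigma> / 2 - conv_const / L) = 0" by simp
    then show ?thesis unfolding mult.assoc[symmetric] exp_add[symmetric] by simp
  qed
  ultimately have "\<Phi> 1 \<le> exp (m0 + \<sigma> / 2 + conv_const / L) * \<Phi> 0" by linarith
  then show "(\<integral>w. exp (X i w) * g (Y w) \<partial>P) \<le> exp (log_limit L + conv_const / L) * (\<integral>w. g (Y w) \<partial>P)"
    unfolding lim \<Phi>_def by simp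
qed

end


context basket
begin

text \<open>Shrinking bumps ending at \<open>x\<close> give the pointwise value by continuity of
  \<open>E\<close>. The ratio bounds do not depend on the bump, so no rate of shrinking
  enters.\<close>

lemma conditional_mean_bounds:
  fixes E :: "real \<Rightarrow> real"
  assumes cont: "continuous_on {0<..} E"
    and int: "\<And>u v. 0 < u \<Longrightarrow> u < v \<Longrightarrow> integrable P (\<lambda>w. E (Y w) * bump u v (Y w))"
    and eq: "\<And>u v. 0 < u \<Longrightarrow> u < v \<Longrightarrow>
      (\<integral>w. E (Y w) * bump u v (Y w) \<partial>P) = (\<integral>w. exp (X i w) * bump u v (Y w) \<partial>P)"
    and L: "Lmin \<le> L"
  shows "exp (log_limit L - conv_const / L) \<le> E (exp (- L))"
    and "E (exp (- L)) \<le> exp (log_limit L + conv_const / L)"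
proof -
  define x where "x = exp (- L)"
  have x: "0 < x" unfolding x_def by simp
  have L2: "2 \<le> L" using L Lmin_pos by simp
  have *: "exp (log_limit L - conv_const / L) \<le> E x + \<eta> \<and> E x - \<eta> \<le> exp (log_limit L + conv_const / L)"
    if \<eta>: "0 < \<eta>" for \<eta>
  proof -
    have "isCont E x"
      using cont x by (simp add: continuous_on_eq_continuous_at)
    then obtain \<delta> where \<delta>: "0 < \<delta>" "\<And>y. \<bar>y - x\<bar> < \<delta> \<Longrightarrow> \<bar>E y - E x\<bar> < \<eta>"
      using \<eta> unfolding continuous_at_eps_delta dist_real_def by blast
    \<comment> \<open>The left end respects both the window of \<open>localized_ratio\<close> and
      the continuity radius; halving \<open>\<delta>\<close> makes the distance strict.\<close>
    define u where "u = max ((1 - 1 / L) * x) (x - \<delta> / 2)"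
    have "0 < (1 - 1 / L) * x" "(1 - 1 / L) * x < x" using L2 x by (auto simp: field_simps)
    then have u: "0 < u" "u < x" "(1 - 1 / L) * x \<le> u" "x - \<delta> / 2 \<le> u"
      unfolding u_def using \<delta>(1) by auto
    define N where "N = (\<integral>w. bump u x (Y w) \<partial>P)"
    have N: "0 < N" unfolding N_def by (rule integral_bump_positive[OF u(1,2)])
    have "(1 - 1 / L) * exp (- L) \<le> y \<and> y \<le> exp (- L)" if "bump u x y \<noteq> 0" for y
      using bump_support[OF u(2) that] u(3) unfolding x_def by linarith
    then have lo: "exp (log_limit L - conv_const / L) * N \<le> (\<integral>w. exp (X i w) * bump u x (Y w) \<partial>P)"
      and hi: "(\<integral>w. exp (X i w) * bump u x (Y w) \<partial>P) \<le> exp (log_limit L + conv_const / L) * N"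
      unfolding N_def
      by (intro localized_ratio[OF L bump_DERIV bump'_measurable bump_bounded[OF u(2)] bump_nonneg]; simp)+
    have ib: "integrable P (\<lambda>w. bump u x (Y w))"
      using has_grad_comp_Y[OF bump_DERIV bump'_measurable bump_bounded[OF u(2)]]
      unfolding has_grad_def by (auto intro: integrable_tame)
    have pw: "(E x - \<eta>) * bump u x (Y w) \<le> E (Y w) * bump u x (Y w)
        \<and> E (Y w) * bump u x (Y w) \<le> (E x + \<eta>) * bump u x (Y w)" for w
    proof (cases "bump u x (Y w) = 0")
      case False
      then have "\<bar>Y w - x\<bar> < \<delta>" using bump_support[OF u(2) False] u(4) \<delta>(1) by linarith
      then have "\<bar>E (Y w) - E x\<bar> < \<eta>" by (rule \<delta>(2))
      then show ?thesis using bump_nonneg by (auto intro!: mult_right_mono)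
    qed simp
    have "(E x - \<eta>) * N \<le> (\<integral>w. E (Y w) * bump u x (Y w) \<partial>P)"
      unfolding N_def integral_mult_right_zero[symmetric]
      by (rule integral_mono) (use pw ib int[OF u(1,2)] in auto)
    moreover have "(\<integral>w. E (Y w) * bump u x (Y w) \<partial>P) \<le> (E x + \<eta>) * N"
      unfolding N_def integral_mult_right_zero[symmetric]
      by (rule integral_mono) (use pw ib int[OF u(1,2)] in auto)
    ultimately have "exp (log_limit L - conv_const / L) * N \<le> (E x + \<eta>) * N"
      "(E x - \<eta>) * N \<le> exp (log_limit L + conv_const / L) * N"
      using lo hi unfolding eq[OF u(1,2)] by linarith+
    then show ?thesis using N by simp
  qed
  show "exp (log_limit L - conv_const / L) \<le> E (exp (- L))"
    unfolding x_def[symmetric] by (rule field_le_epsilon) (use * in simp)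
  show "E (exp (- L)) \<le> exp (log_limit L + conv_const / L)"
    unfolding x_def[symmetric]
  proof (rule field_le_epsilon)
    fix \<eta> :: real assume "0 < \<eta>"
    then show "E x \<le> exp (log_limit L + conv_const / L) + \<eta>" using *[of \<eta>] by linarith
  qed
qed

lemma conditional_mean_asymptotics:
  fixes E :: "real \<Rightarrow> real"
  assumes cont: "continuous_on {0<..} E"
    and int: "\<And>u v. 0 < u \<Longrightarrow> u < v \<Longrightarrow> integrable P (\<lambda>w. E (Y w) * bump u v (Y w))"
    and eq: "\<And>u v. 0 < u \<Longrightarrow> u < v \<Longrightarrow>
      (\<integral>w. E (Y w) * bump u v (Y w) \<partial>P) = (\<integral>w. exp (X i w) * bump u v (Y w) \<partial>P)"
  shows "(\<lambda>x. E x / exp (log_limit (ln (1 / x))) - 1) \<in> O[at_right 0](\<lambda>x. 1 / ln (1 / x))"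
proof (rule bigoI)
  \<comment> \<open>\<open>conv_const \<le> L\<close> keeps \<open>q\<close> in [0,1], where
    \<open>exp q \<le> 1 + 2 * q\<close>; this is the source of the factor 2 in the final
    constant.\<close>
  define L0 where "L0 = max Lmin conv_const"
  have c: "0 \<le> conv_const" unfolding conv_const_def by simp
  show "\<forall>\<^sub>F x in at_right 0. norm (E x / exp (log_limit (ln (1 / x))) - 1) \<le> (2 * conv_const) * norm (1 / ln (1 / x))"
    unfolding eventually_at_right_field
  proof (intro exI[of _ "exp (- L0)"] conjI allI impI)
    fix x :: real assume x: "0 < x" "x < exp (- L0)"
    define L where "L = ln (1 / x)"
    have xL: "x = exp (- L)" unfolding L_def using x(1) by (simp add: ln_div)
    have L: "L0 \<le> L" using x(2) unfolding xL by simp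
    then have LL: "Lmin \<le> L" "conv_const \<le> L" "0 < L" unfolding L0_def using Lmin_pos by auto
    define q where "q = conv_const / L"
    have q: "0 \<le> q" "q \<le> 1" unfolding q_def using c LL by auto
    define M where "M = exp (log_limit L)"
    have M: "0 < M" unfolding M_def by simp
    have b: "M * exp (- q) \<le> E x" "E x \<le> M * exp q"
      using conditional_mean_bounds[OF assms LL(1)] unfolding xL[symmetric] q_def[symmetric] M_def
      by (auto simp: exp_add[symmetric])
    have "exp (- q) \<le> E x / M" "E x / M \<le> exp q" using b M by (auto simp: field_simps)
    moreover have "1 - q \<le> exp (- q)" using exp_ge_add_one_self[of "- q"] by simp
    moreover have "exp q \<le> 1 + 2 * q"
    proof -
      have "exp q \<le> 1 + q + q\<^sup>2" using q by (intro exp_bound) auto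
      moreover have "q\<^sup>2 \<le> q" using q by (simp add: power2_eq_square mult_left_le)
      ultimately show ?thesis by linarith
    qed
    ultimately have "\<bar>E x / M - 1\<bar> \<le> 2 * q" using q by (simp add: abs_le_iff)
    then show "norm (E x / exp (log_limit (ln (1 / x))) - 1) \<le> (2 * conv_const) * norm (1 / ln (1 / x))"
      unfolding L_def[symmetric] M_def q_def using LL by simp
  qed simp
qed

end

context prob_space
begin

section \<open>Transfer to the given probability space\<close>

lemma indep_normal_distr:
  assumes n: "1 \<le> n" and \<sigma>: "0 < \<sigma>"
    and ind: "indep_vars (\<lambda>_. borel) W {..<n}"
    and dist: "\<And>j. j < n \<Longrightarrow> distributed M lborel (W j) (\<lambda>x. ennreal (normal_density 0 \<sigma> x))"
  shows "distr M (\<Pi>\<^sub>M j\<in>{..<n}. borel) (\<lambda>\<omega>. \<lambda>j\<in>{..<n}. W j \<omega>) = normal_product n \<sigma>"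
proof -
  have rv: "random_variable borel (W j)" if "j \<in> {..<n}" for j
    using distributed_measurable[OF dist[of j]] that by simp
  have "distr M (\<Pi>\<^sub>M j\<in>{..<n}. borel) (\<lambda>\<omega>. \<lambda>j\<in>{..<n}. W j \<omega>) = (\<Pi>\<^sub>M j\<in>{..<n}. distr M borel (W j))"
  proof (rule indep_vars_iff_distr_eq_PiM'[THEN iffD1])
    show "{..<n} \<noteq> {}" using n by (auto simp: lessThan_empty_iff)
  qed (fact rv ind)+
  also have "\<dots> = normal_product n \<sigma>"
    unfolding normal_product_def
  proof (rule PiM_cong[OF refl])
    fix j assume "j \<in> {..<n}"
    then have "distr M lborel (W j) = normal_measure \<sigma>"
      using dist[of j] by (intro distributed_distr_eq_density) auto
    moreover have "distr M borel (W j) = distr M lborel (W j)" by (rule distr_cong) auto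
    ultimately show "distr M borel (W j) = normal_measure \<sigma>" by simp
  qed
  finally show ?thesis .
qed

text \<open>\<open>\<phi> (Y \<omega>)\<close> is measurable for the sigma-algebra of
  \<open>Y\<close> and can be moved through the conditional expectation; with bumps for
  \<open>\<phi>\<close> this is all that is extracted from the conditional expectation.\<close>

lemma conditional_expectation_test:
  fixes Y S e \<phi> :: "_ \<Rightarrow> real"
  assumes Y: "Y \<in> borel_measurable M" and S: "S \<in> borel_measurable M"
    and e: "AE \<omega> in M. e (Y \<omega>) = real_cond_exp M (vimage_algebra (space M) Y borel) S \<omega>"
    and e_meas: "e \<in> borel_measurable borel" and \<phi>: "\<phi> \<in> borel_measurable borel"
    and int: "integrable M (\<lambda>\<omega>. \<phi> (Y \<omega>) * S \<omega>)"
  shows "integrable M (\<lambda>\<omega>. e (Y \<omega>) * \<phi> (Y \<omega>))"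
    and "(\<integral>\<omega>. e (Y \<omega>) * \<phi> (Y \<omega>) \<partial>M) = (\<integral>\<omega>. S \<omega> * \<phi> (Y \<omega>) \<partial>M)"
proof -
  define F where "F = vimage_algebra (space M) Y borel"
  have "subalgebra M F"
    unfolding subalgebra_def F_def using Y by (auto simp: sets_vimage_algebra2 intro: measurable_sets)
  then interpret finite_measure_subalgebra M F by unfold_locales
  have "Y \<in> borel_measurable F" unfolding F_def by (rule measurable_vimage_algebra1) simp
  then have m: "(\<lambda>\<omega>. \<phi> (Y \<omega>)) \<in> borel_measurable F" by (rule measurable_compose[OF _ \<phi>])
  note ce = real_cond_exp_intg[OF int m S]
  have ae: "AE \<omega> in M. \<phi> (Y \<omega>) * real_cond_exp M F S \<omega> = e (Y \<omega>) * \<phi> (Y \<omega>)"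
    using e unfolding F_def by eventually_elim simp
  have meas: "(\<lambda>\<omega>. e (Y \<omega>) * \<phi> (Y \<omega>)) \<in> borel_measurable M"
    using Y e_meas \<phi> by measurable
  have meas': "(\<lambda>\<omega>. \<phi> (Y \<omega>) * real_cond_exp M F S \<omega>) \<in> borel_measurable M"
    using ce(1) by (rule borel_measurable_integrable)
  show "integrable M (\<lambda>\<omega>. e (Y \<omega>) * \<phi> (Y \<omega>))"
    using ce(1) integrable_cong_AE[OF meas' meas ae] by simp
  show "(\<integral>\<omega>. e (Y \<omega>) * \<phi> (Y \<omega>) \<partial>M) = (\<integral>\<omega>. S \<omega> * \<phi> (Y \<omega>) \<partial>M)"
    using ce(2) integral_cong_AE[OF meas' meas ae] by (simp add: mult.commute)
qed

end


section \<open>The Black--Scholes basket\<close>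

lemma finite_positive_lower_bound:
  fixes g :: "'a \<Rightarrow> real"
  assumes "finite M" "\<And>k. k \<in> M \<Longrightarrow> 0 < g k"
  shows "\<exists>c>0. \<forall>k\<in>M. c \<le> g k"
proof (intro exI conjI ballI)
  \<comment> \<open>The inserted 1 covers an empty \<open>M\<close>, as when every asset is
    active.\<close>
  show "0 < Min (insert 1 (g ` M))" using assms by auto
  show "Min (insert 1 (g ` M)) \<le> g k" if "k \<in> M" for k using assms that by (intro Min_le) auto
qed

text \<open>Stationarity makes \<open>B w\<close> equal to the minimal variance on \<open>I\<close>.
  Hence \<open>w\<close> divided by that variance and the row sums \<open>A\<close> solve the same
  block system with right-hand side 1.\<close>

lemma active_inverse_sums:
  assumes B: "pos_def n B" and n: "1 \<le> n"
  defines "I \<equiv> support_set n B" and "w \<equiv> min_var_weights n B"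
  defines "A \<equiv> \<lambda>k. \<Sum>j\<in>I. restr_inv I B k j"
  shows "I \<subseteq> {..<n}"
    and "\<And>k. A k = w k / quad_form n B w"
    and "\<And>k. k \<in> I \<Longrightarrow> 0 < A k"
    and "(\<Sum>k\<in>I. A k) = 1 / quad_form n B w"
    and "\<And>k. k < n \<Longrightarrow> (\<Sum>j<n. B k j * A j) = (\<Sum>j<n. B k j * w j) / quad_form n B w"
proof -
  note ws = min_var_weights(1)[OF B n, folded w_def]
  note KKT = min_var_weights_KKT[OF B n, folded w_def]
  show I: "I \<subseteq> {..<n}" unfolding I_def support_set_def by auto
  have wI: "w k = 0" if "k \<notin> I" for k
    using that ws unfolding I_def support_set_def w_def std_simplex_def by (cases "k < n") (auto simp: not_less)
  have wpos: "0 < w k" if "k \<in> I" for k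
    using that ws unfolding I_def support_set_def w_def std_simplex_def by (auto simp: less_le)
  have sumI: "(\<Sum>k\<in>I. f k * w k) = (\<Sum>k<n. f k * w k)" for f
    using I wI by (intro sum.mono_neutral_left) auto
  show A: "A k = w k / quad_form n B w" for k
  proof (cases "k \<in> I")
    case True
    have "(\<Sum>k\<in>I. B i k * A k) = (\<Sum>k\<in>I. B i k * (w k / quad_form n B w))" if i: "i \<in> I" for i
    proof -
      have "(\<Sum>k\<in>I. B i k * A k) = (\<Sum>j\<in>I. \<Sum>k\<in>I. B i k * restr_inv I B k j)"
        unfolding A_def sum_distrib_left by (rule sum.swap)
      also have "\<dots> = (\<Sum>j\<in>I. if i = j then 1 else 0)"
        using i by (intro sum.cong refl restr_inv(1)[OF B I])
      also have "\<dots> = 1" using i finite_subset[OF I] by simp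
      also have "1 = (\<Sum>k\<in>I. B i k * w k) / quad_form n B w"
        using KKT(1) KKT(3)[of i] i I wpos[OF i] unfolding sumI by auto
      finally show ?thesis by (simp add: sum_divide_distrib)
    qed
    then show ?thesis using True by (rule pos_def_solution_unique[OF B I])
  next
    case False
    then show ?thesis unfolding A_def using restr_inv(2)[OF B I] wI by simp
  qed
  show "0 < A k" if "k \<in> I" for k unfolding A using wpos[OF that] KKT(1) by simp
  have "(\<Sum>k\<in>I. w k) = 1" using sumI[of "\<lambda>_. 1"] ws unfolding std_simplex_def by simp
  then show "(\<Sum>k\<in>I. A k) = 1 / quad_form n B w" unfolding A by (simp add: sum_divide_distrib[symmetric])
  show "(\<Sum>j<n. B k j * A j) = (\<Sum>j<n. B k j * w j) / quad_form n B w" for k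
    unfolding A by (simp add: sum_divide_distrib)
qed

text \<open>The expression in Assumption (A) is the slack of the stationarity inequality at
  \<open>i\<close>, so being nonzero means being positive.\<close>

lemma assumption_A_strict:
  assumes B: "pos_def n B" and n: "1 \<le> n" and A: "assumption_A n B"
    and i: "i < n" "i \<notin> support_set n B"
  shows "quad_form n B (min_var_weights n B) < (\<Sum>j<n. B i j * min_var_weights n B j)"
proof -
  define w where "w = min_var_weights n B"
  have "(\<Sum>j<n. \<Sum>k<n. ((if j = i then 1 else 0) - w j) * B j k * w k) = (\<Sum>k<n. B i k * w k) - quad_form n B w"
  proof -
    define y where "y j = (\<Sum>k<n. B j k * w k)" for j
    have "(\<Sum>j<n. \<Sum>k<n. ((if j = i then 1 else 0) - w j) * B j k * w k) = (\<Sum>j<n. (if j = i then y j else 0) - w j * y j)"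
      unfolding y_def by (intro sum.cong refl) (simp add: mult.assoc sum_distrib_left[symmetric] left_diff_distrib sum_subtractf)
    then show ?thesis using i unfolding quad_form_eq y_def[symmetric] by (simp add: sum_subtractf)
  qed
  moreover have "(\<Sum>j<n. \<Sum>k<n. ((if j = i then 1 else 0) - w j) * B j k * w k) \<noteq> 0"
    using A i unfolding assumption_A_def w_def by blast
  moreover have "quad_form n B w \<le> (\<Sum>k<n. B i k * w k)"
    using min_var_weights_KKT(2)[OF B n i(1)] unfolding w_def .
  ultimately show ?thesis unfolding w_def by linarith
qed

text \<open>\<open>d0\<close> and \<open>d1\<close> solve the block systems on \<open>I\<close> with
  right-hand sides \<open>ln (A q / Sbar) - \<mu> q\<close> and \<open>- (t * B q i)\<close>. This
  cancels the tilt on \<open>I\<close> and places the predicted fractions at the optimal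
  weights.\<close>

lemma basket_instance:
  fixes n :: nat and B :: "nat \<Rightarrow> nat \<Rightarrow> real" and \<mu> :: "nat \<Rightarrow> real"
  assumes B: "pos_def n B" and n: "1 \<le> n" and t: "0 < t" and asmA: "assumption_A n B" and i: "i < n"
  defines "I \<equiv> support_set n B"
  defines "a \<equiv> restr_inv I B"
  defines "A \<equiv> \<lambda>k. \<Sum>j\<in>I. a k j"
  defines "Sbar \<equiv> \<Sum>k\<in>I. A k"
  defines "\<beta> \<equiv> \<lambda>k. \<Sum>l<n. B k l * A l"
  defines "d0 \<equiv> \<lambda>p. \<Sum>q\<in>I. a p q * (ln (A q / Sbar) - \<mu> q)"
  defines "d1 \<equiv> \<lambda>p. - (\<Sum>q\<in>I. a p q * (t * B q i))"
  obtains K D b \<beta>m Am f where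
    "basket n t (mat_sqrt n B) B K \<mu> I A \<beta> Sbar D b \<beta>m Am i d0 d1 f"
proof -
  note act = active_inverse_sums[OF B n, folded I_def, folded a_def]
  note I = act(1)
  have A_pos: "0 < A k" if "k \<in> I" for k unfolding A_def by (rule act(3)[OF that])
  define w where "w = min_var_weights n B"
  define lam where "lam = quad_form n B w"
  note KKT = min_var_weights_KKT[OF B n, folded w_def, folded lam_def]
  have Sb: "Sbar = 1 / lam" unfolding Sbar_def A_def lam_def w_def by (rule act(4))
  have fin: "finite I" using I finite_subset by blast
  have a_off: "a p q = 0" if "p \<notin> I \<or> q \<notin> I" for p q
    unfolding a_def by (rule restr_inv(2)[OF B I that])
  have Ba: "(\<Sum>p\<in>I. B k p * a p q) = (if k = q then 1 else 0)" if "k \<in> I" "q \<in> I" for k q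
    unfolding a_def by (rule restr_inv(1)[OF B I that])
  have sumI: "(\<Sum>l<n. B k l * h l) = (\<Sum>l\<in>I. B k l * h l)" if "\<And>l. l \<notin> I \<Longrightarrow> h l = 0" for k h
    using I that by (intro sum.mono_neutral_right) auto
  have Bsol: "(\<Sum>l<n. B k l * (\<Sum>q\<in>I. a l q * z q)) = z k" if k: "k \<in> I" for k z
  proof -
    have "(\<Sum>l<n. B k l * (\<Sum>q\<in>I. a l q * z q)) = (\<Sum>l\<in>I. \<Sum>q\<in>I. B k l * a l q * z q)"
      by (subst sumI) (auto simp: a_off sum_distrib_left mult.assoc)
    also have "\<dots> = (\<Sum>q\<in>I. (\<Sum>l\<in>I. B k l * a l q) * z q)"
      by (subst sum.swap) (simp add: sum_distrib_right)
    also have "\<dots> = (\<Sum>q\<in>I. if k = q then z q else 0)"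
      using k by (intro sum.cong refl) (simp add: Ba)
    finally show ?thesis using k fin by simp
  qed
  have d_off: "d0 k = 0 \<and> d1 k = 0" if "k \<notin> I" for k
    unfolding d0_def d1_def using a_off that by simp
  have \<beta>: "\<beta> k = (\<Sum>j<n. B k j * w j) / lam" if "k < n" for k
    unfolding \<beta>_def A_def lam_def w_def by (rule act(5)[OF that])
  obtain K where K: "sym_mat n K" "\<And>v. 0 \<le> quad_form n K v"
    "\<And>i j. i < n \<Longrightarrow> j < n \<Longrightarrow> (\<Sum>k<n. K i k * B k j) = of_bool (i = j)"
    by (rule pos_def_inverse[OF B]) blast
  have "\<exists>c>0. \<forall>k\<in>I. c \<le> A k"
    by (rule finite_positive_lower_bound[OF fin]) (rule A_pos)
  then obtain Am where Am: "0 < Am" "\<And>k. k \<in> I \<Longrightarrow> Am \<le> A k"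
    by blast
  obtain b where b: "0 < b" "\<And>k. k \<in> {..<n} - I \<Longrightarrow> b \<le> \<beta> k - 1"
  proof -
    have "0 < \<beta> k - 1" if k: "k \<in> {..<n} - I" for k
    proof -
      have "lam < (\<Sum>j<n. B k j * w j)"
        using assumption_A_strict[OF B n asmA, of k] k unfolding lam_def w_def I_def by simp
      then show ?thesis using \<beta>[of k] k KKT(1) by simp
    qed
    then have "\<exists>c>0. \<forall>k\<in>{..<n} - I. c \<le> \<beta> k - 1"
      by (intro finite_positive_lower_bound) auto
    then show thesis using that by blast
  qed
  define \<beta>m where "\<beta>m = 1 + (\<Sum>k<n. \<bar>\<beta> k\<bar>)"
  define \<kappa> where "\<kappa> s k = \<mu> k + s * t * B k i + (\<Sum>l<n. B k l * (d0 l + s * d1 l))" for s k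
  \<comment> \<open>Bounds both \<open>\<kappa> s k\<close> and the correction at \<open>k\<close>,
    uniformly in \<open>s\<close> between 0 and 1.\<close>
  define Dk where "Dk k = \<bar>\<mu> k\<bar> + \<bar>t * B k i\<bar> + (\<Sum>l<n. \<bar>B k l\<bar> * (\<bar>d0 l\<bar> + \<bar>d1 l\<bar>)) + \<bar>d0 k\<bar> + \<bar>d1 k\<bar>" for k
  define D where "D = (\<Sum>k<n. Dk k)"
  have Dk_nn: "0 \<le> Dk k" for k unfolding Dk_def by (simp add: sum_nonneg add_nonneg_nonneg)
  have Dk: "Dk k \<le> D" if "k < n" for k unfolding D_def using that Dk_nn by (intro member_le_sum) auto
  have ds: "\<bar>d0 k + s * d1 k\<bar> \<le> \<bar>d0 k\<bar> + \<bar>d1 k\<bar>" if "0 \<le> s" "s \<le> 1" for s k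
  proof -
    have "\<bar>s * d1 k\<bar> \<le> 1 * \<bar>d1 k\<bar>" unfolding abs_mult using that by (intro mult_right_mono) auto
    then show ?thesis by linarith
  qed
  \<comment> \<open>The unit vector \<open>j\<close> minus its regression coefficients on
    \<open>I\<close>, the block inverse applied to column \<open>j\<close> of
    \<open>B\<close>.\<close>
  define f where "f j k = (if k = j then 1 else 0) - (\<Sum>p\<in>I. a k p * B p j)" for j k
  have "basket n t (mat_sqrt n B) B K \<mu> I A \<beta> Sbar D b \<beta>m Am i d0 d1 f"
  proof unfold_locales
    show "0 < t" by (rule t)
    show "(\<Sum>k<n. mat_sqrt n B i k * mat_sqrt n B j k) = B i j" if "i < n" "j < n" for i j
      by (rule mat_sqrt[OF B that])
    show "(\<Sum>k<n. K i k * B k j) = (if i = j then 1 else 0)" if "i < n" "j < n" for i j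
      using K(3)[OF that] by simp
    show "I \<subseteq> {..<n}" by (rule I)
    show "Sbar = (\<Sum>k\<in>I. A k)" unfolding Sbar_def ..
    show "0 < Sbar" unfolding Sb using KKT(1) by simp
    show "0 < Am" "\<And>k. k \<in> I \<Longrightarrow> Am \<le> A k" by (rule Am)+
    show "0 \<le> D" unfolding D_def using Dk_nn by (simp add: sum_nonneg)
    show "0 < b" by (rule b)
    show "\<beta> k = 1" if "k \<in> I" for k
    proof -
      have "k < n" "w k \<noteq> 0" using that unfolding I_def support_set_def w_def by auto
      then show ?thesis using \<beta> KKT(1,3) by simp
    qed
    show "1 + b \<le> \<beta> k" if "k < n" "k \<notin> I" for k using b(2)[of k] that by simp
    show "1 \<le> \<beta>m" unfolding \<beta>m_def by (simp add: sum_nonneg)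
    show "\<beta> k \<le> \<beta>m" if "k < n" for k
    proof -
      have "\<bar>\<beta> k\<bar> \<le> (\<Sum>k<n. \<bar>\<beta> k\<bar>)" using that by (intro member_le_sum) auto
      then show ?thesis unfolding \<beta>m_def by linarith
    qed
    show "i < n" by (rule i)
    show "sym_mat n B" using B unfolding pos_def_def by simp
    show "sym_mat n K" by (rule K)
    show "0 \<le> quad_form n K v" for v by (rule K)
    show "A k = 0" if "k < n" "k \<notin> I" for k unfolding A_def using a_off that by simp
    show "\<beta> k = (\<Sum>l<n. B k l * A l)" for k by (simp add: \<beta>_def)
    show "d0 k = 0 \<and> d1 k = 0" if "k < n" "k \<notin> I" for k by (rule d_off[OF that(2)])
    show "\<bar>d0 k + s * d1 k\<bar> \<le> D" if "0 \<le> s" "s \<le> 1" "k \<in> I" for s k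
    proof -
      have "\<bar>d0 k\<bar> + \<bar>d1 k\<bar> \<le> Dk k" unfolding Dk_def by (simp add: sum_nonneg)
      then show ?thesis using ds[OF that(1,2), of k] Dk[of k] that(3) I by force
    qed
    show "\<mu> k + s * t * B k i + (\<Sum>l<n. B k l * (d0 l + s * d1 l)) = ln (A k / Sbar)" if "k \<in> I" for s k
    proof -
      have "(\<Sum>l<n. B k l * (d0 l + s * d1 l)) = (\<Sum>l<n. B k l * d0 l) - s * (\<Sum>l<n. B k l * (\<Sum>q\<in>I. a l q * (t * B q i)))"
      proof -
        have "(\<Sum>l<n. B k l * (d0 l + s * - z l)) = (\<Sum>l<n. B k l * d0 l) - s * (\<Sum>l<n. B k l * z l)" for z
          by (simp add: algebra_simps sum_subtractf sum_distrib_left)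
        then show ?thesis unfolding d1_def .
      qed
      also have "\<dots> = (ln (A k / Sbar) - \<mu> k) - s * (t * B k i)"
        unfolding d0_def Bsol[OF that] ..
      finally show ?thesis by simp
    qed
    show "\<bar>\<mu> k + s * t * B k i + (\<Sum>l<n. B k l * (d0 l + s * d1 l))\<bar> \<le> D" if s: "0 \<le> s" "s \<le> 1" and k: "k < n" for s k
    proof -
      have "\<bar>\<Sum>l<n. B k l * (d0 l + s * d1 l)\<bar> \<le> (\<Sum>l<n. \<bar>B k l * (d0 l + s * d1 l)\<bar>)" by (rule sum_abs)
      also have "\<dots> \<le> (\<Sum>l<n. \<bar>B k l\<bar> * (\<bar>d0 l\<bar> + \<bar>d1 l\<bar>))"
        unfolding abs_mult by (intro sum_mono mult_left_mono ds s) auto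
      finally have 1: "\<bar>\<Sum>l<n. B k l * (d0 l + s * d1 l)\<bar> \<le> (\<Sum>l<n. \<bar>B k l\<bar> * (\<bar>d0 l\<bar> + \<bar>d1 l\<bar>))" .
      have "\<bar>s * (t * B k i)\<bar> \<le> 1 * \<bar>t * B k i\<bar>" unfolding abs_mult[of s] using s by (intro mult_right_mono) auto
      then have 2: "\<bar>s * t * B k i\<bar> \<le> \<bar>t * B k i\<bar>" by (simp add: mult.assoc)
      have "\<bar>\<mu> k + s * t * B k i + (\<Sum>l<n. B k l * (d0 l + s * d1 l))\<bar> \<le> Dk k"
        unfolding Dk_def using 1 2 by linarith
      then show ?thesis using Dk[OF k] by linarith
    qed
    show "f j j = 1" if "j < n" "j \<notin> I" for j unfolding f_def using a_off that by simp
    show "f j k = 0" if "j < n" "j \<notin> I" "k < n" "k \<notin> I" "k \<noteq> j" for j k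
      unfolding f_def using a_off that by simp
    show "(\<Sum>l<n. B k l * f j l) = 0" if "j < n" "j \<notin> I" "k \<in> I" for j k
    proof -
      have "(\<Sum>l<n. B k l * f j l) = (\<Sum>l<n. B k l * (if l = j then 1 else 0)) - (\<Sum>l<n. B k l * (\<Sum>p\<in>I. a l p * B p j))"
        unfolding f_def by (simp add: right_diff_distrib sum_subtractf)
      also have "(\<Sum>l<n. B k l * (\<Sum>p\<in>I. a l p * B p j)) = B k j" by (rule Bsol[OF that(3)])
      finally show ?thesis using that(1) by (simp add: if_distrib[of "(*) _"] cong: if_cong)
    qed
  qed
  then show thesis by (rule that)
qed

theorem theorem4:
  fixes M :: "'a measure"
    and n :: nat and t :: real
    and B :: "nat \<Rightarrow> nat \<Rightarrow> real"
    and \<theta> S0 \<xi> :: "nat \<Rightarrow> real"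
    and W :: "nat \<Rightarrow> 'a \<Rightarrow> real"
    and S :: "nat \<Rightarrow> 'a \<Rightarrow> real"
    and Y :: "'a \<Rightarrow> real"
    and e :: "nat \<Rightarrow> real \<Rightarrow> real"
  assumes "prob_space M"
    and "1 \<le> n"
    and "0 < t"
    and "pos_def n B"
    and "\<forall>i<n. 0 < S0 i"
    and "\<forall>i<n. 0 < \<xi> i"
    and "assumption_A n B"
    \<comment> \<open>W is W_t: independent components, each normal with mean 0 and variance t\<close>
    and "prob_space.indep_vars M (\<lambda>_. borel) W {..<n}"
    and "\<forall>j<n. distributed M lborel (W j) (\<lambda>x. ennreal (normal_density 0 (sqrt t) x))"
    and "\<forall>i<n. \<forall>\<omega>. S i \<omega> = exp (ln (S0 i) + \<theta> i * t - t / 2 * B i i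
                    + (\<Sum>j<n. mat_sqrt n B i j * W j \<omega>))"
    and "\<forall>\<omega>. Y \<omega> = (\<Sum>k<n. \<xi> k * S k \<omega>)"
    \<comment> \<open>e i is the continuous version of x \<mapsto> E[S_i | Y = x]\<close>
    and "\<forall>i<n. e i \<in> borel_measurable borel \<and> continuous_on {0<..} (e i)
            \<and> (AE \<omega> in M. e i (Y \<omega>) = real_cond_exp M (vimage_algebra (space M) Y borel) (S i) \<omega>)"
  shows "let wbar = min_var_weights n B; I = support_set n B; a = restr_inv I B;
             A = (\<lambda>k. \<Sum>j\<in>I. a k j); Sbar = (\<Sum>k\<in>I. A k);
             \<mu> = (\<lambda>q. ln (S0 q) + ln \<bar>\<xi> q\<bar> + \<theta> q * t - B q q * t / 2)
         in (\<forall>i\<in>I.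
               (\<lambda>x. e i x / (x / \<xi> i * (A i / Sbar)) - 1) \<in> O[at_right 0](\<lambda>x. 1 / ln (1 / x))
             \<and> (\<lambda>x. e i x / (x * wbar i / \<xi> i) - 1) \<in> O[at_right 0](\<lambda>x. 1 / ln (1 / x)))
          \<and> (\<forall>i<n. i \<notin> I \<longrightarrow>
               (\<lambda>x. e i x / (x powr (\<Sum>j\<in>I. A j * B i j) * S0 i
                   * exp (\<theta> i * t - (\<Sum>p\<in>I. \<Sum>q\<in>I. B p i * a p q * (ln (Sbar / A q) + \<mu> q)))
                   * exp (- t / 2 * (\<Sum>p\<in>I. \<Sum>q\<in>I. a p q * B p i * B q i))) - 1)
                 \<in> O[at_right 0](\<lambda>x. 1 / ln (1 / x)))"
proof -
  interpret prob_space M by fact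
  note n = assms(2) and t = assms(3) and B = assms(4)
  define I where "I = support_set n B"
  define a where "a = restr_inv I B"
  define A where "A = (\<lambda>k. \<Sum>j\<in>I. a k j)"
  define Sb where "Sb = (\<Sum>k\<in>I. A k)"
  define \<mu> where "\<mu> = (\<lambda>q. ln (S0 q) + ln \<bar>\<xi> q\<bar> + \<theta> q * t - B q q * t / 2)"
  define T where "T = (\<lambda>i x. if i \<in> I then x / \<xi> i * (A i / Sb) else x powr (\<Sum>j\<in>I. A j * B i j) * S0 i
                   * exp (\<theta> i * t - (\<Sum>p\<in>I. \<Sum>q\<in>I. B p i * a p q * (ln (Sb / A q) + \<mu> q)))
                   * exp (- t / 2 * (\<Sum>p\<in>I. \<Sum>q\<in>I. a p q * B p i * B q i)))"
  have I: "I \<subseteq> {..<n}" unfolding I_def support_set_def by auto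
  have B_sym: "B i j = B j i" if "i < n" "j < n" for i j
    using B that unfolding pos_def_def sym_mat_def by simp
  note act = active_inverse_sums[OF B n, folded I_def, folded a_def]
  have A_pos: "0 < A k" if "k \<in> I" for k unfolding A_def by (rule act(3)[OF that])
  have lam: "0 < quad_form n B (min_var_weights n B)" by (rule min_var_weights_KKT(1)[OF B n])
  have Sb: "Sb = 1 / quad_form n B (min_var_weights n B)"
    unfolding Sb_def A_def by (rule act(4))
  have Sb_pos: "0 < Sb" unfolding Sb using lam by simp
  have wbar: "A k / Sb = min_var_weights n B k" for k
  proof -
    have "A k = min_var_weights n B k / quad_form n B (min_var_weights n B)"
      unfolding A_def by (rule act(2))
    then show ?thesis unfolding Sb using lam by simp
  qed
  \<comment> \<open>The restriction makes the values points of the product space, whose functions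
    are \<open>undefined\<close> off the index set; \<open>X\<close> and \<open>Y\<close> read
    indices below \<open>n\<close> only.\<close>
  define W' where "W' \<omega> = (\<lambda>j\<in>{..<n}. W j \<omega>)" for \<omega>
  have W'_distr: "distr M (\<Pi>\<^sub>M j\<in>{..<n}. borel) W' = normal_product n (sqrt t)"
    unfolding W'_def using t assms(9) by (intro indep_normal_distr n assms(8)) auto
  have W'_meas: "W' \<in> M \<rightarrow>\<^sub>M (\<Pi>\<^sub>M j\<in>{..<n}. borel)"
    unfolding W'_def
  proof (rule measurable_restrict)
    show "W j \<in> borel_measurable M" if "j \<in> {..<n}" for j
      using distributed_measurable[of M lborel "W j"] assms(9) that by auto
  qed
  have main: "(\<lambda>x. e i x / T i x - 1) \<in> O[at_right 0](\<lambda>x. 1 / ln (1 / x))" if i: "i < n" for i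
  proof -
    define \<beta> where "\<beta> = (\<lambda>k. \<Sum>l<n. B k l * A l)"
    define d0 where "d0 = (\<lambda>p. \<Sum>q\<in>I. a p q * (ln (A q / Sb) - \<mu> q))"
    define d1 where "d1 = (\<lambda>p. - (\<Sum>q\<in>I. a p q * (t * B q i)))"
    obtain K D b \<beta>m Am f where
      "basket n t (mat_sqrt n B) B K \<mu> I A \<beta> Sb D b \<beta>m Am i d0 d1 f"
      unfolding I_def a_def A_def Sb_def \<beta>_def d0_def d1_def
      by (rule basket_instance[OF B n t assms(7) i])
    then interpret bk: basket n t "mat_sqrt n B" B K \<mu> I A \<beta> Sb D b \<beta>m Am i d0 d1 f .
    have \<xi>: "0 < \<xi> k" "0 < S0 k" if "k < n" for k using assms(5,6) that by auto
    have X: "exp (bk.X k (W' \<omega>)) = \<xi> k * S k \<omega>" if k: "k < n" for k \<omega>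
    proof -
      have "bk.X k (W' \<omega>) = ln (\<xi> k) + (ln (S0 k) + \<theta> k * t - t / 2 * B k k + (\<Sum>j<n. mat_sqrt n B k j * W j \<omega>))"
        unfolding bk.X_def unfolding \<mu>_def W'_def using \<xi>[OF k] by simp
      then show ?thesis using assms(10) k \<xi>[OF k] by (simp add: exp_add)
    qed
    have Y: "bk.Y (W' \<omega>) = Y \<omega>" for \<omega>
      unfolding bk.Y_def using assms(11) X by simp
    have transfer: "integrable bk.P h \<longleftrightarrow> integrable M (\<lambda>\<omega>. h (W' \<omega>))"
      "(\<integral>w. h w \<partial>bk.P) = (\<integral>\<omega>. h (W' \<omega>) \<partial>M)"
      if "h \<in> borel_measurable (\<Pi>\<^sub>M j\<in>{..<n}. borel)" for h :: "_ \<Rightarrow> real"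
      unfolding W'_distr[symmetric] using W'_meas that by (auto simp: integrable_distr_eq integral_distr)
    have Y_meas0: "bk.Y \<in> borel_measurable (\<Pi>\<^sub>M j\<in>{..<n}. borel)"
      using bk.tame_Y unfolding bk.tame_def by simp
    have Y_meas: "Y \<in> borel_measurable M"
      using measurable_compose[OF W'_meas Y_meas0] unfolding Y .
    have X_meas0: "(\<lambda>w. exp (bk.X i w)) \<in> borel_measurable (\<Pi>\<^sub>M j\<in>{..<n}. borel)"
      using bk.tame_exp_X1[OF i] unfolding bk.tame_def by simp
    have "(\<lambda>\<omega>. \<xi> i * S i \<omega>) \<in> borel_measurable M"
      using measurable_compose[OF W'_meas X_meas0] unfolding X[OF i] .
    then have "(\<lambda>\<omega>. (1 / \<xi> i) * (\<xi> i * S i \<omega>)) \<in> borel_measurable M"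
      by (rule borel_measurable_times[OF borel_measurable_const])
    then have S_meas: "S i \<in> borel_measurable M" using \<xi>[OF i] by simp
    have e_meas: "e i \<in> borel_measurable borel" and e_cont: "continuous_on {0<..} (e i)"
      and e_ae: "AE \<omega> in M. e i (Y \<omega>) = real_cond_exp M (vimage_algebra (space M) Y borel) (S i) \<omega>"
      using assms(12) i by auto
    have bump_meas: "bump u v \<in> borel_measurable borel" for u v
      unfolding bump_def by measurable
    have test: "integrable bk.P (\<lambda>w. \<xi> i * e i (bk.Y w) * bump u v (bk.Y w))"
      "(\<integral>w. \<xi> i * e i (bk.Y w) * bump u v (bk.Y w) \<partial>bk.P) = (\<integral>w. exp (bk.X i w) * bump u v (bk.Y w) \<partial>bk.P)"
      if uv: "0 < u" "u < v" for u v
    proof -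
      have tb: "bk.tame (\<lambda>w. bump u v (bk.Y w))"
        using bk.has_grad_comp_Y[OF bump_DERIV bump'_measurable bump_bounded[OF uv(2)]]
        unfolding bk.has_grad_def by auto
      have tS: "bk.tame (\<lambda>w. exp (bk.X i w) * bump u v (bk.Y w))"
        by (intro bk.tame_mult bk.tame_exp_X1 i tb)
      then have mS: "(\<lambda>w. exp (bk.X i w) * bump u v (bk.Y w)) \<in> borel_measurable (\<Pi>\<^sub>M j\<in>{..<n}. borel)"
        unfolding bk.tame_def by simp
      have me: "(\<lambda>w. \<xi> i * e i (bk.Y w) * bump u v (bk.Y w)) \<in> borel_measurable (\<Pi>\<^sub>M j\<in>{..<n}. borel)"
        using Y_meas0 e_meas bump_meas by measurable
      have "integrable M (\<lambda>\<omega>. \<xi> i * S i \<omega> * bump u v (Y \<omega>))"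
        using bk.integrable_tame[OF tS] unfolding transfer[OF mS] X[OF i] Y .
      then have "integrable M (\<lambda>\<omega>. (1 / \<xi> i) * (\<xi> i * S i \<omega> * bump u v (Y \<omega>)))"
        by (rule integrable_mult_right)
      then have iS: "integrable M (\<lambda>\<omega>. bump u v (Y \<omega>) * S i \<omega>)"
        using \<xi>[OF i] by (simp add: mult.commute)
      note ce = conditional_expectation_test[OF Y_meas S_meas e_ae e_meas bump_meas iS]
      show "integrable bk.P (\<lambda>w. \<xi> i * e i (bk.Y w) * bump u v (bk.Y w))"
        unfolding transfer[OF me] Y using ce(1) by (simp add: mult.assoc)
      show "(\<integral>w. \<xi> i * e i (bk.Y w) * bump u v (bk.Y w) \<partial>bk.P) = (\<integral>w. exp (bk.X i w) * bump u v (bk.Y w) \<partial>bk.P)"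
        unfolding transfer[OF me] transfer[OF mS] X[OF i] Y using ce(2) by (simp add: mult.assoc)
    qed
    have "(\<lambda>x. \<xi> i * e i x / exp (bk.log_limit (ln (1 / x))) - 1) \<in> O[at_right 0](\<lambda>x. 1 / ln (1 / x))"
      by (rule bk.conditional_mean_asymptotics) (use test e_cont in \<open>auto intro!: continuous_intros\<close>)
    moreover have "\<forall>\<^sub>F x in at_right 0. \<xi> i * e i x / exp (bk.log_limit (ln (1 / x))) - 1 = e i x / T i x - 1"
      unfolding eventually_at_right_field
    proof (intro exI[of _ 1] conjI allI impI)
      fix x :: real assume x: "0 < x" "x < 1"
      have lx: "ln (1 / x) = - ln x" using x by (simp add: ln_div)
      have "exp (bk.log_limit (- ln x)) = \<xi> i * T i x"
      proof (cases "i \<in> I")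
        case True
        \<comment> \<open>At \<open>s = 1 / 2\<close> the corrections cancel on the support, where
          moreover the exponent \<open>\<beta> i\<close> is 1.\<close>
        have "bk.log_limit (- ln x) = ln (A i / Sb) + ln x"
          unfolding bk.log_limit_def using bk.\<kappa>_I[OF True, of "1 / 2"] bk.\<beta>I[OF True] by simp
        then show ?thesis
          using True x A_pos[OF True] Sb_pos \<xi>[OF i] unfolding T_def by (simp add: exp_add)
      next
        case False
        define E1 where "E1 = (\<Sum>p\<in>I. \<Sum>q\<in>I. B p i * a p q * (ln (Sb / A q) + \<mu> q))"
        define E2 where "E2 = (\<Sum>p\<in>I. \<Sum>q\<in>I. a p q * B p i * B q i)"
        have off: "d0 l + d1 l / 2 = 0" "A l = 0" if "l < n" "l \<notin> I" for l
          using bk.d_off[OF that] bk.A_off[OF that] by auto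
        have "(\<Sum>l<n. B i l * (d0 l + d1 l / 2)) = (\<Sum>p\<in>I. B i p * (d0 p + d1 p / 2))"
          using I off by (intro sum.mono_neutral_right) auto
        also have "\<dots> = (\<Sum>p\<in>I. \<Sum>q\<in>I. - (B p i * a p q * (ln (Sb / A q) + \<mu> q)) - t / 2 * (a p q * B p i * B q i))"
        proof (rule sum.cong[OF refl])
          fix p assume p: "p \<in> I"
          have "B i p = B p i" using B_sym[of i p] i p I by auto
          moreover have "d0 p + d1 p / 2 = (\<Sum>q\<in>I. a p q * (ln (A q / Sb) - \<mu> q) - a p q * (t * B q i) / 2)"
            unfolding d0_def d1_def by (simp add: sum_subtractf sum_divide_distrib)
          moreover have "ln (A q / Sb) = - ln (Sb / A q)" if "q \<in> I" for q
            using A_pos[OF that] Sb_pos by (simp add: ln_div)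
          ultimately show "B i p * (d0 p + d1 p / 2) = (\<Sum>q\<in>I. - (B p i * a p q * (ln (Sb / A q) + \<mu> q)) - t / 2 * (a p q * B p i * B q i))"
            by (simp add: sum_distrib_left) (intro sum.cong refl, simp add: algebra_simps)
        qed
        also have "\<dots> = - E1 - t / 2 * E2"
          unfolding E1_def E2_def by (simp add: sum_subtractf sum_negf sum_distrib_left)
        finally have s: "(\<Sum>l<n. B i l * (d0 l + d1 l / 2)) = - E1 - t / 2 * E2" .
        have \<beta>: "\<beta> i = (\<Sum>j\<in>I. A j * B i j)"
        proof -
          have "\<beta> i = (\<Sum>j\<in>I. B i j * A j)"
            unfolding \<beta>_def using I off by (intro sum.mono_neutral_right) auto
          then show ?thesis by (simp add: mult.commute)
        qed
        \<comment> \<open>The term \<open>t * B i i / 2\<close> of \<open>log_limit\<close> cancels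
          the Ito correction in \<open>\<mu> i\<close>, and \<open>ln (\<xi> i)\<close> splits off
          as the factor between \<open>e i\<close> and the conditional mean of
          \<open>exp (X i)\<close>.\<close>
        have "bk.log_limit (- ln x) = ln (\<xi> i) + (\<beta> i * ln x + ln (S0 i) + (\<theta> i * t - E1) + (- t / 2 * E2))"
          unfolding bk.log_limit_def s unfolding \<mu>_def using \<xi>[OF i] by simp
        also have "exp \<dots> = \<xi> i * (x powr \<beta> i * S0 i * exp (\<theta> i * t - E1) * exp (- t / 2 * E2))"
          using \<xi>[OF i] x by (simp only: exp_add exp_ln powr_def) simp
        finally show ?thesis using False unfolding T_def E1_def E2_def \<beta> by simp
      qed
      then show "\<xi> i * e i x / exp (bk.log_limit (ln (1 / x))) - 1 = e i x / T i x - 1"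
        unfolding lx using \<xi>[OF i] by simp
    qed simp
    ultimately show ?thesis by (subst (asm) landau_o.big.in_cong)
  qed
  have 1: "(\<lambda>x. e i x / (x / \<xi> i * (A i / Sb)) - 1) \<in> O[at_right 0](\<lambda>x. 1 / ln (1 / x))"
      "(\<lambda>x. e i x / (x * min_var_weights n B i / \<xi> i) - 1) \<in> O[at_right 0](\<lambda>x. 1 / ln (1 / x))" if "i \<in> I" for i
  proof -
    show *: "(\<lambda>x. e i x / (x / \<xi> i * (A i / Sb)) - 1) \<in> O[at_right 0](\<lambda>x. 1 / ln (1 / x))"
      using main[of i] that I unfolding T_def by auto
    then show "(\<lambda>x. e i x / (x * min_var_weights n B i / \<xi> i) - 1) \<in> O[at_right 0](\<lambda>x. 1 / ln (1 / x))"
      unfolding wbar by simp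
  qed
  have 2: "(\<lambda>x. e i x / (x powr (\<Sum>j\<in>I. A j * B i j) * S0 i
                   * exp (\<theta> i * t - (\<Sum>p\<in>I. \<Sum>q\<in>I. B p i * a p q * (ln (Sb / A q) + \<mu> q)))
                   * exp (- t / 2 * (\<Sum>p\<in>I. \<Sum>q\<in>I. a p q * B p i * B q i))) - 1)
                 \<in> O[at_right 0](\<lambda>x. 1 / ln (1 / x))" if "i < n" "i \<notin> I" for i
    using main[OF that(1)] that(2) unfolding T_def by simp
  show ?thesis
    unfolding Let_def using 1 2 unfolding \<mu>_def Sb_def A_def a_def I_def by blast
qed

end
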